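(* Consider the model of $L$ independent parallel scalar complex fast fading channels described in the context. Let $\epsilon>0$ be fixed and let $\delta^*(n,\epsilon)$ be the supremum of the NLDs of $nL$ complex-dimensional infinite constellations (transmitted over $n$ uses of the parallel model) with average error probability at most $\epsilon$. Then, as $n\to\infty$, $$\delta^*(n,\epsilon)=\delta^*-\sqrt{\frac Vn}Q^{-1}(\epsilon)+O\!\left(\frac{\ln n}{n}\right),$$ where $\delta^*=E\{\ln\det(\frac{\mathbf H^\dagger\mathbf H}{\pi e\sigma^2})\}$ and $V=L+\mathrm{Var}(\ln\det(\mathbf H^\dagger\mathbf H))$, with $\mathbf H=\mathrm{diag}(H^{(1)},\dots,H^{(L)})$.
   Context: Model: $\mathbf y=\mathbf H\mathbf x+\mathbf z$ with $\mathbf x,\mathbf y,\mathbf z\in\mathbb C^L$, $\mathbf H=\mathrm{diag}(H^{(1)},\dots,H^{(L)})$ with $H^{(l)}$ i.i.d. circularly symmetric $CN(0,1)$, $\mathbf z\sim CN(0,\sigma^2I_L)$; channel uses are i.i.d. (fast fading) and the receiver knows $\mathbf H$ at each use. An IC of complex dimension $nL$ is a countable $S\subset\mathbb C^{nL}$ with density $\gamma=\limsup_a|S\cap\mathrm{Cb}(a)|/a^{2nL}$, $\mathrm{Cb}(a)=\{|\mathrm{Re}x_i|,|\mathrm{Im}x_i|<a/2\}$, and NLD $\frac1n\ln\gamma$. Average error probability: expectation over the fading of the limsup over $a$ of the average, over received points in the faded cube, of the ML (Voronoi-cell) error probability given the fading. $Q$ is the standard Gaussian complementary CDF. *)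

theory Defs
  imports "HOL-Probability.Probability"
begin

text \<open>Vectors in C^N are functions nat => complex; only coordinates k < N matter.
  Coordinate k = t*L + l is branch l of channel use t.  Since fading is i.i.d.
  over uses and branches, the n*L fading coefficients are i.i.d. CN(0,1).\<close>

definition cgauss :: "real \<Rightarrow> complex measure" where
  "cgauss s2 = density lborel (\<lambda>z. ennreal (exp (- (cmod z)\<^sup>2 / s2) / (pi * s2)))"

definition cgaussvec :: "nat \<Rightarrow> real \<Rightarrow> (nat \<Rightarrow> complex) measure" where
  "cgaussvec N s2 = PiM {..<N} (\<lambda>_. cgauss s2)"

definition cube :: "nat \<Rightarrow> real \<Rightarrow> (nat \<Rightarrow> complex) set" where
  "cube N a = {x. \<forall>k<N. \<bar>Re (x k)\<bar> < a / 2 \<and> \<bar>Im (x k)\<bar> < a / 2}"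

definition is_IC :: "nat \<Rightarrow> (nat \<Rightarrow> complex) set \<Rightarrow> bool" where
  "is_IC N S \<longleftrightarrow> countable S \<and> (\<forall>x\<in>S. \<forall>k. N \<le> k \<longrightarrow> x k = 0)
     \<and> (\<forall>a. finite (S \<inter> cube N a))"

definition IC_density :: "nat \<Rightarrow> (nat \<Rightarrow> complex) set \<Rightarrow> ereal" where
  "IC_density N S = Limsup at_top (\<lambda>a::real. ereal (real (card (S \<inter> cube N a)) / a ^ (2 * N)))"

definition sqdist :: "nat \<Rightarrow> (nat \<Rightarrow> complex) \<Rightarrow> (nat \<Rightarrow> complex) \<Rightarrow> real" where
  "sqdist N x y = (\<Sum>k<N. (cmod (x k - y k))\<^sup>2)"

definition fade :: "(nat \<Rightarrow> complex) \<Rightarrow> (nat \<Rightarrow> complex) \<Rightarrow> (nat \<Rightarrow> complex)" where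
  "fade h x = (\<lambda>k. h k * x k)"

definition ml_err_prob :: "nat \<Rightarrow> real \<Rightarrow> (nat \<Rightarrow> complex) set \<Rightarrow> (nat \<Rightarrow> complex) \<Rightarrow> real" where
  "ml_err_prob N s2 T p = measure (cgaussvec N s2)
     {z \<in> space (cgaussvec N s2). \<exists>q\<in>T. sqdist N (\<lambda>k. p k + z k) q < sqdist N (\<lambda>k. p k + z k) p}"

text \<open>Error probability given the fading h: limsup over a of the average over the
  points of the faded cube, i.e. the faded points h*s with s in S \<inter> Cb(a).\<close>
definition err_given_fading :: "nat \<Rightarrow> real \<Rightarrow> (nat \<Rightarrow> complex) set \<Rightarrow> (nat \<Rightarrow> complex) \<Rightarrow> ennreal" where
  "err_given_fading N s2 S h = Limsup at_top (\<lambda>a::real.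
     ennreal ((\<Sum>s\<in>S \<inter> cube N a. ml_err_prob N s2 (fade h ` S) (fade h s))
              / real (card (S \<inter> cube N a))))"

definition avg_err_prob :: "nat \<Rightarrow> nat \<Rightarrow> real \<Rightarrow> (nat \<Rightarrow> complex) set \<Rightarrow> ennreal" where
  "avg_err_prob n L s2 S = (\<integral>\<^sup>+ h. err_given_fading (n * L) s2 S h \<partial>cgaussvec (n * L) 1)"

definition NLD :: "nat \<Rightarrow> nat \<Rightarrow> (nat \<Rightarrow> complex) set \<Rightarrow> real" where
  "NLD n L S = ln (real_of_ereal (IC_density (n * L) S)) / real n"

definition opt_NLD :: "nat \<Rightarrow> nat \<Rightarrow> real \<Rightarrow> real \<Rightarrow> ereal" where
  "opt_NLD n L s2 \<epsilon> = Sup {ereal (NLD n L S) | S. is_IC (n * L) S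
       \<and> 0 < IC_density (n * L) S \<and> IC_density (n * L) S < \<infinity>
       \<and> avg_err_prob n L s2 S \<le> ennreal \<epsilon>}"

definition Qfun :: "real \<Rightarrow> real" where
  "Qfun x = measure std_normal_distribution {x<..}"

definition Qinv :: "real \<Rightarrow> real" where
  "Qinv e = (THE x. Qfun x = e)"

text \<open>ln det(H^dagger H / c) for diagonal H = diag(h 0,...,h (L-1)).\<close>
definition lndet :: "nat \<Rightarrow> real \<Rightarrow> (nat \<Rightarrow> complex) \<Rightarrow> real" where
  "lndet L c h = ln (\<Prod>l<L. (cmod (h l))\<^sup>2 / c)"

definition delta_star :: "nat \<Rightarrow> real \<Rightarrow> real" where
  "delta_star L s2 = (\<integral>h. lndet L (pi * exp 1 * s2) h \<partial>cgaussvec L 1)"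

definition disp_V :: "nat \<Rightarrow> real" where
  "disp_V L = real L + (\<integral>h. (lndet L 1 h - (\<integral>h'. lndet L 1 h' \<partial>cgaussvec L 1))\<^sup>2 \<partial>cgaussvec L 1)"

end

(*
Let f be the noise density, N = nL, and J(h, z) = ln (f(z) |det h|^2), a sum of N i.i.d. terms
ln |h_k|^2 - ln (pi s2) - |z_k|^2 / s2 whose mean and variance, times L, are delta_star and disp_V.
Both bounds compare the error probability of a constellation of density gamma with the
distribution function of J near ln gamma.

Converse: pulling the Voronoi cells back by h, the probability of correct decoding at a point is at
most P(J > ln kappa) + kappa * (volume of the cell); the average cell volume is about 1 / gamma, and
kappa = gamma / (4 sqrt n) gives error >= P(J <= ln gamma - ln n / 2 - ln 4) - 2 / sqrt n.

Direct part: if J >= ln (gamma / beta), then by Markov's inequality the points q for which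
z + h p - h q has density at least f(z) fill volume at most beta / gamma. Points chosen greedily
in a large cube, repeated periodically with guard intervals, therefore have average error at most
P(J < ln (gamma / beta)) + 2 beta; take beta = 1 / sqrt n.

The Berry-Esseen bound comes directly from Levy's inversion formula: the exponential part |z_k|^2 / s2
of each term makes the characteristic function decay like 1 / |t|, so no smoothing is needed.
*)
theory Submission
  imports Defs "HOL-Real_Asymp.Real_Asymp"
begin

section \<open>The complex Gaussian distribution\<close>

text \<open>The constellation is fixed before the fading is drawn. The greedy choice therefore
  charges a pair of points with a confusion probability under the joint law of fading and noise, and
  only the mean of these charges over the chosen points is controlled. Error probability and density
  are both limsups over cubes. In the converse the density is known to be reached only on
  arbitrarily large cubes, which is enough: a lower bound on the error along such cubes passes to
  its limsup. Voronoi cells can have infinite volume; cutting each to a box keeps all cells of a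
  cube inside a slightly larger cube. The bounds on the error hold for almost every fading
  separately, by functions of \<open>h\<close> known to be measurable, so averaging over the fading
  uses only monotonicity of the integral. The two kinds of loss differ in size. An error of order 1
  / sqrt n in probability moves the normal quantile by the same order, hence ln gamma by a constant.
  The factors sqrt n and 4 in the density cost ln gamma (ln n) / 2 + ln 4, and this is the origin of
  the ln n / n in the remainder.\<close>

lemma lborel_complex_eq_distr:
  "(lborel :: complex measure) = distr (lborel \<Otimes>\<^sub>M lborel) borel (\<lambda>(x, y). Complex x y)"
proof (rule lborel_eqI)
  have [measurable]: "(\<lambda>(x, y). Complex x y) \<in> borel \<Otimes>\<^sub>M borel \<rightarrow>\<^sub>M borel"
    unfolding Complex_eq by measurable
  fix l u :: complex assume le: "\<And>b. b \<in> Basis \<Longrightarrow> l \<bullet> b \<le> u \<bullet> b"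
  have le': "Re l \<le> Re u" "Im l \<le> Im u" using le[of 1] le[of \<i>] by (auto simp: Basis_complex_def)
  have "(\<lambda>(x, y). Complex x y) -` box l u = box (Re l) (Re u) \<times> box (Im l) (Im u)"
    by (auto simp: box_def Basis_complex_def)
  then show "emeasure (distr (lborel \<Otimes>\<^sub>M lborel) borel (\<lambda>(x, y). Complex x y)) (box l u) = (\<Prod>b\<in>Basis. (u - l) \<bullet> b)"
    using le' by (simp add: emeasure_distr space_pair_measure lborel.emeasure_pair_measure_Times Basis_complex_def
       box_real ennreal_mult'')
qed simp

lemma measurable_Complex [measurable (raw)]:
  assumes [measurable]: "f \<in> borel_measurable M" "g \<in> borel_measurable M"
  shows "(\<lambda>x. Complex (f x) (g x)) \<in> borel_measurable M"
  unfolding Complex_eq by measurable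

lemma nn_integral_lborel_complex:
  assumes [measurable]: "F \<in> borel_measurable borel"
  shows "(\<integral>\<^sup>+z. F z \<partial>(lborel :: complex measure)) = (\<integral>\<^sup>+x. \<integral>\<^sup>+y. F (Complex x y) \<partial>lborel \<partial>lborel)"
  by (subst lborel_complex_eq_distr) (simp add: nn_integral_distr split_beta' lborel.nn_integral_fst[symmetric])

lemma nn_integral_lborel_complex_swap:
  assumes [measurable]: "F \<in> borel_measurable borel"
  shows "(\<integral>\<^sup>+z. F z \<partial>(lborel :: complex measure)) = (\<integral>\<^sup>+y. \<integral>\<^sup>+x. F (Complex x y) \<partial>lborel \<partial>lborel)"
  by (subst nn_integral_lborel_complex) (auto intro!: lborel_pair.Fubini')

text \<open>Multiplication by \<open>h\<close> is the matrix with rows \<open>(a, -b)\<close> and \<open>(b, a)\<close>; for \<open>a \<noteq> 0\<close> it is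
  handled by one substitution in each real variable.\<close>

lemma nn_integral_complex_affine:
  fixes h c :: complex
  assumes [measurable]: "F \<in> borel_measurable borel" and h: "h \<noteq> 0"
  shows "(\<integral>\<^sup>+z. F z \<partial>lborel) = ennreal ((cmod h)\<^sup>2) * (\<integral>\<^sup>+z. F (h * z + c) \<partial>lborel)"
proof -
  have Re_ne: "(\<integral>\<^sup>+z. F z \<partial>lborel) = ennreal ((cmod h)\<^sup>2) * (\<integral>\<^sup>+z. F (h * z + c) \<partial>lborel)"
    if "Re h \<noteq> 0" and [measurable]: "F \<in> borel_measurable borel" for h c :: complex and F :: "complex \<Rightarrow> ennreal"
  proof -
    define a b where "a = Re h" and "b = Im h"
    have a: "a \<noteq> 0" using that a_def by simp
    \<comment> \<open>\<open>?d\<close> is the second pivot in the elimination of that matrix and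
      \<open>a\<close> the first; their product is \<open>(cmod h)^2\<close>. The substitution in
      \<open>y\<close> at fixed \<open>x\<close> comes first, so that after the swap of integrals
      the one in \<open>x\<close> has Jacobian \<open>a\<close>.\<close>
    let ?d = "(a^2 + b^2) / a"
    have d: "?d \<noteq> 0" using a by (simp add: sum_power2_eq_zero_iff)
    have "(\<integral>\<^sup>+z. F z \<partial>lborel) = (\<integral>\<^sup>+x. \<integral>\<^sup>+y. F (Complex x y) \<partial>lborel \<partial>lborel)"
      by (rule nn_integral_lborel_complex) simp
    also have "\<dots> = (\<integral>\<^sup>+x. \<bar>?d\<bar> * (\<integral>\<^sup>+y. F (Complex x (Im c + b / a * (x - Re c) + ?d * y)) \<partial>lborel) \<partial>lborel)"
      by (intro nn_integral_cong nn_integral_real_affine) (use d in auto)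
    also have "\<dots> = \<bar>?d\<bar> * (\<integral>\<^sup>+x. \<integral>\<^sup>+y. F (Complex x (Im c + b / a * (x - Re c) + ?d * y)) \<partial>lborel \<partial>lborel)"
      by (rule nn_integral_cmult) measurable
    also have "(\<integral>\<^sup>+x. \<integral>\<^sup>+y. F (Complex x (Im c + b / a * (x - Re c) + ?d * y)) \<partial>lborel \<partial>lborel)
        = (\<integral>\<^sup>+y. \<integral>\<^sup>+x. F (Complex x (Im c + b / a * (x - Re c) + ?d * y)) \<partial>lborel \<partial>lborel)"
      by (rule lborel_pair.Fubini') measurable
    also have "\<dots> = (\<integral>\<^sup>+y. \<bar>a\<bar> * (\<integral>\<^sup>+x. F (h * Complex x y + c) \<partial>lborel) \<partial>lborel)"
    proof (intro nn_integral_cong)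
      fix y :: real
      have "(\<integral>\<^sup>+x. F (Complex x (Im c + b / a * (x - Re c) + ?d * y)) \<partial>lborel) =
         \<bar>a\<bar> * (\<integral>\<^sup>+x. F (Complex ((Re c - b * y) + a * x) (Im c + b / a * ((Re c - b * y) + a * x - Re c) + ?d * y)) \<partial>lborel)"
        by (rule nn_integral_real_affine) (use a in auto)
      also have "(\<lambda>x. Complex ((Re c - b * y) + a * x) (Im c + b / a * ((Re c - b * y) + a * x - Re c) + ?d * y))
         = (\<lambda>x. h * Complex x y + c)"
        using a by (auto simp: complex_eq_iff a_def b_def field_simps power2_eq_square fun_eq_iff)
      finally show "(\<integral>\<^sup>+x. F (Complex x (Im c + b / a * (x - Re c) + ?d * y)) \<partial>lborel) =
         \<bar>a\<bar> * (\<integral>\<^sup>+x. F (h * Complex x y + c) \<partial>lborel)" .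
    qed
    also have "\<dots> = \<bar>a\<bar> * (\<integral>\<^sup>+y. \<integral>\<^sup>+x. F (h * Complex x y + c) \<partial>lborel \<partial>lborel)"
      by (rule nn_integral_cmult) measurable
    also have "(\<integral>\<^sup>+y. \<integral>\<^sup>+x. F (h * Complex x y + c) \<partial>lborel \<partial>lborel) = (\<integral>\<^sup>+z. F (h * z + c) \<partial>lborel)"
      by (rule nn_integral_lborel_complex_swap[symmetric]) measurable
    also have "ennreal \<bar>?d\<bar> * (ennreal \<bar>a\<bar> * (\<integral>\<^sup>+z. F (h * z + c) \<partial>lborel)) = ennreal ((cmod h)\<^sup>2) * (\<integral>\<^sup>+z. F (h * z + c) \<partial>lborel)"
      using a by (simp add: mult.assoc[symmetric] ennreal_mult'[symmetric] abs_mult[symmetric] cmod_power2 a_def b_def)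
    finally show ?thesis .
  qed
  show ?thesis
  proof (cases "Re h = 0")
    case False then show ?thesis by (intro Re_ne) auto
  next
    case True
    \<comment> \<open>A purely imaginary \<open>h\<close> is the product of \<open>k\<close> and
      \<open>h / k\<close>, which both have non-zero real part; the two Jacobians multiply to
      \<open>(cmod h)^2\<close>.\<close>
    define k where "k = 1 + \<i>"
    have k: "Re k \<noteq> 0" "Re (h / k) \<noteq> 0" "k * (h / k) = h"
      using True h by (auto simp: k_def complex_eq_iff Re_divide Im_divide field_simps)
    have "(\<integral>\<^sup>+z. F z \<partial>lborel) = ennreal ((cmod k)\<^sup>2) * (\<integral>\<^sup>+z. F (k * z + c) \<partial>lborel)"
      by (rule Re_ne) (use k in auto)
    also have "(\<integral>\<^sup>+z. F (k * z + c) \<partial>lborel) = ennreal ((cmod (h / k))\<^sup>2) * (\<integral>\<^sup>+z. F (k * (h / k * z + 0) + c) \<partial>lborel)"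
      by (rule Re_ne) (use k in auto)
    also have "(\<lambda>z. k * (h / k * z + 0) + c) = (\<lambda>z. h * z + c)" by (simp only: mult.assoc[symmetric] k(3) add_0_right)
    finally show ?thesis
      by (simp only: mult.assoc[symmetric] ennreal_mult'[symmetric] zero_le_power2 power_mult_distrib[symmetric] norm_mult[symmetric] k(3))
  qed
qed

section \<open>The density of the complex Gaussian and the law of its squared modulus\<close>

definition cdens :: "real \<Rightarrow> complex \<Rightarrow> real" where
  "cdens s2 z = exp (- (cmod z)\<^sup>2 / s2) / (pi * s2)"

lemma cdens_measurable [measurable]: "cdens s2 \<in> borel_measurable borel"
  unfolding cdens_def[abs_def] by measurable

lemma cdens_pos: "0 < s2 \<Longrightarrow> 0 < cdens s2 z"
  by (simp add: cdens_def)

lemma cgauss_eq_density: "cgauss s2 = density lborel (\<lambda>z. ennreal (cdens s2 z))"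
  by (simp add: cgauss_def cdens_def)

lemma space_cgauss [simp]: "space (cgauss s2) = UNIV" by (simp add: cgauss_def)

lemma sets_cgauss [simp, measurable_cong]: "sets (cgauss s2) = sets borel" by (simp add: cgauss_def)

lemma nn_integral_cdens:
  assumes "0 < s2" shows "(\<integral>\<^sup>+z. ennreal (cdens s2 z) \<partial>lborel) = 1"
proof -
  \<comment> \<open>Real and imaginary part each carry half of the variance
    \<open>s2\<close>.\<close>
  let ?s = "sqrt (s2 / 2)" let ?n = "normal_density 0 ?s"
  have s: "0 < ?s" using assms by simp
  have e: "cdens s2 (Complex x y) = ?n x * ?n y" for x y
    using assms by (simp add: cdens_def normal_density_def cmod_power2 exp_add[symmetric] field_simps)
  have n1: "(\<integral>\<^sup>+x. ennreal (?n x) \<partial>lborel) = 1"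
    using prob_space.emeasure_space_1[OF prob_space_normal_density[OF s, of 0]] by (simp add: emeasure_density)
  have "(\<integral>\<^sup>+z. ennreal (cdens s2 z) \<partial>lborel) = (\<integral>\<^sup>+x. \<integral>\<^sup>+y. ennreal (?n x) * ennreal (?n y) \<partial>lborel \<partial>lborel)"
    by (subst nn_integral_lborel_complex) (auto simp: e ennreal_mult')
  also have "\<dots> = 1"
    by (simp add: nn_integral_cmult n1)
  finally show ?thesis .
qed

lemma prob_space_cgauss: "0 < s2 \<Longrightarrow> prob_space (cgauss s2)"
  by (rule prob_spaceI) (simp add: cgauss_eq_density emeasure_density nn_integral_cdens)

text \<open>Layer cake: \<open>exp (-|z|\<^sup>2/s2)\<close> is the integral of its derivative over \<open>r \<ge> |z|\<^sup>2\<close>,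
  which reduces the tail probability to the area of annuli.\<close>

lemma cgauss_sqnorm_exponential:
  assumes s2: "0 < s2"
  shows "distributed (cgauss s2) lborel (\<lambda>z. (cmod z)\<^sup>2 / s2) (exponential_density 1)"
proof -
  interpret prob_space "cgauss s2" by (rule prob_space_cgauss[OF assms])
  have "\<P>(z in cgauss s2. (cmod z)\<^sup>2 / s2 \<le> a) = 1 - exp (- a * 1)" if a: "0 \<le> a" for a
  proof -
    let ?I = "\<lambda>r. exp (- r / s2) / (pi * s2^2)"
    define A where "A = a * s2"
    have A: "0 \<le> A" using a s2 by (simp add: A_def)
    have lay: "ennreal (cdens s2 z) = (\<integral>\<^sup>+r. ennreal (?I r) * indicator {(cmod z)\<^sup>2..} r \<partial>lborel)" for z
    proof -
      have "(\<integral>\<^sup>+r. ennreal (?I r) * indicator {(cmod z)\<^sup>2..} r \<partial>lborel) = ennreal (0 - (- exp (- (cmod z)\<^sup>2 / s2) / (pi * s2)))"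
      proof (rule nn_integral_FTC_atLeast[where F = "\<lambda>r. - exp (- r / s2) / (pi * s2)"])
        show "((\<lambda>r. - exp (- r / s2) / (pi * s2)) has_real_derivative ?I r) (at r)" for r
          using s2 by (auto intro!: derivative_eq_intros simp: field_simps power2_eq_square)
        show "((\<lambda>r. - exp (- r / s2) / (pi * s2)) \<longlongrightarrow> 0) at_top"
          using s2 by real_asymp
      qed (use s2 in auto)
      then show ?thesis by (simp add: cdens_def)
    qed
    have area: "emeasure lborel {z::complex. A < (cmod z)\<^sup>2 \<and> (cmod z)\<^sup>2 \<le> r} = ennreal (pi * (r - A))"
      if "A \<le> r" for r
    proof -
      have "{z::complex. A < (cmod z)\<^sup>2 \<and> (cmod z)\<^sup>2 \<le> r} = cball 0 (sqrt r) - cball 0 (sqrt A)"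
        using real_sqrt_le_iff[of "(cmod z)\<^sup>2" for z] by (auto simp: not_le[symmetric])
      moreover have "emeasure lborel (cball (0::complex) (sqrt r) - cball 0 (sqrt A)) = ennreal (pi * r) - ennreal (pi * A)"
        using A that by (subst emeasure_Diff) (auto simp: emeasure_cball unit_ball_vol_2 intro: order_trans[OF _ real_sqrt_le_mono])
      ultimately show ?thesis
        using A that by (simp add: ennreal_minus[symmetric] right_diff_distrib)
    qed
    have "emeasure (cgauss s2) {z. A < (cmod z)\<^sup>2} =
         (\<integral>\<^sup>+z. \<integral>\<^sup>+r. ennreal (?I r) * indicator {(cmod z)\<^sup>2..} r * indicator {z. A < (cmod z)\<^sup>2} z \<partial>lborel \<partial>lborel)"
      unfolding cgauss_eq_density lay by (subst emeasure_density) (simp_all add: nn_integral_multc indicator_def)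
    also have "\<dots> = (\<integral>\<^sup>+r. \<integral>\<^sup>+z. ennreal (?I r) * indicator {(cmod z)\<^sup>2..} r * indicator {z. A < (cmod z)\<^sup>2} z \<partial>lborel \<partial>lborel)"
      by (rule lborel_pair.Fubini') (simp add: indicator_def)
    also have "\<dots> = (\<integral>\<^sup>+r. ennreal (exp (- r / s2) * (r - A) / s2^2) * indicator {A..} r \<partial>lborel)"
    proof (intro nn_integral_cong)
      fix r :: real
      have "(\<integral>\<^sup>+z. ennreal (?I r) * indicator {(cmod z)\<^sup>2..} r * indicator {z. A < (cmod z)\<^sup>2} z \<partial>lborel)
        = (\<integral>\<^sup>+z. ennreal (?I r) * indicator {z. A < (cmod z)\<^sup>2 \<and> (cmod z)\<^sup>2 \<le> r} z \<partial>lborel)"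
        by (intro nn_integral_cong) (auto simp: indicator_def)
      also have "\<dots> = ennreal (?I r) * emeasure lborel {z::complex. A < (cmod z)\<^sup>2 \<and> (cmod z)\<^sup>2 \<le> r}"
        by (rule nn_integral_cmult_indicator) measurable
      also have "\<dots> = ennreal (exp (- r / s2) * (r - A) / s2^2) * indicator {A..} r"
      proof (cases "A \<le> r")
        case True then show ?thesis using s2 by (simp add: area ennreal_mult'[symmetric])
      next
        case False
        then have e: "{z::complex. A < (cmod z)\<^sup>2 \<and> (cmod z)\<^sup>2 \<le> r} = {}" by auto
        show ?thesis using False unfolding e by simp
      qed
      finally show "(\<integral>\<^sup>+z. ennreal (?I r) * indicator {(cmod z)\<^sup>2..} r * indicator {z. A < (cmod z)\<^sup>2} z \<partial>lborel) =
        ennreal (exp (- r / s2) * (r - A) / s2^2) * indicator {A..} r" .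
    qed
    also have "\<dots> = ennreal (0 - (- exp (- A / s2) * (A - A + s2) / s2))"
    proof (rule nn_integral_FTC_atLeast[where F = "\<lambda>r. - exp (- r / s2) * (r - A + s2) / s2"])
      let ?F = "\<lambda>r. - exp (- r / s2) * (r - A + s2) / s2"
      show "(?F has_real_derivative exp (- r / s2) * (r - A) / s2^2) (at r)" for r
        using s2 by (auto intro!: derivative_eq_intros simp: field_simps power2_eq_square)
      show "(?F \<longlongrightarrow> 0) at_top"
        using s2 by real_asymp
    qed (use s2 in \<open>auto\<close>)
    finally have "emeasure (cgauss s2) {z. A < (cmod z)\<^sup>2} = ennreal (exp (- a))"
      using s2 by (simp add: A_def)
    then have "prob {z \<in> space (cgauss s2). A < (cmod z)\<^sup>2} = exp (- a)"
      by (simp add: measure_def)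
    then have "prob {z \<in> space (cgauss s2). \<not> (A < (cmod z)\<^sup>2)} = 1 - exp (- a)"
      by (subst prob_neg) auto
    then show ?thesis using s2 by (simp add: A_def field_simps not_less)
  qed
  then show ?thesis by (subst exponential_distributed_iff) auto
qed

section \<open>A Berry--Esseen bound\<close>

text \<open>Levy inversion writes both interval probabilities with the same kernel
  \<open>?K\<close>. That kernel is at most \<open>2 / |t|\<close> in modulus, and the factor
  \<open>|t|\<close> in \<open>bnd\<close> cancels the singularity, so the bound does not involve
  the length of the interval and survives \<open>a\<close> going to minus infinity.\<close>

lemma interval_prob_char_diff:
  assumes M: "real_distribution M" and N: "real_distribution N" and ab: "a \<le> b"
    and atoms: "measure M {a} = 0" "measure M {b} = 0" "measure N {a} = 0" "measure N {b} = 0"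
    and g: "integrable lborel g" and g0: "\<And>t. 0 \<le> g t"
    and bnd: "\<And>t. cmod (char M t - char N t) \<le> \<bar>t\<bar> * g t"
  shows "\<bar>measure M {a<..b} - measure N {a<..b}\<bar> \<le> (\<integral>t. g t \<partial>lborel) / pi"
proof -
  interpret M: real_distribution M by (rule M)
  interpret N: real_distribution N by (rule N)
  let ?K = "\<lambda>t::real. (iexp (-(t * a)) - iexp (-(t * b))) / (\<i> * t)"
  let ?I = "\<lambda>\<phi> (T::nat). 1 / (2 * pi) * (CLBINT t=-T..T. ?K t * \<phi> t)"
  have lim: "(\<lambda>T. ?I (char M) T - ?I (char N) T) \<longlonglongrightarrow> of_real (measure M {a<..b}) - of_real (measure N {a<..b})"
    using M.Levy_Inversion[OF ab atoms(1,2)] N.Levy_Inversion[OF ab atoms(3,4)]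
    by (intro tendsto_diff) auto
  \<comment> \<open>The bound by the length of the interval only serves integrability on the finite
    range of integration.\<close>
  have Kb: "cmod (?K t) \<le> b - a" for t
  proof (cases "t = 0")
    case False
    then show ?thesis using Levy_Inversion_aux2[of "-b" "-a" t] ab by simp
  qed (use ab in simp)
  have Kt: "cmod (?K t) * \<bar>t\<bar> \<le> 2" for t
  proof (cases "t = 0")
    case False
    have "cmod (iexp (-(t * a)) - iexp (-(t * b))) \<le> 1 + 1"
      by (rule order_trans[OF norm_triangle_ineq4]) (simp add: norm_exp_i_times del: of_real_mult of_real_minus)
    then show ?thesis using False by (simp add: norm_divide norm_mult)
  qed simp
  have int: "set_integrable lborel {- real T<..<real T} (\<lambda>t. ?K t * \<phi> t)"
    if [measurable]: "\<phi> \<in> borel_measurable borel" and "\<And>t. cmod (\<phi> t) \<le> 1" for \<phi> T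
    unfolding set_integrable_def
  proof (rule integrableI_bounded_set_indicator[where B = "b - a"])
    have "cmod (?K x) * cmod (\<phi> x) \<le> (b - a) * 1" for x
      by (intro mult_mono Kb that(2)) (use ab in auto)
    then have "cmod (?K x * \<phi> x) \<le> b - a" for x by (simp only: norm_mult mult_1_right)
    then show "AE x in lborel. x \<in> {- real T<..<real T} \<longrightarrow> cmod (?K x * \<phi> x) \<le> b - a"
      by (intro AE_I2 impI)
  qed auto
  have "cmod (?I (char M) T - ?I (char N) T) \<le> (\<integral>t. g t \<partial>lborel) / pi" for T
  proof -
    have io: "(CLBINT t=-T..T. f t) = (CLINT t:{- real T<..<real T}|lborel. f t)" for f
      using interval_integral_Ioo[of "- real T" "real T" f] by simp
    let ?h = "\<lambda>t. indicator {- real T<..<real T} t *\<^sub>R (?K t * (char M t - char N t))"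
    have "?I (char M) T - ?I (char N) T = 1 / (2 * pi) * (CLINT t:{- real T<..<real T}|lborel. ?K t * char M t - ?K t * char N t)"
      unfolding io using int[OF M.char_measurable M.cmod_char_le_1] int[OF N.char_measurable N.cmod_char_le_1]
      by (subst set_integral_diff) (auto simp: right_diff_distrib)
    also have "\<dots> = 1 / (2 * pi) * (CLINT t|lborel. ?h t)"
      by (simp add: set_lebesgue_integral_def right_diff_distrib)
    also have "cmod \<dots> \<le> 1 / (2 * pi) * (\<integral>t. 2 * g t \<partial>lborel)"
    proof -
      have "cmod (?h t) \<le> 2 * g t" for t
      proof -
        have "cmod (?h t) \<le> cmod (?K t * (char M t - char N t))"
          by (simp only: norm_scaleR) (simp add: indicator_def)
        also have "\<dots> \<le> cmod (?K t) * (\<bar>t\<bar> * g t)"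
          unfolding norm_mult by (intro mult_left_mono bnd norm_ge_zero)
        also have "\<dots> \<le> 2 * g t"
          using mult_right_mono[OF Kt[of t] g0[of t]] by (simp add: mult.assoc)
        finally show ?thesis .
      qed
      then have h: "cmod (CLINT t|lborel. ?h t) \<le> (\<integral>t. 2 * g t \<partial>lborel)"
        by (intro order_trans[OF integral_norm_bound] integral_mono' integrable_mult_right g) (auto simp: g0)
      have gen: "cmod (1 / (2 * of_real pi) * X) \<le> 1 / (2 * pi) * c" if "cmod X \<le> c" for X :: complex and c
        using that by (simp add: norm_mult norm_divide divide_right_mono)
      show ?thesis using gen[OF h] by (simp only: of_real_divide of_real_mult of_real_numeral of_real_1)
    qed
    also have "\<dots> = (\<integral>t. g t \<partial>lborel) / pi" by simp
    finally show ?thesis .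
  qed
  then have "cmod (of_real (measure M {a<..b}) - of_real (measure N {a<..b})) \<le> (\<integral>t. g t \<partial>lborel) / pi"
    by (intro LIMSEQ_le_const2[OF tendsto_norm[OF lim]]) auto
  then show ?thesis by (simp add: of_real_diff[symmetric] del: of_real_diff)
qed

text \<open>Letting \<open>a\<close> tend to minus infinity along non-atoms of \<open>M\<close>
  gives the bound at every non-atom. Any \<open>x\<close> lies between two non-atoms at distance
  less than \<open>e\<close>; \<open>cdf M\<close> is monotone, and \<open>cdf N\<close> moves by at
  most \<open>e\<close> on the way to either of them.\<close>

lemma cdf_char_diff:
  assumes M: "real_distribution M" and N: "real_distribution N"
    and Natoms: "\<And>x. measure N {x} = 0" and lip: "\<And>x y. x \<le> y \<Longrightarrow> cdf N y - cdf N x \<le> y - x"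
    and g: "integrable lborel g" and g0: "\<And>t. 0 \<le> g t"
    and bnd: "\<And>t. cmod (char M t - char N t) \<le> \<bar>t\<bar> * g t"
  shows "\<bar>cdf M x - cdf N x\<bar> \<le> (\<integral>t. g t \<partial>lborel) / pi"
proof -
  interpret M: real_distribution M by (rule M)
  interpret N: real_distribution N by (rule N)
  let ?B = "(\<integral>t. g t \<partial>lborel) / pi"
  have ex: "\<exists>y\<in>{u<..<v}. measure M {y} = 0" if uv: "u < v" for u v
  proof (rule ccontr)
    assume "\<not> ?thesis"
    then have "{u<..<v} \<subseteq> {y. measure M {y} > 0}" by (auto simp: less_le)
    then have "countable {u<..<v}" using M.countable_atoms countable_subset by blast
    then show False using uv by (metis uncountable_open_interval)
  qed
  have *: "\<bar>cdf M y - cdf N y\<bar> \<le> ?B" if y: "measure M {y} = 0" for y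
  proof (rule field_le_epsilon)
    fix e :: real assume e: "0 < e"
    have "eventually (\<lambda>a. cdf M a < e / 2) at_bot" "eventually (\<lambda>a. cdf N a < e / 2) at_bot"
      using M.cdf_lim_at_bot N.cdf_lim_at_bot e by (auto simp: tendsto_iff dist_real_def M.cdf_nonneg N.cdf_nonneg elim!: allE[of _ "e/2"])
    then have "eventually (\<lambda>a. cdf M a < e / 2 \<and> cdf N a < e / 2) at_bot" by eventually_elim auto
    then obtain k where k: "\<And>a. a \<le> k \<Longrightarrow> cdf M a < e / 2 \<and> cdf N a < e / 2"
      unfolding eventually_at_bot_linorder by blast
    obtain a where a: "a \<in> {min k y - 1<..<min k y}" "measure M {a} = 0" using ex[of "min k y - 1" "min k y"] by force
    then have ay: "a < y" "a \<le> k" by auto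
    have "\<bar>(cdf M y - cdf M a) - (cdf N y - cdf N a)\<bar> \<le> ?B"
      using interval_prob_char_diff[OF M N _ a(2) y Natoms Natoms g g0 bnd] ay
      by (simp add: M.cdf_diff_eq N.cdf_diff_eq)
    then show "\<bar>cdf M y - cdf N y\<bar> \<le> ?B + e"
      using k[OF ay(2)] M.cdf_nonneg[of a] N.cdf_nonneg[of a] by linarith
  qed
  show ?thesis
  proof (rule field_le_epsilon)
    fix e :: real assume e: "0 < e"
    obtain y where y: "y \<in> {x<..<x + e}" "measure M {y} = 0" using ex[of x "x + e"] e by auto
    obtain z where z: "z \<in> {x - e<..<x}" "measure M {z} = 0" using ex[of "x - e" x] e by auto
    show "\<bar>cdf M x - cdf N x\<bar> \<le> ?B + e"
      using *[OF y(2)] *[OF z(2)] lip[of x y] lip[of z x] M.cdf_nondecreasing[of x y] M.cdf_nondecreasing[of z x] y z by auto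
  qed
qed

text \<open>Rescaling by \<open>m\<close> reduces to the unit disc. The factor
  \<open>m ^ (n - 1)\<close> preserves Gaussian decay when
  \<open>m = exp (- s^2 / 4)\<close>.\<close>

lemma norm_power_diff_le:
  fixes a b :: complex
  assumes "cmod a \<le> m" "cmod b \<le> m" "0 < m"
  shows "cmod (a ^ n - b ^ n) \<le> real n * cmod (a - b) * m ^ (n - 1)"
proof (cases n)
  case (Suc k)
  have "cmod ((a / m) ^ n - (b / m) ^ n) \<le> real n * cmod (a / m - b / m)"
    using assms by (intro norm_power_diff) (auto simp: norm_divide)
  also have "(a / m) ^ n - (b / m) ^ n = (a ^ n - b ^ n) / m ^ n" by (simp add: power_divide diff_divide_distrib)
  also have "a / m - b / m = (a - b) / m" by (simp add: diff_divide_distrib)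
  finally have "cmod (a ^ n - b ^ n) / m ^ n \<le> real n * (cmod (a - b) / m)"
    using assms by (simp add: norm_divide norm_power)
  then show ?thesis using assms by (simp add: field_simps Suc)
qed simp

text \<open>With \<open>s = t / sqrt n\<close>, the range is split at \<open>|s| = c\<close>.
  Inside, the third-order expansion makes one factor differ from the Gaussian one by order
  \<open>|s|^3\<close>, and the other \<open>n - 1\<close> factors supply Gaussian decay. Outside,
  the two terms are bounded separately: by \<open>dec\<close>, \<open>n - 2\<close> factors of the
  characteristic function give the geometric \<open>q ^ (n - 2)\<close>, and the last two give the
  integrable \<open>1 / (1 + s^2 / v)\<close>.\<close>

lemma char_power_normal_bound:
  assumes nu: "real_distribution \<nu>"
    and i1: "integrable \<nu> (\<lambda>x. x)" and m1: "(\<integral>x. x \<partial>\<nu>) = 0"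
    and i2: "integrable \<nu> (\<lambda>x. x\<^sup>2)" and m2: "(\<integral>x. x\<^sup>2 \<partial>\<nu>) = 1"
    and i3: "integrable \<nu> (\<lambda>x. \<bar>x\<bar>^3)"
    and v: "0 < v" and dec: "\<And>s. cmod (char \<nu> s) \<le> 1 / sqrt (1 + s\<^sup>2 / v)"
  shows "\<exists>C. \<forall>n\<ge>4. \<exists>g. integrable lborel g \<and> (\<forall>t. 0 \<le> g t) \<and>
      (\<forall>t. cmod (char \<nu> (t / sqrt (real n)) ^ n - of_real (exp (- t\<^sup>2 / 2))) \<le> \<bar>t\<bar> * g t) \<and>
      (\<integral>t. g t \<partial>lborel) / pi \<le> C / sqrt (real n)"
proof -
  interpret real_distribution \<nu> by (rule nu)
  define \<rho> where "\<rho> = (\<integral>x. \<bar>x\<bar>^3 \<partial>\<nu>)"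
  have \<rho>: "0 \<le> \<rho>" unfolding \<rho>_def by simp
  \<comment> \<open>\<open>c * \<rho> \<le> 1\<close> makes the cubic error at most
    \<open>s^2 / 6\<close> for \<open>|s| \<le> c\<close>, so that the characteristic function stays
    below \<open>1 - s^2 / 4\<close> in modulus; \<open>c \<le> 1\<close> keeps
    \<open>1 - s^2 / 2\<close> non-negative.\<close>
  define c where "c = 1 / (1 + \<rho>)"
  have c: "0 < c" "c \<le> 1" "c * \<rho> \<le> 1" using \<rho> by (auto simp: c_def field_simps)
  have ap: "cmod (char \<nu> s - of_real (1 - s\<^sup>2 / 2)) \<le> \<rho> * \<bar>s\<bar>^3 / 6" for s
  proof -
    have "cmod (char \<nu> s - of_real (1 - s\<^sup>2 / 2)) \<le> (s\<^sup>2 / 6) * expectation (\<lambda>x. min (6 * x\<^sup>2) (\<bar>s\<bar> * \<bar>x\<bar>^3))"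
      using char_approx3[OF i1 m1 i2, of 1 s] m1 m2 by simp
    also have "\<dots> \<le> (s\<^sup>2 / 6) * expectation (\<lambda>x. \<bar>s\<bar> * \<bar>x\<bar>^3)"
      by (intro mult_left_mono integral_mono Bochner_Integration.integrable_bound[OF integrable_mult_right[OF i3, of "\<bar>s\<bar>"]] integrable_mult_right i3)
         (auto simp: abs_mult)
    also have "\<dots> = \<rho> * \<bar>s\<bar>^3 / 6" by (simp add: \<rho>_def power2_eq_square power3_eq_cube)
    finally show ?thesis .
  qed
  \<comment> \<open>\<open>\<rho> / 6\<close> is the Taylor remainder of the characteristic
    function; \<open>1 / 4\<close> comes from \<open>(s^2 / 2)^2 \<le> |s|^3 / 4\<close>, the
    remainder of \<open>exp (- s^2 / 2)\<close>.\<close>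
  define C1 where "C1 = \<rho> / 6 + 1 / 4"
  have C1: "0 < C1" using \<rho> by (simp add: C1_def)
  have near: "cmod (char \<nu> s) \<le> exp (- s\<^sup>2 / 4) \<and> cmod (char \<nu> s - of_real (exp (- s\<^sup>2 / 2))) \<le> C1 * \<bar>s\<bar>^3"
    if s: "\<bar>s\<bar> \<le> c" for s
  proof -
    have s1: "\<bar>s\<bar> \<le> 1" using s c by linarith
    then have s2: "s\<^sup>2 \<le> 1" by (simp add: abs_square_le_1)
    have "\<rho> * \<bar>s\<bar>^3 / 6 = (\<rho> * \<bar>s\<bar>) * s\<^sup>2 / 6" by (simp add: power3_eq_cube power2_eq_square)
    also have "\<dots> \<le> 1 * s\<^sup>2 / 6"
      using mult_left_mono[OF s \<rho>] c(3) by (intro divide_right_mono mult_right_mono) (auto simp: mult.commute)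
    finally have r: "\<rho> * \<bar>s\<bar>^3 / 6 \<le> s\<^sup>2 / 6" by simp
    have "cmod (char \<nu> s) \<le> cmod (char \<nu> s - of_real (1 - s\<^sup>2 / 2)) + cmod (of_real (1 - s\<^sup>2 / 2))"
      using norm_triangle_ineq[of "char \<nu> s - of_real (1 - s\<^sup>2 / 2)" "of_real (1 - s\<^sup>2 / 2)"] by (simp only: diff_add_cancel)
    moreover have "cmod (of_real (1 - s\<^sup>2 / 2)) = 1 - s\<^sup>2 / 2" using s2 unfolding norm_of_real by simp
    ultimately have "cmod (char \<nu> s) \<le> 1 - s\<^sup>2 / 4" using ap[of s] r zero_le_power2[of s] by linarith
    also have "\<dots> \<le> exp (- s\<^sup>2 / 4)" using exp_ge_add_one_self[of "- s\<^sup>2 / 4"] by simp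
    finally have 1: "cmod (char \<nu> s) \<le> exp (- s\<^sup>2 / 4)" .
    have e: "\<bar>exp (- u) - (1 - u)\<bar> \<le> u\<^sup>2" if "0 \<le> u" "u \<le> 1" for u :: real
    proof -
      have "exp (-u) \<le> 1 + (-u) + (-u)\<^sup>2"
      proof -
        have "exp (-u) * (1 + u) \<le> exp (-u) * exp u" by (intro mult_left_mono exp_ge_add_one_self) auto
        then have "exp (-u) \<le> 1 / (1 + u)" using that by (simp add: exp_minus field_simps)
        also have "1 / (1 + u) \<le> 1 - u + u\<^sup>2" using that by (simp add: field_simps power2_eq_square)
        finally show ?thesis by simp
      qed
      then show ?thesis using exp_ge_add_one_self[of "-u"] by simp
    qed
    have "(s\<^sup>2 / 2)\<^sup>2 = \<bar>s\<bar>^3 * \<bar>s\<bar> / 4" by (simp add: power2_eq_square power3_eq_cube)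
    also have "\<dots> \<le> \<bar>s\<bar>^3 * 1 / 4" using s1 by (intro divide_right_mono mult_left_mono) auto
    finally have q: "\<bar>(1 - s\<^sup>2 / 2) - exp (- s\<^sup>2 / 2)\<bar> \<le> \<bar>s\<bar>^3 / 4" using e[of "s\<^sup>2 / 2"] s2 by (simp add: abs_minus_commute)
    have sp: "x - of_real b = (x - of_real a) + of_real (a - b)" for x :: complex and a b by simp
    have "cmod (char \<nu> s - of_real (exp (- s\<^sup>2 / 2))) \<le> cmod (char \<nu> s - of_real (1 - s\<^sup>2 / 2)) + \<bar>(1 - s\<^sup>2 / 2) - exp (- s\<^sup>2 / 2)\<bar>"
      using norm_triangle_ineq[of "char \<nu> s - of_real (1 - s\<^sup>2 / 2)" "of_real ((1 - s\<^sup>2 / 2) - exp (- s\<^sup>2 / 2))"]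
      unfolding sp[symmetric] norm_of_real .
    then have "cmod (char \<nu> s - of_real (exp (- s\<^sup>2 / 2))) \<le> C1 * \<bar>s\<bar>^3"
      using ap[of s] q unfolding C1_def distrib_right by linarith
    then show ?thesis using 1 by blast
  qed
  define q where "q = 1 / sqrt (1 + c\<^sup>2 / v)"
  have "1 < 1 + c\<^sup>2 / v" using c v by simp
  then have q: "0 < q" "q < 1" by (auto simp: q_def)
  \<comment> \<open>\<open>C1\<close> is used for \<open>|s| \<le> c\<close>; \<open>1 / c^3\<close>
    pays for the Gaussian term outside, where \<open>c^3 * r \<le> |t|^3\<close> with
    \<open>r = sqrt n\<close>.\<close>
  define K where "K = C1 + 1 / c^3"
  define G1 where "G1 = (\<lambda>t::real. t\<^sup>2 * exp (- t\<^sup>2 / 8))"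
  have G1: "integrable lborel G1"
  proof -
    have "integrable lborel (\<lambda>t. sqrt (8 * pi) * (normal_density 0 2 t * (t - 0)^2))"
      by (intro integrable_mult_right integrable_normal_moment) simp
    also have "(\<lambda>t. sqrt (8 * pi) * (normal_density 0 2 t * (t - 0)^2)) = G1"
      by (simp add: G1_def normal_density_def fun_eq_iff mult.commute)
    finally show ?thesis .
  qed
  define G2 where "G2 = (\<lambda>t::real. 1 / (1 + t\<^sup>2))"
  have G2: "integrable lborel G2"
    using integrable_inverse_1_plus_square unfolding set_integrable_def G2_def by (simp add: einterval_def inverse_eq_divide)
  \<comment> \<open>The part of the majorant that covers the characteristic function for
    \<open>|s| > c\<close> integrates to a multiple of \<open>q ^ (n - 2)\<close>, because rescaling
    \<open>t\<close> restores the factor \<open>sqrt n\<close> that was divided out. Boundedness of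
    \<open>n * q ^ n\<close> makes this of order \<open>1 / sqrt n\<close>.\<close>
  obtain B where B: "\<And>n. real n * q ^ n \<le> B"
  proof -
    have "(\<lambda>n. real n * q ^ n) \<longlonglongrightarrow> 0" using powser_times_n_limit_0[of q] q by simp
    then have "Bseq (\<lambda>n. real n * q ^ n)" using convergent_imp_Bseq convergentI by blast
    then obtain K where "\<And>n. norm (real n * q ^ n) \<le> K" by (auto simp: Bseq_def)
    then show ?thesis using that[of K] by (metis abs_le_D1 real_norm_def)
  qed
  define I1 where "I1 = (\<integral>t. G1 t \<partial>lborel)"
  define I2 where "I2 = (\<integral>t. G2 t \<partial>lborel)"
  have I2: "0 \<le> I2" unfolding I2_def G2_def by simp
  show ?thesis
  proof (intro exI[of _ "(K * I1 + B / q\<^sup>2 * sqrt v * I2 / c) / pi"] allI impI)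
    fix n :: nat assume n: "4 \<le> n"
    define r where "r = sqrt (real n)"
    have r: "1 \<le> r" "r\<^sup>2 = real n" "0 < r" using n by (auto simp: r_def)
    let ?g = "\<lambda>t. K / r * G1 t + q ^ (n - 2) / (c * r) * G2 (0 + (1 / (r * sqrt v)) * t)"
    have rv: "1 / (r * sqrt v) \<noteq> 0" using r v by simp
    have int2: "integrable lborel (\<lambda>t. G2 (0 + (1 / (r * sqrt v)) * t))"
      by (rule lborel_integrable_real_affine[OF G2 rv])
    have val2: "(\<integral>t. G2 (0 + (1 / (r * sqrt v)) * t) \<partial>lborel) = r * sqrt v * I2"
      using lborel_integral_real_affine[OF rv, of G2 0] r v unfolding I2_def by (simp add: field_simps)
    have K: "0 < K" using C1 c by (simp add: K_def add_pos_pos)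
    have "integrable lborel ?g" using G1 int2 by simp
    moreover have "0 \<le> ?g t" for t using K r q c by (simp add: G1_def G2_def)
    moreover have "cmod (char \<nu> (t / sqrt (real n)) ^ n - of_real (exp (- t\<^sup>2 / 2))) \<le> \<bar>t\<bar> * ?g t" for t
    proof -
      define s where "s = t / r"
      have t: "t = s * r" using r by (simp add: s_def)
      have en: "exp (- t\<^sup>2 / 2) = exp (- s\<^sup>2 / 2) ^ n"
        using r(2) by (simp add: t exp_of_nat_mult[symmetric] power_mult_distrib)
      have g2: "G2 (0 + (1 / (r * sqrt v)) * t) = 1 / (1 + s\<^sup>2 / v)"
        using r v by (simp add: G2_def t power_divide)
      have A0: "0 \<le> K / r * G1 t" "0 \<le> q ^ (n - 2) / (c * r) * G2 (0 + (1 / (r * sqrt v)) * t)"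
        using K r q c by (simp_all add: G1_def G2_def)
      show ?thesis
      proof (cases "\<bar>s\<bar> \<le> c")
        case True
        note nr = near[OF True]
        have "cmod (char \<nu> s ^ n - of_real (exp (- s\<^sup>2 / 2)) ^ n) \<le> real n * cmod (char \<nu> s - of_real (exp (- s\<^sup>2 / 2))) * exp (- s\<^sup>2 / 4) ^ (n - 1)"
          using nr norm_power_diff_le[of "char \<nu> s" "exp (- s\<^sup>2 / 4)" "of_real (exp (- s\<^sup>2 / 2))" n] by simp
        also have "\<dots> \<le> real n * (C1 * \<bar>s\<bar>^3) * exp (- t\<^sup>2 / 8)"
        proof (intro mult_mono mult_left_mono)
          \<comment> \<open>\<open>n \<le> 2 * (n - 1)\<close>: dropping one of the \<open>n\<close>
            factors at most halves the exponent, hence 8 in place of 4.\<close>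
          have "s\<^sup>2 * r\<^sup>2 \<le> s\<^sup>2 * (2 * real (n - 1))" using n r by (intro mult_left_mono) auto
          then show "exp (- s\<^sup>2 / 4) ^ (n - 1) \<le> exp (- t\<^sup>2 / 8)"
            by (simp add: exp_of_nat_mult[symmetric] t power_mult_distrib field_simps)
        qed (use nr C1 in auto)
        also have "real n * (C1 * \<bar>s\<bar>^3) * exp (- t\<^sup>2 / 8) = \<bar>t\<bar> * (C1 / r * G1 t)"
          using r by (simp add: G1_def t abs_mult field_simps power3_eq_cube power2_eq_square r(2)[symmetric])
        also have "\<dots> \<le> \<bar>t\<bar> * (K / r * G1 t)"
          using c r by (intro mult_left_mono mult_right_mono divide_right_mono) (auto simp: K_def G1_def)
        also have "\<dots> \<le> \<bar>t\<bar> * ?g t" using A0 by (intro mult_left_mono) auto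
        finally show ?thesis by (simp only: en s_def r_def of_real_power)
      next
        case False
        then have cs: "c < \<bar>s\<bar>" by simp
        have ct: "c * r \<le> \<bar>t\<bar>" using cs r by (simp add: t abs_mult)
        have "cmod (char \<nu> s ^ n - of_real (exp (- t\<^sup>2 / 2))) \<le> cmod (char \<nu> s) ^ n + exp (- t\<^sup>2 / 2)"
          by (rule order_trans[OF norm_triangle_ineq4]) (simp add: norm_power)
        also have "exp (- t\<^sup>2 / 2) \<le> \<bar>t\<bar> * (K / r * G1 t)"
        proof -
          have "c^3 * r \<le> (c * r)^3" using r c by (simp add: power_mult_distrib mult_left_mono self_le_power)
          also have "\<dots> \<le> \<bar>t\<bar>^3" using ct c r by (intro power_mono) auto
          finally have "1 \<le> \<bar>t\<bar>^3 / (c^3 * r)" using c r by simp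
          then have "1 * exp (- t\<^sup>2 / 2) \<le> \<bar>t\<bar>^3 / (c^3 * r) * exp (- t\<^sup>2 / 8)"
            by (intro mult_mono) auto
          also have "\<dots> = \<bar>t\<bar> * ((1 / c^3) / r * G1 t)" by (simp add: G1_def power3_eq_cube power2_eq_square)
          also have "\<dots> \<le> \<bar>t\<bar> * (K / r * G1 t)"
            using C1 r by (intro mult_left_mono mult_right_mono divide_right_mono) (auto simp: K_def G1_def)
          finally show ?thesis by simp
        qed
        also have "cmod (char \<nu> s) ^ n \<le> \<bar>t\<bar> * (q ^ (n - 2) / (c * r) * (1 / (1 + s\<^sup>2 / v)))"
        proof -
          let ?d = "1 / sqrt (1 + s\<^sup>2 / v)"
          have "c\<^sup>2 \<le> s\<^sup>2" using cs c by (simp add: abs_le_square_iff[symmetric])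
          then have "sqrt (1 + c\<^sup>2 / v) \<le> sqrt (1 + s\<^sup>2 / v)" using v by (simp add: divide_right_mono)
          moreover have "0 < sqrt (1 + c\<^sup>2 / v)" using v by (simp add: add_pos_nonneg)
          ultimately have dq: "?d \<le> q" by (auto simp: q_def intro!: divide_left_mono)
          have d0: "0 \<le> ?d" using v by simp
          have "cmod (char \<nu> s) ^ n \<le> ?d ^ n" by (intro power_mono dec) auto
          also have "?d ^ n = ?d ^ (n - 2) * ?d\<^sup>2"
          proof -
            have "n = n - 2 + 2" using n by simp
            then show ?thesis by (metis power_add)
          qed
          also have "\<dots> \<le> q ^ (n - 2) * ?d\<^sup>2" using dq d0 by (intro mult_right_mono power_mono) auto
          also have "?d\<^sup>2 = 1 / (1 + s\<^sup>2 / v)" using v by (simp add: power_divide)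
          also have "q ^ (n - 2) * (1 / (1 + s\<^sup>2 / v)) \<le> (\<bar>t\<bar> / (c * r)) * (q ^ (n - 2) * (1 / (1 + s\<^sup>2 / v)))"
            using mult_right_mono[of 1 "\<bar>t\<bar> / (c * r)" "q ^ (n - 2) * (1 / (1 + s\<^sup>2 / v))"] ct c r q v by simp
          finally show ?thesis by simp
        qed
        finally show ?thesis using g2 by (simp add: s_def r_def distrib_left add.commute)
      qed
    qed
    moreover have "(\<integral>t. ?g t \<partial>lborel) / pi \<le> (K * I1 + B / q\<^sup>2 * sqrt v * I2 / c) / pi / sqrt (real n)"
    proof -
      have "(\<integral>t. ?g t \<partial>lborel) = K / r * I1 + q ^ (n - 2) / (c * r) * (r * sqrt v * I2)"
        using G1 int2 by (simp add: val2[simplified] I1_def)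
      also have "q ^ (n - 2) / (c * r) * (r * sqrt v * I2) = q ^ (n - 2) * (sqrt v * I2 / c)" using r by simp
      also have "\<dots> \<le> (B / q\<^sup>2 / r) * (sqrt v * I2 / c)"
      proof (intro mult_right_mono)
        have "r \<le> real n" using r by (metis mult_right_mono mult_1 power2_eq_square less_imp_le)
        then have "r * q ^ n \<le> B" using B[of n] q by (meson mult_right_mono order_trans zero_le_power less_imp_le)
        moreover have "q ^ n = q ^ (n - 2) * q\<^sup>2"
          proof -
            have "n = n - 2 + 2" using n by simp
            then show ?thesis by (metis power_add)
          qed
        ultimately show "q ^ (n - 2) \<le> B / q\<^sup>2 / r" using q r by (simp add: field_simps)
      qed (use v c I2 in auto)
      also have "K / r * I1 + B / q\<^sup>2 / r * (sqrt v * I2 / c) = (K * I1 + B / q\<^sup>2 * sqrt v * I2 / c) / r"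
        by (simp add: add_divide_distrib mult_ac)
      finally have "(\<integral>t. ?g t \<partial>lborel) \<le> (K * I1 + B / q\<^sup>2 * sqrt v * I2 / c) / r" by simp
      then have "(\<integral>t. ?g t \<partial>lborel) / pi \<le> (K * I1 + B / q\<^sup>2 * sqrt v * I2 / c) / r / pi" by (intro divide_right_mono) auto
      then show ?thesis by (simp add: r_def mult.commute)
    qed
    ultimately show "\<exists>g. integrable lborel g \<and> (\<forall>t. 0 \<le> g t) \<and>
      (\<forall>t. cmod (char \<nu> (t / sqrt (real n)) ^ n - of_real (exp (- t\<^sup>2 / 2))) \<le> \<bar>t\<bar> * g t) \<and>
      (\<integral>t. g t \<partial>lborel) / pi \<le> (K * I1 + B / q\<^sup>2 * sqrt v * I2 / c) / pi / sqrt (real n)"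
      by blast
  qed
qed

section \<open>The standard normal distribution function and the normal approximation\<close>

abbreviation ncdf :: "real \<Rightarrow> real" where
  "ncdf \<equiv> cdf std_normal_distribution"

lemma std_normal_density_le_1: "std_normal_density x \<le> 1"
proof -
  have "1 \<le> sqrt (2 * pi)" using pi_gt3 by simp
  then have "1 / sqrt (2 * pi) * exp (- x\<^sup>2 / 2) \<le> 1 * 1" by (intro mult_mono) auto
  then show ?thesis by (simp add: std_normal_density_def)
qed

lemma measure_std_normal_Ioc:
  assumes "x \<le> y"
  shows "measure std_normal_distribution {x<..y} = (\<integral>t. indicator {x<..y} t * std_normal_density t \<partial>lborel)"
proof -
  have "measure std_normal_distribution {x<..y} = enn2real (\<integral>\<^sup>+ t. ennreal (indicator {x<..y} t * std_normal_density t) \<partial>lborel)"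
    unfolding measure_def by (subst emeasure_density) (auto intro!: arg_cong[where f = enn2real] nn_integral_cong simp: indicator_def)
  also have "\<dots> = (\<integral>t. indicator {x<..y} t * std_normal_density t \<partial>lborel)"
    by (rule integral_eq_nn_integral[symmetric]) auto
  finally show ?thesis .
qed

lemma std_normal_lipschitz:
  assumes "x \<le> y" shows "ncdf y - ncdf x \<le> y - x"
proof -
  interpret real_distribution std_normal_distribution by (rule real_dist_normal_dist)
  have "ncdf y - ncdf x = measure std_normal_distribution {x<..y}"
    using assms by (cases "x = y") (auto simp: cdf_diff_eq)
  also have "\<dots> \<le> (\<integral>t. indicator {x<..y} t \<partial>lborel)"
    unfolding measure_std_normal_Ioc[OF assms]
  proof (rule integral_mono')
    show "integrable lborel (indicator {x<..y} :: real \<Rightarrow> real)" using assms by simp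
  qed (auto simp: indicator_def std_normal_density_le_1)
  also have "\<dots> = y - x" using assms by simp
  finally show ?thesis .
qed

lemma std_normal_atomless: "measure std_normal_distribution {x} = 0"
proof -
  interpret real_distribution std_normal_distribution by (rule real_dist_normal_dist)
  have "measure std_normal_distribution {x} \<le> e" if "0 < e" for e :: real
  proof -
    have "measure std_normal_distribution {x} \<le> measure std_normal_distribution {x - e<..x}"
      using that by (intro finite_measure_mono) auto
    also have "\<dots> \<le> e" using cdf_diff_eq[of "x - e" x] std_normal_lipschitz[of "x - e" x] that by simp
    finally show ?thesis .
  qed
  then show ?thesis by (metis field_le_epsilon add_0 measure_le_0_iff)
qed

lemma char_distr_affine:
  assumes M: "real_distribution M" and "b \<noteq> 0"
  shows "char (distr M borel (\<lambda>x. (x - a) / b)) t = iexp (- (t * a / b)) * char M (t / b)"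
proof -
  interpret real_distribution M by (rule M)
  have "char (distr M borel (\<lambda>x. (x - a) / b)) t = (CLINT x|M. iexp (- (t * a / b)) * iexp (t / b * x))"
    unfolding char_def by (subst integral_distr) (auto simp: exp_add[symmetric] field_simps diff_divide_distrib)
  then show ?thesis by (simp add: char_def)
qed

text \<open>Stated for any law \<open>\<mu>\<close> whose characteristic function is an
  \<open>n\<close>-th power, as independence enters only in this form; \<open>C\<close> depends on
  \<open>\<nu>\<close> alone. Centring contributes only a phase and scaling replaces
  \<open>s^2\<close> by \<open>s^2 / v\<close>, so \<open>dec\<close> carries over to the
  standardised law.\<close>

theorem berry_esseen:
  assumes nu: "real_distribution \<nu>"
    and i1: "integrable \<nu> (\<lambda>x. x)" and m: "(\<integral>x. x \<partial>\<nu>) = m"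
    and i2: "integrable \<nu> (\<lambda>x. x\<^sup>2)" and v: "(\<integral>x. (x - m)\<^sup>2 \<partial>\<nu>) = v" "0 < v"
    and i3: "integrable \<nu> (\<lambda>x. \<bar>x\<bar>^3)"
    and dec: "\<And>s. cmod (char \<nu> s) \<le> 1 / sqrt (1 + s\<^sup>2)"
  shows "\<exists>C. \<forall>n\<ge>4. \<forall>\<mu>. real_distribution \<mu> \<longrightarrow> (\<forall>t. char \<mu> t = char \<nu> t ^ n) \<longrightarrow>
    (\<forall>x. \<bar>cdf \<mu> x - ncdf ((x - real n * m) / sqrt (real n * v))\<bar> \<le> C / sqrt (real n))"
proof -
  interpret real_distribution \<nu> by (rule nu)
  define \<nu>0 where "\<nu>0 = distr \<nu> borel (\<lambda>x. (x - m) / sqrt v)"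
  have nu0: "real_distribution \<nu>0" unfolding \<nu>0_def by (rule real_distribution_distr) simp
  have c0: "char \<nu>0 s = iexp (- (s * m / sqrt v)) * char \<nu> (s / sqrt v)" for s
    unfolding \<nu>0_def using v by (intro char_distr_affine nu) auto
  have i3': "integrable \<nu> (\<lambda>x. \<bar>(x - m) / sqrt v\<bar>^3)"
  proof (rule Bochner_Integration.integrable_bound)
    show "integrable \<nu> (\<lambda>x. (4 * \<bar>x\<bar>^3 + 4 * \<bar>m\<bar>^3) / sqrt v ^ 3)" using i3 by simp
    have "\<bar>x - m\<bar>^3 \<le> 4 * \<bar>x\<bar>^3 + 4 * \<bar>m\<bar>^3" for x
    proof -
      have "\<bar>x - m\<bar>^3 \<le> (\<bar>x\<bar> + \<bar>m\<bar>)^3" by (intro power_mono) auto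
      moreover have "0 \<le> 3 * ((\<bar>x\<bar> + \<bar>m\<bar>) * (\<bar>x\<bar> - \<bar>m\<bar>)\<^sup>2)" by (intro mult_nonneg_nonneg add_nonneg_nonneg) auto
      moreover have "4 * a^3 + 4 * b^3 - (a + b)^3 = 3 * ((a + b) * (a - b)\<^sup>2)" for a b :: real by algebra
      ultimately show ?thesis by (smt (verit))
    qed
    then have "\<bar>x - m\<bar>^3 / sqrt v ^ 3 \<le> (4 * \<bar>x\<bar>^3 + 4 * \<bar>m\<bar>^3) / sqrt v ^ 3" for x
      using v by (intro divide_right_mono) auto
    moreover have "norm (\<bar>(x - m) / sqrt v\<bar>^3) = \<bar>x - m\<bar>^3 / sqrt v ^ 3" for x
      using v by (simp add: abs_divide power_divide)
    moreover have "y \<le> norm y" for y :: real by simp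
    ultimately show "AE x in \<nu>. norm (\<bar>(x - m) / sqrt v\<bar>^3) \<le> norm ((4 * \<bar>x\<bar>^3 + 4 * \<bar>m\<bar>^3) / sqrt v ^ 3)"
      by (intro AE_I2) (metis order_trans)
  qed simp
  have "\<exists>C. \<forall>n\<ge>4. \<exists>g. integrable lborel g \<and> (\<forall>t. 0 \<le> g t) \<and>
      (\<forall>t. cmod (char \<nu>0 (t / sqrt (real n)) ^ n - of_real (exp (- t\<^sup>2 / 2))) \<le> \<bar>t\<bar> * g t) \<and>
      (\<integral>t. g t \<partial>lborel) / pi \<le> C / sqrt (real n)"
  proof (rule char_power_normal_bound[OF nu0])
    have i2': "integrable \<nu> (\<lambda>x. (x - m)\<^sup>2)" using i1 i2 by (simp add: power2_diff)
    have i1': "integrable \<nu> (\<lambda>x. x - m)" using i1 by simp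
    show "integrable \<nu>0 (\<lambda>x. x)" using i1' by (simp add: \<nu>0_def integrable_distr_eq)
    have "(\<integral>x. x \<partial>\<nu>0) = (\<integral>x. (x - m) / sqrt v \<partial>\<nu>)" unfolding \<nu>0_def by (rule integral_distr) auto
    also have "\<dots> = (\<integral>x. x - m \<partial>\<nu>) / sqrt v" by (rule integral_divide_zero)
    also have "(\<integral>x. x - m \<partial>\<nu>) = (\<integral>x. x \<partial>\<nu>) - (\<integral>x. m \<partial>\<nu>)" by (rule Bochner_Integration.integral_diff) (rule i1, simp)
    also have "(\<integral>x. m \<partial>\<nu>) = m" by (rule lebesgue_integral_const[THEN trans]) (simp add: prob_space[unfolded space_eq_univ])
    finally show "(\<integral>x. x \<partial>\<nu>0) = 0" by (simp only: m) simp
    show "integrable \<nu>0 (\<lambda>x. x\<^sup>2)" using i2' by (simp add: \<nu>0_def integrable_distr_eq power_divide)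
    show "(\<integral>x. x\<^sup>2 \<partial>\<nu>0) = 1" using v by (simp add: \<nu>0_def integral_distr power_divide)
    show "integrable \<nu>0 (\<lambda>x. \<bar>x\<bar>^3)" using i3' by (simp add: \<nu>0_def integrable_distr_eq)
    show "cmod (char \<nu>0 s) \<le> 1 / sqrt (1 + s\<^sup>2 / v)" for s
      using dec[of "s / sqrt v"] v by (simp add: c0 norm_mult power_divide)
  qed fact
  then obtain C where C: "\<And>n. 4 \<le> n \<Longrightarrow> \<exists>g. integrable lborel g \<and> (\<forall>t. 0 \<le> g t) \<and>
      (\<forall>t. cmod (char \<nu>0 (t / sqrt (real n)) ^ n - of_real (exp (- t\<^sup>2 / 2))) \<le> \<bar>t\<bar> * g t) \<and>
      (\<integral>t. g t \<partial>lborel) / pi \<le> C / sqrt (real n)" by blast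
  show ?thesis
  proof (intro exI[of _ C] allI impI)
    fix n :: nat and \<mu> :: "real measure" and x :: real
    assume n: "4 \<le> n" and mu: "real_distribution \<mu>" and ch: "\<forall>t. char \<mu> t = char \<nu> t ^ n"
    interpret mu: real_distribution \<mu> by (rule mu)
    define r where "r = sqrt (real n * v)"
    have r: "0 < r" using n v by (simp add: r_def)
    define M where "M = distr \<mu> borel (\<lambda>x. (x - real n * m) / r)"
    have M: "real_distribution M" unfolding M_def by (rule mu.real_distribution_distr) simp
    have cM: "char M t = char \<nu>0 (t / sqrt (real n)) ^ n" for t
    proof -
      have "char M t = iexp (- (t * (real n * m) / r)) * char \<mu> (t / r)"
        unfolding M_def using r by (intro char_distr_affine mu) auto
      also have "char \<mu> (t / r) = char \<nu> (t / sqrt (real n) / sqrt v) ^ n"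
        using ch by (simp add: r_def real_sqrt_mult)
      also have "iexp (- (t * (real n * m) / r)) = iexp (- (t / sqrt (real n) * m / sqrt v)) ^ n"
        unfolding exp_of_nat_mult[symmetric] by (simp add: r_def real_sqrt_mult mult_ac)
      finally show ?thesis by (simp add: c0 power_mult_distrib)
    qed
    obtain g where g: "integrable lborel g" "\<And>t. 0 \<le> g t"
      "\<And>t. cmod (char \<nu>0 (t / sqrt (real n)) ^ n - of_real (exp (- t\<^sup>2 / 2))) \<le> \<bar>t\<bar> * g t"
      "(\<integral>t. g t \<partial>lborel) / pi \<le> C / sqrt (real n)" using C[OF n] by blast
    let ?y = "(x - real n * m) / r"
    have "\<bar>cdf M ?y - ncdf ?y\<bar> \<le> (\<integral>t. g t \<partial>lborel) / pi"
      by (rule cdf_char_diff[OF M real_dist_normal_dist std_normal_atomless std_normal_lipschitz g(1,2)])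
         (use g(3) in \<open>simp_all add: cM char_std_normal_distribution\<close>)
    also have "cdf M ?y = cdf \<mu> x"
    proof -
      have "(\<lambda>x. (x - real n * m) / r) -` {..?y} = {..x}" using r by (auto simp: divide_le_cancel)
      then show ?thesis by (simp add: cdf_def M_def measure_distr)
    qed
    finally show "\<bar>cdf \<mu> x - ncdf ((x - real n * m) / sqrt (real n * v))\<bar> \<le> C / sqrt (real n)"
      using g(4) by (simp add: r_def)
  qed
qed

section \<open>Affine substitution in the noise vector\<close>

abbreviation cvec :: "nat \<Rightarrow> (nat \<Rightarrow> complex) measure" where
  "cvec N \<equiv> PiM {..<N} (\<lambda>_. lborel)"

definition vdens :: "nat \<Rightarrow> real \<Rightarrow> (nat \<Rightarrow> complex) \<Rightarrow> real" where
  "vdens N s2 z = (\<Prod>k<N. cdens s2 (z k))"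

text \<open>A sum of logarithms and not the logarithm of a product, so that the i.i.d. structure is
  visible. Where some \<open>h k\<close> vanishes it loses its meaning, but such \<open>h\<close>
  form a null set.\<close>

definition infod :: "nat \<Rightarrow> real \<Rightarrow> (nat \<Rightarrow> complex) \<Rightarrow> (nat \<Rightarrow> complex) \<Rightarrow> real" where
  "infod N s2 h z = (\<Sum>k<N. ln ((cmod (h k))\<^sup>2) - ln (pi * s2) - (cmod (z k))\<^sup>2 / s2)"

definition hdet :: "nat \<Rightarrow> (nat \<Rightarrow> complex) \<Rightarrow> real" where
  "hdet N h = (\<Prod>k<N. (cmod (h k))\<^sup>2)"

lemma vdens_pos: "0 < s2 \<Longrightarrow> 0 < vdens N s2 z"
  unfolding vdens_def by (intro prod_pos) (auto simp: cdens_pos)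

lemma exp_infod:
  assumes "0 < s2" "\<forall>k<N. h k \<noteq> 0"
  shows "exp (infod N s2 h z) = vdens N s2 z * hdet N h"
proof -
  have "exp (ln ((cmod (h k))\<^sup>2) - ln (pi * s2) - (cmod (z k))\<^sup>2 / s2) = cdens s2 (z k) * (cmod (h k))\<^sup>2" if "k < N" for k
    using assms that by (simp add: cdens_def exp_diff exp_minus divide_inverse mult_ac)
  then show ?thesis
    by (simp add: infod_def vdens_def hdet_def exp_sum prod.distrib[symmetric])
qed

lemma sets_cgaussvec [measurable_cong]: "sets (cgaussvec N s2) = sets (cvec N)"
  unfolding cgaussvec_def by (intro sets_PiM_cong) auto

lemma space_cgaussvec: "space (cgaussvec N s2) = space (cvec N)"
  by (intro sets_eq_imp_space_eq sets_cgaussvec)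

lemma prob_space_cgaussvec: "0 < s2 \<Longrightarrow> prob_space (cgaussvec N s2)"
  unfolding cgaussvec_def by (intro prob_space_PiM prob_space_cgauss)

lemma product_prob_space_cgauss: "0 < s2 \<Longrightarrow> product_prob_space (\<lambda>_::nat. cgauss s2)"
  by (simp add: product_prob_space_def product_prob_space_axioms_def product_sigma_finite_def prob_space_cgauss prob_space_imp_sigma_finite)

lemma measurable_vdens [measurable]: "vdens N s2 \<in> borel_measurable (cvec N)"
  unfolding vdens_def[abs_def] by measurable

lemma measurable_infod [measurable]:
  "(\<lambda>x. infod N s2 (fst x) (snd x)) \<in> borel_measurable (cvec N \<Otimes>\<^sub>M cvec N)"
  "infod N s2 h \<in> borel_measurable (cvec N)"
  unfolding infod_def[abs_def] by measurable

text \<open>\<open>h k * (w k - p k)\<close> is the noise that carries the faded \<open>p\<close> to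
  the faded \<open>w\<close>. In the variable \<open>w\<close>, before fading, the decision regions
  of all points \<open>p\<close> are measured by one reference measure. The restriction to
  \<open>{..<N}\<close> is there because the product space consists of extensional
  functions.\<close>

lemma nn_integral_cgaussvec_affine:
  assumes s2: "0 < s2" and h: "\<forall>k<N. h k \<noteq> 0" and [measurable]: "\<phi> \<in> borel_measurable (cvec N)"
  shows "(\<integral>\<^sup>+z. \<phi> z \<partial>cgaussvec N s2) =
    (\<integral>\<^sup>+w. \<phi> (\<lambda>k\<in>{..<N}. h k * (w k - p k)) * ennreal (vdens N s2 (\<lambda>k. h k * (w k - p k)) * hdet N h) \<partial>cvec N)"
proof -
  interpret G: product_prob_space "\<lambda>_::nat. cgauss s2" by (rule product_prob_space_cgauss[OF s2])
  interpret L: product_sigma_finite "\<lambda>_::nat. lborel :: complex measure" by standard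
  let ?T = "\<lambda>w. \<lambda>k\<in>{..<N}. h k * (w k - p k)"
  let ?d = "\<lambda>w. ennreal (vdens N s2 (\<lambda>k. h k * (w k - p k)) * hdet N h)"
  have [measurable]: "?d \<in> borel_measurable (cvec N)" unfolding vdens_def by measurable
  have [measurable]: "?T \<in> cvec N \<rightarrow>\<^sub>M cvec N" by measurable
  \<comment> \<open>The substitution is proved as an equality of measures: rectangles suffice, and
    there the integral factors into one-dimensional complex substitutions.\<close>
  let ?D = "distr (density (cvec N) ?d) (cvec N) ?T"
  have "?D = PiM {..<N} (\<lambda>_. cgauss s2)"
  proof (rule G.PiM_eqI)
    show "sets ?D = sets (PiM {..<N} (\<lambda>_. cgauss s2))" using sets_cgaussvec[of N s2] by (simp add: cgaussvec_def)
    fix A :: "nat \<Rightarrow> complex set" assume A: "\<And>i. i \<in> {..<N} \<Longrightarrow> A i \<in> sets (cgauss s2)"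
    then have A' [measurable]: "i \<in> {..<N} \<Longrightarrow> A i \<in> sets borel" for i by simp
    have PA: "Pi\<^sub>E {..<N} A \<in> sets (cvec N)" using A' by (intro sets_PiM_I_finite) auto
    have one: "(\<integral>\<^sup>+w. ennreal (cdens s2 (h k * (w - p k)) * (cmod (h k))\<^sup>2) * indicator (A k) (h k * (w - p k)) \<partial>lborel) = emeasure (cgauss s2) (A k)"
      if k: "k < N" for k
    proof -
      have [measurable]: "A k \<in> sets borel" using A' k by simp
      have "emeasure (cgauss s2) (A k) = (\<integral>\<^sup>+w. ennreal (cdens s2 w) * indicator (A k) w \<partial>lborel)"
        unfolding cgauss_eq_density by (subst emeasure_density) auto
      also have "\<dots> = ennreal ((cmod (h k))\<^sup>2) * (\<integral>\<^sup>+w. ennreal (cdens s2 (h k * w + (- h k * p k))) * indicator (A k) (h k * w + (- h k * p k)) \<partial>lborel)"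
        using h k by (intro nn_integral_complex_affine) auto
      also have "\<dots> = (\<integral>\<^sup>+w. ennreal ((cmod (h k))\<^sup>2) * (ennreal (cdens s2 (h k * w + (- h k * p k))) * indicator (A k) (h k * w + (- h k * p k))) \<partial>lborel)"
        by (rule nn_integral_cmult[symmetric]) measurable
      also have "\<dots> = (\<integral>\<^sup>+w. ennreal (cdens s2 (h k * (w - p k)) * (cmod (h k))\<^sup>2) * indicator (A k) (h k * (w - p k)) \<partial>lborel)"
        by (intro nn_integral_cong) (simp add: ennreal_mult' right_diff_distrib mult_ac)
      finally show ?thesis ..
    qed
    have "emeasure ?D (Pi\<^sub>E {..<N} A) = (\<integral>\<^sup>+w. ?d w * indicator (?T -` Pi\<^sub>E {..<N} A \<inter> space (cvec N)) w \<partial>cvec N)"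
    proof -
      have "emeasure ?D (Pi\<^sub>E {..<N} A) = emeasure (density (cvec N) ?d) (?T -` Pi\<^sub>E {..<N} A \<inter> space (cvec N))"
        using PA by (subst emeasure_distr) auto
      also have "\<dots> = (\<integral>\<^sup>+w. ?d w * indicator (?T -` Pi\<^sub>E {..<N} A \<inter> space (cvec N)) w \<partial>cvec N)"
        using PA by (intro emeasure_density measurable_sets[where A = "cvec N"]) measurable
      finally show ?thesis .
    qed
    also have "\<dots> = (\<integral>\<^sup>+w. (\<Prod>k<N. ennreal (cdens s2 (h k * (w k - p k)) * (cmod (h k))\<^sup>2) * indicator (A k) (h k * (w k - p k))) \<partial>cvec N)"
    proof (intro nn_integral_cong)
      fix w assume w: "w \<in> space (cvec N)"
      have "indicator (?T -` Pi\<^sub>E {..<N} A \<inter> space (cvec N)) w = (\<Prod>k<N. indicator (A k) (h k * (w k - p k)) :: ennreal)"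
        using w by (auto simp: indicator_def PiE_iff prod_zero_iff split: if_splits)
      moreover have "?d w = (\<Prod>k<N. ennreal (cdens s2 (h k * (w k - p k)) * (cmod (h k))\<^sup>2))"
        using s2 by (simp add: vdens_def hdet_def prod.distrib[symmetric] prod_ennreal cdens_pos less_imp_le)
      ultimately show "?d w * indicator (?T -` Pi\<^sub>E {..<N} A \<inter> space (cvec N)) w =
         (\<Prod>k<N. ennreal (cdens s2 (h k * (w k - p k)) * (cmod (h k))\<^sup>2) * indicator (A k) (h k * (w k - p k)))"
        by (simp only: prod.distrib)
    qed
    also have "\<dots> = (\<Prod>k<N. \<integral>\<^sup>+w. ennreal (cdens s2 (h k * (w - p k)) * (cmod (h k))\<^sup>2) * indicator (A k) (h k * (w - p k)) \<partial>lborel)"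
      by (rule L.product_nn_integral_prod) auto
    also have "\<dots> = (\<Prod>k<N. emeasure (cgauss s2) (A k))" by (intro prod.cong) (auto simp: one)
    finally show "emeasure ?D (Pi\<^sub>E {..<N} A) = (\<Prod>k<N. emeasure (cgauss s2) (A k))" .
  qed simp
  then have "(\<integral>\<^sup>+z. \<phi> z \<partial>cgaussvec N s2) = (\<integral>\<^sup>+z. \<phi> z \<partial>?D)" by (simp add: cgaussvec_def)
  also have "\<dots> = (\<integral>\<^sup>+w. \<phi> (?T w) \<partial>density (cvec N) ?d)" by (rule nn_integral_distr) measurable
  also have "\<dots> = (\<integral>\<^sup>+w. ?d w * \<phi> (?T w) \<partial>cvec N)" by (rule nn_integral_density) measurable
  also have "\<dots> = (\<integral>\<^sup>+w. \<phi> (?T w) * ?d w \<partial>cvec N)" by (simp only: mult.commute)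
  finally show ?thesis .
qed

lemma AE_cgaussvec_nonzero:
  assumes "0 < s2" shows "AE h in cgaussvec N s2. \<forall>k<N. h k \<noteq> 0"
proof -
  have "AE z in cgauss s2. z \<noteq> 0"
    unfolding cgauss_eq_density using AE_lborel_singleton[of "0::complex"] by (auto simp: AE_density)
  then have "AE h in cgaussvec N s2. h k \<noteq> 0" if "k < N" for k
    unfolding cgaussvec_def using that by (intro AE_PiM_component prob_space_cgauss assms) auto
  then have "AE h in cgaussvec N s2. \<forall>k\<in>{..<N}. h k \<noteq> 0" by (intro AE_finite_allI) auto
  then show ?thesis by auto
qed

section \<open>The converse bound\<close>

lemma le_Limsup_frequently:
  fixes f :: "_ \<Rightarrow> _ :: complete_linorder"
  assumes "\<exists>\<^sub>F x in F. c \<le> f x" shows "c \<le> Limsup F f"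
proof (rule ccontr)
  assume "\<not> ?thesis"
  then have "\<forall>\<^sub>F x in F. f x < c" by (intro Limsup_lessD) simp
  then show False using assms by (simp add: frequently_def not_le)
qed

lemma frequently_less_Limsup:
  fixes f :: "_ \<Rightarrow> _ :: complete_linorder"
  assumes "c < Limsup F f" shows "\<exists>\<^sub>F x in F. c < f x"
proof (rule ccontr)
  assume "\<not> ?thesis"
  then have "\<forall>\<^sub>F x in F. f x \<le> c" by (simp add: frequently_def not_less)
  then have "Limsup F f \<le> c" by (rule Limsup_bounded)
  then show False using assms by simp
qed

lemma sqdist_fade: "sqdist N (fade h w) (fade h p) = (\<Sum>k<N. (cmod (h k))\<^sup>2 * (cmod (w k - p k))\<^sup>2)"
  unfolding sqdist_def fade_def by (simp add: right_diff_distrib[symmetric] norm_mult power_mult_distrib)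

lemma measurable_sqdist_fade [measurable]:
  "(\<lambda>w. sqdist N (fade h w) (fade h p)) \<in> borel_measurable (cvec N)"
  unfolding sqdist_fade by measurable

text \<open>Ties count as correct decisions, so Voronoi cells overlap on bisectors; a bisector is a real
  affine hyperplane in any coordinate in which the two points differ.\<close>

lemma bisector_null:
  assumes h: "\<forall>k<N. h k \<noteq> 0" and j: "j < N" "p j \<noteq> q j"
  shows "{w \<in> space (cvec N). sqdist N (fade h w) (fade h p) = sqdist N (fade h w) (fade h q)} \<in> null_sets (cvec N)"
proof -
  interpret L: product_sigma_finite "\<lambda>_::nat. lborel :: complex measure" by standard
  let ?X = "{w \<in> space (cvec N). sqdist N (fade h w) (fade h p) = sqdist N (fade h w) (fade h q)}"
  have X [measurable]: "?X \<in> sets (cvec N)" by measurable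
  define J where "J = {..<N} - {j}"
  have J: "finite J" "j \<notin> J" "{..<N} = insert j J" using j by (auto simp: J_def)
  have "emeasure (cvec N) ?X = (\<integral>\<^sup>+w. indicator ?X w \<partial>cvec N)" by simp
  also have "\<dots> = (\<integral>\<^sup>+x. \<integral>\<^sup>+y. indicator ?X (x(j := y)) \<partial>lborel \<partial>PiM J (\<lambda>_. lborel))"
    using X unfolding J(3) by (intro L.product_nn_integral_insert J borel_measurable_indicator)
  also have "\<dots> = (\<integral>\<^sup>+x. 0 \<partial>PiM J (\<lambda>_. lborel :: complex measure))"
  proof (rule nn_integral_cong)
    fix x :: "nat \<Rightarrow> complex"
    let ?c = "\<Sum>k\<in>J. (cmod (h k))\<^sup>2 * (cmod (x k - q k))\<^sup>2 - (cmod (h k))\<^sup>2 * (cmod (x k - p k))\<^sup>2"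
    let ?a = "2 * (q j - p j)" let ?b = "?c / (cmod (h j))\<^sup>2 - (cmod (p j))\<^sup>2 + (cmod (q j))\<^sup>2"
    have "negligible {y. ?a \<bullet> y = ?b}" using j by (intro negligible_hyperplane) auto
    then have "{y. ?a \<bullet> y = ?b} \<in> null_sets lborel"
      by (subst null_sets_completion_iff[symmetric]) (auto simp: negligible_iff_null_sets)
    then have ae: "AE y in lborel. \<not> ?a \<bullet> y = ?b"
      by (intro AE_I') auto
    have "indicator ?X (x(j := y)) = (0::ennreal)" if ne: "\<not> ?a \<bullet> y = ?b" for y
    proof -
      have "(\<Sum>k<N. (cmod (h k))\<^sup>2 * (cmod ((x(j := y)) k - r k))\<^sup>2) = (cmod (h j))\<^sup>2 * (cmod (y - r j))\<^sup>2 + (\<Sum>k\<in>J. (cmod (h k))\<^sup>2 * (cmod (x k - r k))\<^sup>2)" for r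
        unfolding J(3) using J(1,2) by (subst sum.insert) (auto intro!: sum.cong)
      moreover have "(cmod (y - p j))\<^sup>2 - (cmod (y - q j))\<^sup>2 = ?a \<bullet> y + (cmod (p j))\<^sup>2 - (cmod (q j))\<^sup>2"
        unfolding cmod_power2 by (simp add: inner_complex_def power2_eq_square algebra_simps)
      moreover have gen: "(a * u + s) - (a * v + t) = a * (u - v) - (t - s)" for a u v s t :: real
        by (simp add: algebra_simps)
      ultimately have "sqdist N (fade h (x(j := y))) (fade h p) - sqdist N (fade h (x(j := y))) (fade h q)
          = (cmod (h j))\<^sup>2 * (?a \<bullet> y + (cmod (p j))\<^sup>2 - (cmod (q j))\<^sup>2) - ?c"
        unfolding sqdist_fade by (simp only: gen sum_subtractf)
      also have "\<dots> \<noteq> 0" using ne h j by (simp add: field_simps)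
      finally show ?thesis by (simp add: indicator_def)
    qed
    then have "(\<integral>\<^sup>+y. indicator ?X (x(j := y)) \<partial>lborel) = (\<integral>\<^sup>+y. 0 \<partial>(lborel :: complex measure))"
      using ae by (intro nn_integral_cong_AE) (auto elim!: eventually_mono)
    then show "(\<integral>\<^sup>+y. indicator ?X (x(j := y)) \<partial>lborel) = (0::ennreal)" by simp
  qed
  finally show ?thesis using X by (simp add: null_sets_def)
qed

text \<open>The Voronoi cell of the faded \<open>p\<close>, pulled back through the fading so that
  its volume is compared with the density of \<open>S\<close> and not with that of the faded set.
  The truncating box is taken in the unfaded coordinates too.\<close>

definition cellbox :: "nat \<Rightarrow> (nat \<Rightarrow> complex) \<Rightarrow> (nat \<Rightarrow> complex) set \<Rightarrow> (nat \<Rightarrow> complex) \<Rightarrow> real \<Rightarrow> (nat \<Rightarrow> complex) set" where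
  "cellbox N h S p R = {w \<in> space (cvec N). (\<forall>q\<in>S. sqdist N (fade h w) (fade h p) \<le> sqdist N (fade h w) (fade h q)) \<and>
      (\<forall>k<N. \<bar>Re (w k - p k)\<bar> \<le> R \<and> \<bar>Im (w k - p k)\<bar> \<le> R)}"

lemma sets_cellbox [measurable]:
  assumes "countable S" shows "cellbox N h S p R \<in> sets (cvec N)"
proof -
  have "{w \<in> space (cvec N). \<forall>k\<in>{..<N}. \<bar>Re (w k - p k)\<bar> \<le> R \<and> \<bar>Im (w k - p k)\<bar> \<le> R} \<in> sets (cvec N)"
    by measurable
  then show ?thesis
    unfolding cellbox_def using assms by (intro sets.sets_Collect_conj sets.sets_Collect_countable_All') auto
qed

lemma emeasure_box:
  assumes "0 \<le> c"
  shows "emeasure (cvec N) (PiE {..<N} (\<lambda>_. {z. \<bar>Re z\<bar> \<le> c \<and> \<bar>Im z\<bar> \<le> c})) = ennreal ((2 * c) ^ (2 * N))"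
proof -
  interpret L: product_sigma_finite "\<lambda>_::nat. lborel :: complex measure" by standard
  have b: "{z. \<bar>Re z\<bar> \<le> c \<and> \<bar>Im z\<bar> \<le> c} = cbox (Complex (-c) (-c)) (Complex c c)"
    by (auto simp: cbox_def Basis_complex_def)
  have "emeasure lborel (cbox (Complex (-c) (-c)) (Complex c c)) = ennreal ((2 * c)\<^sup>2)"
    using assms by (subst emeasure_lborel_cbox) (auto simp: Basis_complex_def power2_eq_square)
  then show ?thesis
    unfolding b using assms by (subst L.emeasure_PiM) (auto simp: ennreal_power power_mult)
qed

text \<open>Outside the null set of bisectors the cells are disjoint, and they lie in a cube of side
  \<open>a + 2 * R\<close>. Only the total volume is controlled; a single cell may be far above
  average, which does not disturb a mean over the points of the cube.\<close>

lemma sum_emeasure_cellbox_le: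
  assumes h: "\<forall>k<N. h k \<noteq> 0" and S: "is_IC N S" and a: "0 \<le> a" and R: "0 \<le> R"
  shows "(\<Sum>p\<in>S \<inter> cube N a. emeasure (cvec N) (cellbox N h S p R)) \<le> ennreal ((a + 2 * R) ^ (2 * N))"
proof -
  let ?K = "S \<inter> cube N a"
  have fin: "finite ?K" and cS: "countable S" using S by (auto simp: is_IC_def)
  let ?T = "\<lambda>p q. {w \<in> space (cvec N). sqdist N (fade h w) (fade h p) = sqdist N (fade h w) (fade h q)}"
  define E where "E = (\<Union>p\<in>?K. \<Union>q\<in>?K - {p}. ?T p q)"
  have E: "E \<in> null_sets (cvec N)"
    unfolding E_def
  proof (intro null_sets_UN' countable_finite)
    fix p q assume pq: "p \<in> ?K" "q \<in> ?K - {p}"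
    \<comment> \<open>Points of a constellation vanish from coordinate \<open>N\<close> on, so
      distinct ones differ in a coordinate below \<open>N\<close>.\<close>
    then have "p k = 0" "q k = 0" if "N \<le> k" for k using S that by (auto simp: is_IC_def)
    moreover have "p \<noteq> q" using pq by auto
    ultimately obtain j where "j < N" "p j \<noteq> q j" by (metis ext not_le)
    then show "?T p q \<in> null_sets (cvec N)" by (rule bisector_null[OF h])
  qed (use fin in auto)
  let ?B = "PiE {..<N} (\<lambda>_. {z. \<bar>Re z\<bar> \<le> (a + 2 * R) / 2 \<and> \<bar>Im z\<bar> \<le> (a + 2 * R) / 2})"
  have "(\<Sum>p\<in>?K. emeasure (cvec N) (cellbox N h S p R)) = (\<Sum>p\<in>?K. emeasure (cvec N) (cellbox N h S p R - E))"
    using E cS by (intro sum.cong refl emeasure_Diff_null_set[symmetric]) auto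
  also have "\<dots> = emeasure (cvec N) (\<Union>p\<in>?K. cellbox N h S p R - E)"
  proof (rule sum_emeasure)
    show "disjoint_family_on (\<lambda>p. cellbox N h S p R - E) ?K"
      unfolding disjoint_family_on_def
    proof (intro ballI impI equals0I)
      fix p q w assume pq: "p \<in> ?K" "q \<in> ?K" "p \<noteq> q"
        and w: "w \<in> (cellbox N h S p R - E) \<inter> (cellbox N h S q R - E)"
      have "sqdist N (fade h w) (fade h p) = sqdist N (fade h w) (fade h q)"
        using w pq by (intro antisym) (auto simp: cellbox_def)
      then have "w \<in> ?T p q" using w by (simp add: cellbox_def)
      then have "w \<in> E" using pq unfolding E_def by blast
      then show False using w by simp
    qed
  qed (use E cS fin in auto)
  also have "\<dots> \<le> emeasure (cvec N) ?B"
  proof (rule emeasure_mono)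
    show "(\<Union>p\<in>?K. cellbox N h S p R - E) \<subseteq> ?B"
    proof
      fix w assume "w \<in> (\<Union>p\<in>?K. cellbox N h S p R - E)"
      then obtain p where p: "p \<in> cube N a" and w: "w \<in> cellbox N h S p R" by auto
      have "\<bar>Re (w k)\<bar> \<le> (a + 2 * R) / 2 \<and> \<bar>Im (w k)\<bar> \<le> (a + 2 * R) / 2" if k: "k < N" for k
      proof -
        have "\<bar>Re (p k)\<bar> < a / 2 \<and> \<bar>Im (p k)\<bar> < a / 2" using p k by (auto simp: cube_def)
        moreover have "\<bar>Re (w k) - Re (p k)\<bar> \<le> R \<and> \<bar>Im (w k) - Im (p k)\<bar> \<le> R" using w k by (auto simp: cellbox_def)
        ultimately show ?thesis by (simp add: abs_le_iff abs_less_iff field_simps) linarith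
      qed
      moreover have "w \<in> extensional {..<N}" using w by (auto simp: cellbox_def space_PiM PiE_def)
      ultimately show "w \<in> ?B" by (auto simp: PiE_iff)
    qed
    show "?B \<in> sets (cvec N)" by (intro sets_PiM_I_finite) auto
  qed
  also have "\<dots> = ennreal ((a + 2 * R) ^ (2 * N))"
  proof -
    have "2 * ((a + 2 * R) / 2) = a + 2 * R" by simp
    then show ?thesis using emeasure_box[of "(a + 2 * R) / 2" N] a R by (simp only:)
  qed
  finally show ?thesis .
qed

lemma measurable_ml_err [measurable]:
  assumes "countable T"
  shows "{z \<in> space (cgaussvec N s2). \<exists>q\<in>T. sqdist N (\<lambda>k. p k + z k) q < sqdist N (\<lambda>k. p k + z k) p} \<in> sets (cgaussvec N s2)"
  using assms unfolding sqdist_def by (intro sets.sets_Collect_countable_Ex') auto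

text \<open>The three terms split the noise that leads to a correct decision: high information
  density, noise leaving the box, and the rest. On the rest the noise density in the variable
  \<open>w\<close> is at most \<open>\<kappa>\<close>, by \<open>exp_infod\<close>, so its
  probability is at most \<open>\<kappa>\<close> times the volume of the truncated cell.\<close>

lemma correct_prob_le:
  assumes s2: "0 < s2" and h: "\<forall>k<N. h k \<noteq> 0" and S: "countable S" and kap: "0 < \<kappa>"
  defines "G \<equiv> cgaussvec N s2"
  shows "ennreal (1 - ml_err_prob N s2 (fade h ` S) (fade h p)) \<le>
    emeasure G {z \<in> space G. ln \<kappa> < infod N s2 h z}
    + emeasure G {z \<in> space G. \<exists>k<N. \<not> (\<bar>Re (z k / h k)\<bar> \<le> R \<and> \<bar>Im (z k / h k)\<bar> \<le> R)}
    + ennreal \<kappa> * emeasure (cvec N) (cellbox N h S p R)"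
proof -
  interpret G: prob_space G unfolding G_def by (rule prob_space_cgaussvec[OF s2])
  have [measurable_cong]: "sets G = sets (cvec N)" unfolding G_def by (rule sets_cgaussvec)
  have spG: "space G = space (cvec N)" unfolding G_def by (rule space_cgaussvec)
  let ?err = "{z \<in> space G. \<exists>q\<in>fade h ` S. sqdist N (\<lambda>k. fade h p k + z k) q < sqdist N (\<lambda>k. fade h p k + z k) (fade h p)}"
  let ?I = "{z \<in> space G. ln \<kappa> < infod N s2 h z}"
  let ?O = "{z \<in> space G. \<exists>k<N. \<not> (\<bar>Re (z k / h k)\<bar> \<le> R \<and> \<bar>Im (z k / h k)\<bar> \<le> R)}"
  have err [measurable]: "?err \<in> sets G" unfolding G_def by (rule measurable_ml_err[OF countable_image[OF S]])
  have I [measurable]: "?I \<in> sets G" "?O \<in> sets G" by measurable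
  let ?C = "(space G - ?err) - ?I - ?O"
  have "ennreal (1 - ml_err_prob N s2 (fade h ` S) (fade h p)) = emeasure G (space G - ?err)"
    unfolding ml_err_prob_def G_def[symmetric] G.emeasure_eq_measure G.prob_compl[OF err] ..
  also have "\<dots> \<le> emeasure G ?I + emeasure G ?O + emeasure G ?C"
  proof -
    have *: "emeasure G (space G - X) \<le> emeasure G Y + emeasure G Z + emeasure G ((space G - X) - Y - Z)"
      if [measurable]: "X \<in> sets G" "Y \<in> sets G" "Z \<in> sets G" for X Y Z
    proof -
      have "emeasure G (space G - X) \<le> emeasure G ((Y \<union> Z) \<union> ((space G - X) - Y - Z))"
        by (intro emeasure_mono) (blast, measurable)
      also have "\<dots> \<le> emeasure G (Y \<union> Z) + emeasure G ((space G - X) - Y - Z)"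
        by (rule emeasure_subadditive) measurable
      also have "emeasure G (Y \<union> Z) \<le> emeasure G Y + emeasure G Z"
        by (rule emeasure_subadditive) measurable
      finally show ?thesis by (simp add: add_right_mono)
    qed
    show ?thesis by (rule *[OF err I])
  qed
  also have "emeasure G ?C \<le> ennreal \<kappa> * emeasure (cvec N) (cellbox N h S p R)"
  proof -
    let ?T = "\<lambda>w. \<lambda>k\<in>{..<N}. h k * (w k - p k)"
    have Cs: "?C \<in> sets G" using err I by (intro sets.Diff sets.top)
    then have "emeasure G ?C = (\<integral>\<^sup>+z. indicator ?C z \<partial>G)" by (rule nn_integral_indicator[symmetric])
    also have "\<dots> = (\<integral>\<^sup>+w. indicator ?C (?T w) * ennreal (vdens N s2 (\<lambda>k. h k * (w k - p k)) * hdet N h) \<partial>cvec N)"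
      using Cs sets_cgaussvec[of N s2] unfolding G_def by (intro nn_integral_cgaussvec_affine[OF s2 h] borel_measurable_indicator) simp
    also have "\<dots> \<le> (\<integral>\<^sup>+w. ennreal \<kappa> * indicator (cellbox N h S p R) w \<partial>cvec N)"
    proof (rule nn_integral_mono)
      fix w assume w: "w \<in> space (cvec N)"
      show "indicator ?C (?T w) * ennreal (vdens N s2 (\<lambda>k. h k * (w k - p k)) * hdet N h) \<le> ennreal \<kappa> * indicator (cellbox N h S p R) w"
      proof (cases "?T w \<in> ?C")
        case True
        have i: "infod N s2 h (?T w) \<le> ln \<kappa>" using True by auto
        have "vdens N s2 (\<lambda>k. h k * (w k - p k)) = vdens N s2 (?T w)" by (simp add: vdens_def)
        then have "vdens N s2 (\<lambda>k. h k * (w k - p k)) * hdet N h = exp (infod N s2 h (?T w))"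
          using exp_infod[OF s2 h] by simp
        also have "\<dots> \<le> \<kappa>" using i kap by (metis exp_le_cancel_iff exp_ln)
        finally have 1: "vdens N s2 (\<lambda>k. h k * (w k - p k)) * hdet N h \<le> \<kappa>" .
        have sq: "sqdist N (\<lambda>k. fade h p k + ?T w k) y = sqdist N (fade h w) y" for y
          unfolding sqdist_def by (intro sum.cong) (auto simp: fade_def right_diff_distrib)
        have Tsp: "?T w \<in> space G" using True by blast
        have "\<forall>q\<in>S. \<not> sqdist N (\<lambda>k. fade h p k + ?T w k) (fade h q) < sqdist N (\<lambda>k. fade h p k + ?T w k) (fade h p)"
          using True Tsp by blast
        moreover have "\<forall>k<N. \<bar>Re (?T w k / h k)\<bar> \<le> R \<and> \<bar>Im (?T w k / h k)\<bar> \<le> R" using True Tsp by blast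
        moreover have "?T w k / h k = w k - p k" if "k < N" for k using h that by simp
        ultimately have "w \<in> cellbox N h S p R" using w unfolding cellbox_def sq not_less by simp
        then show ?thesis using 1 True by (simp add: ennreal_leI)
      qed simp
    qed
    also have "\<dots> = ennreal \<kappa> * emeasure (cvec N) (cellbox N h S p R)"
      using S by (intro nn_integral_cmult_indicator) auto
    finally show ?thesis .
  qed
  finally show ?thesis by (simp add: add_left_mono)
qed

text \<open>The bad events decrease to the empty set as \<open>R\<close> grows. \<open>R\<close>
  depends on \<open>h\<close>, which is harmless: the fading is fixed while the cube grows.\<close>

lemma noise_box_tail:
  assumes s2: "0 < s2" and e: "0 < \<eta>"
  shows "\<exists>R\<ge>0. measure (cgaussvec N s2) {z \<in> space (cgaussvec N s2). \<exists>k<N. \<not> (\<bar>Re (z k / h k)\<bar> \<le> R \<and> \<bar>Im (z k / h k)\<bar> \<le> R)} \<le> \<eta>"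
proof -
  let ?G = "cgaussvec N s2"
  interpret G: prob_space ?G by (rule prob_space_cgaussvec[OF s2])
  let ?A = "\<lambda>n::nat. {z \<in> space ?G. \<exists>k<N. \<not> (\<bar>Re (z k / h k)\<bar> \<le> real n \<and> \<bar>Im (z k / h k)\<bar> \<le> real n)}"
  have [measurable]: "?A n \<in> sets ?G" for n by measurable
  have "(\<lambda>n. measure ?G (?A n)) \<longlonglongrightarrow> measure ?G (\<Inter>n. ?A n)"
    by (intro G.finite_Lim_measure_decseq) (auto simp: decseq_def intro: order_trans)
  moreover have "(\<Inter>n. ?A n) = {}"
  proof (intro equals0I)
    fix z assume z: "z \<in> (\<Inter>n. ?A n)"
    define b where "b = (\<Sum>k<N. cmod (z k / h k))"
    obtain n :: nat where n: "b \<le> real n" using real_arch_simple by blast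
    have "\<bar>Re (z k / h k)\<bar> \<le> real n \<and> \<bar>Im (z k / h k)\<bar> \<le> real n" if "k < N" for k
    proof -
      have "cmod (z k / h k) \<le> b" unfolding b_def by (rule member_le_sum) (use that in auto)
      then show ?thesis using n abs_Re_le_cmod[of "z k / h k"] abs_Im_le_cmod[of "z k / h k"] by linarith
    qed
    moreover have "z \<in> ?A n" using z by blast
    ultimately show False by blast
  qed
  ultimately have "(\<lambda>n. measure ?G (?A n)) \<longlonglongrightarrow> 0" by simp
  then have "\<forall>\<^sub>F n in sequentially. measure ?G (?A n) < \<eta>" using e by (rule order_tendstoD)
  then obtain n where "measure ?G (?A n) < \<eta>" by (auto simp: eventually_sequentially)
  then show ?thesis by (intro exI[of _ "real n"]) auto
qed

text \<open>Summing \<open>correct_prob_le\<close> over a cube leaves \<open>\<kappa>\<close> times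
  the volume of the enlarged cube, to be compared with the number of points. One
  \<open>\<eta>\<close> pays for the truncation of the cells, the other for this volume
  term.\<close>

lemma err_given_fading_ge:
  assumes s2: "0 < s2" and N: "0 < N" and h: "\<forall>k<N. h k \<noteq> 0" and S: "is_IC N S"
    and gam: "IC_density N S = ereal \<gamma>" "0 < \<gamma>" and eta: "0 < \<eta>"
  defines "G \<equiv> cgaussvec N s2"
  shows "ennreal (measure G {z \<in> space G. infod N s2 h z \<le> ln (\<gamma> * \<eta> / 4)} - 2 * \<eta>) \<le> err_given_fading N s2 S h"
proof -
  interpret G: prob_space G unfolding G_def by (rule prob_space_cgaussvec[OF s2])
  have [measurable_cong]: "sets G = sets (cvec N)" unfolding G_def by (rule sets_cgaussvec)
  \<comment> \<open>The 4 absorbs two factors 2: the cubes used hold more than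
    \<open>\<gamma> / 2\<close> points per unit volume, and the enlarged cube has at most twice the
    volume \<open>a ^ (2 * N)\<close>. Hence \<open>\<kappa> * (2 * a ^ (2 * N))\<close> is at most
    \<open>\<eta>\<close> times the number of points.\<close>
  define \<kappa> where "\<kappa> = \<gamma> * \<eta> / 4"
  have kap: "0 < \<kappa>" using gam eta by (simp add: \<kappa>_def)
  let ?P = "measure G {z \<in> space G. infod N s2 h z \<le> ln \<kappa>}"
  let ?e = "\<lambda>s. ml_err_prob N s2 (fade h ` S) (fade h s)"
  obtain R where R: "0 \<le> R" and tail: "measure G {z \<in> space G. \<exists>k<N. \<not> (\<bar>Re (z k / h k)\<bar> \<le> R \<and> \<bar>Im (z k / h k)\<bar> \<le> R)} \<le> \<eta>"
    using noise_box_tail[OF s2 eta] unfolding G_def by blast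
  have cS: "countable S" using S by (simp add: is_IC_def)
  have P': "measure G {z \<in> space G. ln \<kappa> < infod N s2 h z} = 1 - ?P"
  proof -
    have "measure G {z \<in> space G. \<not> infod N s2 h z \<le> ln \<kappa>} = 1 - ?P" by (rule G.prob_neg) measurable
    then show ?thesis by (simp add: not_le)
  qed
  have f1: "\<exists>\<^sub>F a in at_top. ereal (\<gamma> / 2) < ereal (real (card (S \<inter> cube N a)) / a ^ (2 * N))"
    by (rule frequently_less_Limsup) (use gam in \<open>simp add: IC_density_def[symmetric]\<close>)
  have "((\<lambda>a. (a + 2 * R) ^ (2 * N) / a ^ (2 * N)) \<longlongrightarrow> 1) at_top"
  proof -
    have "((\<lambda>a. ((a + 2 * R) / a) ^ (2 * N)) \<longlongrightarrow> 1 ^ (2 * N)) at_top"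
      by (intro tendsto_power) real_asymp
    then show ?thesis by (simp add: power_divide)
  qed
  then have f2: "\<forall>\<^sub>F a in at_top. (a + 2 * R) ^ (2 * N) / a ^ (2 * N) < 2" by (rule order_tendstoD) simp
  have "\<exists>\<^sub>F a in at_top. ennreal (?P - 2 * \<eta>) \<le> ennreal ((\<Sum>s\<in>S \<inter> cube N a. ?e s) / real (card (S \<inter> cube N a)))"
    using frequently_eventually_conj[OF f1 eventually_conj[OF f2 eventually_gt_at_top[of 0]]]
  proof (rule frequently_elim1, goal_cases)
    case (1 a)
    let ?K = "S \<inter> cube N a" let ?c = "real (card ?K)"
    have fin: "finite ?K" using S by (auto simp: is_IC_def)
    have a: "0 < a" using 1 by simp
    have ce: "\<gamma> / 2 * a ^ (2 * N) < ?c" using 1 a by (simp add: field_simps)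
    have c0: "0 < ?c" using ce gam a by (smt (verit) divide_pos_pos mult_pos_pos zero_less_power)
    have bx: "(a + 2 * R) ^ (2 * N) \<le> 2 * a ^ (2 * N)" using 1 a by (simp add: field_simps)
    have e1: "?e s \<le> 1" for s unfolding ml_err_prob_def G_def[symmetric] by (rule G.prob_le_1)
    have "ennreal (\<Sum>s\<in>?K. 1 - ?e s) = (\<Sum>s\<in>?K. ennreal (1 - ?e s))" using e1 by (intro sum_ennreal[symmetric]) auto
    also have "\<dots> \<le> (\<Sum>s\<in>?K. ennreal (1 - ?P + \<eta>) + ennreal \<kappa> * emeasure (cvec N) (cellbox N h S s R))"
    proof (rule sum_mono)
      fix s
      let ?O = "{z \<in> space G. \<exists>k<N. \<not> (\<bar>Re (z k / h k)\<bar> \<le> R \<and> \<bar>Im (z k / h k)\<bar> \<le> R)}"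
      have "ennreal (1 - ?e s) \<le> emeasure G {z \<in> space G. ln \<kappa> < infod N s2 h z} + emeasure G ?O + ennreal \<kappa> * emeasure (cvec N) (cellbox N h S s R)"
        using correct_prob_le[OF s2 h cS kap] unfolding G_def .
      also have "emeasure G {z \<in> space G. ln \<kappa> < infod N s2 h z} = ennreal (1 - ?P)" by (simp only: G.emeasure_eq_measure P')
      also have "ennreal (1 - ?P) + emeasure G ?O \<le> ennreal (1 - ?P) + ennreal \<eta>"
        using tail by (intro add_left_mono) (simp only: G.emeasure_eq_measure ennreal_leI)
      also have "ennreal (1 - ?P) + ennreal \<eta> = ennreal (1 - ?P + \<eta>)" using eta by (intro ennreal_plus[symmetric]) auto
      finally show "ennreal (1 - ?e s) \<le> ennreal (1 - ?P + \<eta>) + ennreal \<kappa> * emeasure (cvec N) (cellbox N h S s R)"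
        by (simp add: add_right_mono)
    qed
    also have "\<dots> = ennreal (?c * (1 - ?P + \<eta>)) + ennreal \<kappa> * (\<Sum>s\<in>?K. emeasure (cvec N) (cellbox N h S s R))"
    proof -
      have "of_nat (card ?K) * ennreal (1 - ?P + \<eta>) = ennreal (?c * (1 - ?P + \<eta>))"
        by (simp only: ennreal_of_nat_eq_real_of_nat ennreal_mult'[OF of_nat_0_le_iff])
      then show ?thesis by (simp add: sum.distrib sum_distrib_left)
    qed
    also have "\<dots> \<le> ennreal (?c * (1 - ?P + \<eta>)) + ennreal \<kappa> * ennreal (2 * a ^ (2 * N))"
      using bx a by (intro add_left_mono mult_left_mono order_trans[OF sum_emeasure_cellbox_le[OF h S _ R]] ennreal_leI) auto
    also have "\<dots> = ennreal (?c * (1 - ?P + \<eta>) + \<kappa> * (2 * a ^ (2 * N)))"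
    proof -
      have "0 \<le> ?c * (1 - ?P + \<eta>)" "0 \<le> \<kappa> * (2 * a ^ (2 * N))" using kap a eta by auto
      then show ?thesis using kap by (simp only: ennreal_mult'[symmetric] less_imp_le ennreal_plus)
    qed
    finally have "(\<Sum>s\<in>?K. 1 - ?e s) \<le> ?c * (1 - ?P + \<eta>) + \<kappa> * (2 * a ^ (2 * N))"
      using kap a eta by (subst (asm) ennreal_le_iff) (auto intro!: add_nonneg_nonneg mult_nonneg_nonneg simp del: mult_le_0_iff zero_le_mult_iff)
    then have "?c - (\<Sum>s\<in>?K. ?e s) \<le> ?c * (1 - ?P + \<eta>) + \<kappa> * (2 * a ^ (2 * N))" by (simp add: sum_subtractf)
    moreover have "\<kappa> * (2 * a ^ (2 * N)) \<le> \<eta> * ?c"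
      using mult_left_mono[OF less_imp_le[OF ce], of \<eta>] eta by (simp add: \<kappa>_def field_simps)
    ultimately have "?c * (?P - 2 * \<eta>) \<le> (\<Sum>s\<in>?K. ?e s)" by (simp add: algebra_simps)
    then have "?P - 2 * \<eta> \<le> (\<Sum>s\<in>?K. ?e s) / ?c" using c0 by (simp add: field_simps)
    then show ?case by (rule ennreal_leI)
  qed
  from le_Limsup_frequently[OF this] show ?thesis by (simp only: err_given_fading_def \<kappa>_def)
qed

section \<open>The joint law of fading and noise, and the converse averaged over the fading\<close>

definition jointM :: "nat \<Rightarrow> real \<Rightarrow> ((nat \<Rightarrow> complex) \<times> (nat \<Rightarrow> complex)) measure" where
  "jointM N s2 = cgaussvec N 1 \<Otimes>\<^sub>M cgaussvec N s2"

definition infocdf :: "nat \<Rightarrow> real \<Rightarrow> real \<Rightarrow> real" where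
  "infocdf N s2 t = measure (jointM N s2) {x \<in> space (jointM N s2). infod N s2 (fst x) (snd x) \<le> t}"

lemma sets_jointM [measurable_cong]: "sets (jointM N s2) = sets (cvec N \<Otimes>\<^sub>M cvec N)"
  unfolding jointM_def by (intro sets_pair_measure_cong sets_cgaussvec)

theorem avg_err_prob_ge:
  assumes s2: "0 < s2" and N: "0 < n * L" and S: "is_IC (n * L) S"
    and gam: "IC_density (n * L) S = ereal \<gamma>" "0 < \<gamma>" and eta: "0 < \<eta>"
  shows "ennreal (infocdf (n * L) s2 (ln (\<gamma> * \<eta> / 4)) - 2 * \<eta>) \<le> avg_err_prob n L s2 S"
proof -
  let ?N = "n * L" let ?t = "ln (\<gamma> * \<eta> / 4)"
  let ?H = "cgaussvec ?N 1" let ?G = "cgaussvec ?N s2"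
  interpret H: prob_space ?H by (rule prob_space_cgaussvec) simp
  interpret G: prob_space ?G by (rule prob_space_cgaussvec[OF s2])
  interpret J: pair_prob_space ?H ?G ..
  have [measurable_cong]: "sets ?H = sets (cvec ?N)" "sets ?G = sets (cvec ?N)" by (rule sets_cgaussvec)+
  let ?p = "\<lambda>h. measure ?G {z \<in> space ?G. infod ?N s2 h z \<le> ?t}"
  have [measurable]: "?p \<in> borel_measurable ?H" by measurable
  have X: "{x \<in> space (?H \<Otimes>\<^sub>M ?G). infod ?N s2 (fst x) (snd x) \<le> ?t} \<in> sets (?H \<Otimes>\<^sub>M ?G)" by measurable
  have "ennreal (infocdf ?N s2 ?t) = emeasure (?H \<Otimes>\<^sub>M ?G) {x \<in> space (?H \<Otimes>\<^sub>M ?G). infod ?N s2 (fst x) (snd x) \<le> ?t}"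
    by (simp add: infocdf_def jointM_def J.emeasure_eq_measure)
  also have "\<dots> = (\<integral>\<^sup>+h. emeasure ?G {z \<in> space ?G. infod ?N s2 h z \<le> ?t} \<partial>?H)"
    by (subst G.emeasure_pair_measure_alt[OF X]) (auto intro!: nn_integral_cong arg_cong2[where f = emeasure] simp: space_pair_measure)
  also have "\<dots> = (\<integral>\<^sup>+h. ennreal (?p h) \<partial>?H)" by (simp add: G.emeasure_eq_measure)
  \<comment> \<open>\<open>ennreal\<close> sends a negative \<open>?p h - 2 * \<eta>\<close> to 0,
    so the difference is not integrated directly; \<open>2 * \<eta>\<close> is added on the right
    and subtracted again after integration.\<close>
  also have "\<dots> \<le> (\<integral>\<^sup>+h. ennreal (?p h - 2 * \<eta>) + ennreal (2 * \<eta>) \<partial>?H)"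
  proof (rule nn_integral_mono)
    fix h :: "nat \<Rightarrow> complex"
    show "ennreal (?p h) \<le> ennreal (?p h - 2 * \<eta>) + ennreal (2 * \<eta>)"
      using eta by (cases "2 * \<eta> \<le> ?p h") (auto simp: ennreal_plus[symmetric] ennreal_neg intro!: ennreal_leI simp del: ennreal_plus)
  qed
  also have "\<dots> = (\<integral>\<^sup>+h. ennreal (?p h - 2 * \<eta>) \<partial>?H) + ennreal (2 * \<eta>)"
    by (subst nn_integral_add) (auto simp: H.emeasure_space_1)
  finally have "ennreal (infocdf ?N s2 ?t) \<le> (\<integral>\<^sup>+h. ennreal (?p h - 2 * \<eta>) \<partial>?H) + ennreal (2 * \<eta>)" .
  then have "ennreal (infocdf ?N s2 ?t - 2 * \<eta>) \<le> (\<integral>\<^sup>+h. ennreal (?p h - 2 * \<eta>) \<partial>?H)"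
    using eta by (subst ennreal_minus[symmetric]) (auto simp: ennreal_minus_le_iff add.commute)
  also have "\<dots> \<le> (\<integral>\<^sup>+h. err_given_fading ?N s2 S h \<partial>?H)"
  proof (rule nn_integral_mono_AE)
    show "AE h in ?H. ennreal (?p h - 2 * \<eta>) \<le> err_given_fading ?N s2 S h"
      using AE_cgaussvec_nonzero[of 1 ?N, OF zero_less_one]
      by (rule eventually_mono) (rule err_given_fading_ge[OF s2 N _ S gam eta])
  qed
  finally show ?thesis by (simp add: avg_err_prob_def)
qed

section \<open>Confusion probabilities and greedy choice of points\<close>

definition closer :: "nat \<Rightarrow> (nat \<Rightarrow> complex) \<Rightarrow> (nat \<Rightarrow> complex) \<Rightarrow> (nat \<Rightarrow> complex) \<Rightarrow> (nat \<Rightarrow> complex) \<Rightarrow> bool" where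
  "closer N h z p q \<longleftrightarrow> sqdist N (\<lambda>k. fade h p k + z k) (fade h q) < sqdist N (\<lambda>k. fade h p k + z k) (fade h p)"

text \<open>Only \<open>p - q\<close> matters, so the event is unchanged when both points are moved
  by the same vector; the periodic extension relies on this.\<close>

lemma closer_iff: "closer N h z p q \<longleftrightarrow> (\<Sum>k<N. (cmod (h k * (p k - q k) + z k))\<^sup>2) < (\<Sum>k<N. (cmod (z k))\<^sup>2)"
proof -
  have "fade h p k + z k - fade h q k = h k * (p k - q k) + z k" for k by (simp add: fade_def algebra_simps)
  then show ?thesis by (simp only: closer_def sqdist_def add_diff_cancel_left')
qed

lemma nn_integral_vdens_affine:
  assumes s2: "0 < s2" and h: "\<forall>k<N. h k \<noteq> 0"
  shows "(\<integral>\<^sup>+u. ennreal (vdens N s2 (\<lambda>k. h k * u k + c k)) \<partial>cvec N) = ennreal (1 / hdet N h)"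
proof -
  interpret L: product_sigma_finite "\<lambda>_::nat. lborel :: complex measure" by standard
  have one: "(\<integral>\<^sup>+u. ennreal (cdens s2 (h k * u + c k)) \<partial>lborel) = ennreal (1 / (cmod (h k))\<^sup>2)" if k: "k < N" for k
  proof -
    have hk: "h k \<noteq> 0" using h k by simp
    have "ennreal ((cmod (h k))\<^sup>2) * (\<integral>\<^sup>+u. ennreal (cdens s2 (h k * u + c k)) \<partial>lborel) = 1"
      using nn_integral_complex_affine[of "\<lambda>z. ennreal (cdens s2 z)" "h k" "c k"] hk by (simp add: nn_integral_cdens[OF s2])
    then have "ennreal (1 / (cmod (h k))\<^sup>2) * (ennreal ((cmod (h k))\<^sup>2) * (\<integral>\<^sup>+u. ennreal (cdens s2 (h k * u + c k)) \<partial>lborel)) = ennreal (1 / (cmod (h k))\<^sup>2)"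
      by simp
    then show ?thesis using hk by (simp add: mult.assoc[symmetric] ennreal_mult'[symmetric])
  qed
  have "(\<integral>\<^sup>+u. ennreal (vdens N s2 (\<lambda>k. h k * u k + c k)) \<partial>cvec N) = (\<integral>\<^sup>+u. (\<Prod>k<N. ennreal (cdens s2 (h k * u k + c k))) \<partial>cvec N)"
    using s2 by (simp add: vdens_def prod_ennreal cdens_pos less_imp_le)
  also have "\<dots> = (\<Prod>k<N. \<integral>\<^sup>+u. ennreal (cdens s2 (h k * u + c k)) \<partial>lborel)"
    by (rule L.product_nn_integral_prod) auto
  also have "\<dots> = (\<Prod>k<N. ennreal (1 / (cmod (h k))\<^sup>2))" by (intro prod.cong) (auto simp: one)
  also have "\<dots> = ennreal (1 / hdet N h)" by (simp add: prod_ennreal hdet_def prod_dividef)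
  finally show ?thesis .
qed

lemma vdens_mono:
  assumes "0 < s2" "(\<Sum>k<N. (cmod (x k))\<^sup>2) \<le> (\<Sum>k<N. (cmod (y k))\<^sup>2)"
  shows "vdens N s2 y \<le> vdens N s2 x"
proof -
  have e: "vdens N s2 x = exp (- (\<Sum>k<N. (cmod (x k))\<^sup>2) / s2) / (pi * s2) ^ N" for x
    unfolding vdens_def cdens_def by (simp add: prod_dividef exp_sum[symmetric] sum_negf sum_divide_distrib)
  show ?thesis unfolding e using assms by (intro divide_right_mono) (auto intro!: divide_right_mono)
qed

text \<open>Markov's inequality: where \<open>a u + c\<close> is shorter than \<open>z\<close>, its density is at least that of \<open>z\<close>.\<close>

lemma nn_integral_confusion_le:
  assumes s2: "0 < s2" and h: "\<forall>k<N. h k \<noteq> 0" and t: "t \<le> infod N s2 h z"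
    and a: "\<forall>k<N. a k \<noteq> 0" "hdet N a = hdet N h"
    and A: "\<And>u. u \<in> A \<Longrightarrow> (\<Sum>k<N. (cmod (a k * u k + c k))\<^sup>2) < (\<Sum>k<N. (cmod (z k))\<^sup>2)"
  shows "(\<integral>\<^sup>+u. indicator A u \<partial>cvec N) \<le> ennreal (exp (- t))"
proof -
  have vz: "0 < vdens N s2 z" by (rule vdens_pos[OF s2])
  have "(\<integral>\<^sup>+u. indicator A u \<partial>cvec N) \<le> (\<integral>\<^sup>+u. ennreal (1 / vdens N s2 z) * ennreal (vdens N s2 (\<lambda>k. a k * u k + c k)) \<partial>cvec N)"
  proof (rule nn_integral_mono)
    fix u
    show "indicator A u \<le> ennreal (1 / vdens N s2 z) * ennreal (vdens N s2 (\<lambda>k. a k * u k + c k))"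
    proof (cases "u \<in> A")
      case True
      then have "vdens N s2 z \<le> vdens N s2 (\<lambda>k. a k * u k + c k)" using A[of u] by (intro vdens_mono s2) auto
      then have "1 \<le> 1 / vdens N s2 z * vdens N s2 (\<lambda>k. a k * u k + c k)" using vz by simp
      then show ?thesis using True vz by (simp add: ennreal_mult'[symmetric] del: times_divide_eq_left)
    qed simp
  qed
  also have "\<dots> = ennreal (1 / vdens N s2 z) * ennreal (1 / hdet N a)"
    unfolding nn_integral_vdens_affine[OF s2 a(1), symmetric, of c] by (rule nn_integral_cmult) (unfold vdens_def, measurable)
  also have "\<dots> = ennreal (exp (- infod N s2 h z))"
    using vz by (simp add: exp_minus exp_infod[OF s2 h] a(2) ennreal_mult'[symmetric] divide_inverse)
  also have "\<dots> \<le> ennreal (exp (- t))" using t by (intro ennreal_leI) simp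
  finally show ?thesis .
qed

text \<open>The condition \<open>t \<le> infod\<close> is built in because it is what limits the
  volume of confusable points to \<open>exp (- t)\<close>; its complement is paid for separately
  through \<open>infocdf\<close>.\<close>

definition conf :: "nat \<Rightarrow> real \<Rightarrow> real \<Rightarrow> (nat \<Rightarrow> complex) \<Rightarrow> (nat \<Rightarrow> complex) \<Rightarrow> ennreal" where
  "conf N s2 t p q = emeasure (jointM N s2) {x \<in> space (jointM N s2). t \<le> infod N s2 (fst x) (snd x) \<and> closer N (fst x) (snd x) p q}"

lemma prob_space_jointM: "0 < s2 \<Longrightarrow> prob_space (jointM N s2)"
  unfolding jointM_def by (intro pair_prob_space.axioms(1) prob_space_pair prob_space_cgaussvec) auto

lemma AE_jointM_nonzero:
  assumes "0 < s2" shows "AE x in jointM N s2. \<forall>k<N. fst x k \<noteq> 0"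
proof -
  let ?H = "cgaussvec N 1" let ?G = "cgaussvec N s2"
  interpret H: prob_space ?H by (rule prob_space_cgaussvec) simp
  interpret G: prob_space ?G by (rule prob_space_cgaussvec[OF assms])
  obtain Z where Z: "Z \<in> null_sets ?H" "{h \<in> space ?H. \<not> (\<forall>k<N. h k \<noteq> 0)} \<subseteq> Z"
    using AE_cgaussvec_nonzero[of 1 N] by (auto simp: eventually_ae_filter)
  have "Z \<times> space ?G \<in> null_sets (?H \<Otimes>\<^sub>M ?G)" by (rule G.times_in_null_sets1[OF Z(1)]) simp
  then show ?thesis unfolding jointM_def
    by (rule AE_I') (auto simp: space_pair_measure intro!: subsetD[OF Z(2)])
qed

lemma measurable_coord:
  assumes "f \<in> M \<rightarrow>\<^sub>M cvec N" "k \<in> {..<N}" shows "(\<lambda>x. f x k) \<in> borel_measurable M"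
  using measurable_compose[OF assms(1) measurable_component_singleton[OF assms(2)]] by simp

lemma measurable_closer:
  assumes "f \<in> M \<rightarrow>\<^sub>M cvec N" "g \<in> M \<rightarrow>\<^sub>M cvec N" "p \<in> M \<rightarrow>\<^sub>M cvec N" "q \<in> M \<rightarrow>\<^sub>M cvec N"
  shows "Measurable.pred M (\<lambda>x. closer N (f x) (g x) (p x) (q x))"
proof -
  note [measurable] = assms[THEN measurable_coord]
  show ?thesis unfolding closer_iff by measurable
qed

text \<open>By Fubini, the integral over the variable point is a mean over fading and noise of the
  volume of confusable points, almost surely at most \<open>exp (- t)\<close>. Both orders of the
  arguments occur, since a new point can be mistaken for an old one and the reverse.\<close>

lemma nn_integral_conf_le:
  assumes s2: "0 < s2" and p: "p \<in> space (cvec N)"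
  shows "(\<lambda>q. conf N s2 t p q) \<in> borel_measurable (cvec N)" (is ?m1)
    and "(\<lambda>q. conf N s2 t q p) \<in> borel_measurable (cvec N)" (is ?m2)
    and "(\<integral>\<^sup>+q. conf N s2 t p q \<partial>cvec N) \<le> ennreal (exp (- t))" (is ?i1)
    and "(\<integral>\<^sup>+q. conf N s2 t q p \<partial>cvec N) \<le> ennreal (exp (- t))" (is ?i2)
proof -
  interpret J: prob_space "jointM N s2" by (rule prob_space_jointM[OF s2])
  interpret L: product_sigma_finite "\<lambda>_::nat. lborel :: complex measure" by standard
  interpret L: sigma_finite_measure "cvec N" by (rule L.sigma_finite) simp
  interpret LJ: pair_sigma_finite "cvec N" "jointM N s2" ..
  have gen: "(\<lambda>q. emeasure (jointM N s2) {x \<in> space (jointM N s2). t \<le> infod N s2 (fst x) (snd x) \<and> R q x}) \<in> borel_measurable (cvec N)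
     \<and> (\<integral>\<^sup>+q. emeasure (jointM N s2) {x \<in> space (jointM N s2). t \<le> infod N s2 (fst x) (snd x) \<and> R q x} \<partial>cvec N) \<le> ennreal (exp (- t))"
    if R [measurable]: "Measurable.pred (cvec N \<Otimes>\<^sub>M jointM N s2) (\<lambda>(q, x). R q x)"
      and le: "\<And>x. \<forall>k<N. fst x k \<noteq> 0 \<Longrightarrow> t \<le> infod N s2 (fst x) (snd x) \<Longrightarrow> (\<integral>\<^sup>+q. indicator {q. R q x} q \<partial>cvec N) \<le> ennreal (exp (- t))" for R
  proof
    let ?X = "{y \<in> space (cvec N \<Otimes>\<^sub>M jointM N s2). t \<le> infod N s2 (fst (snd y)) (snd (snd y)) \<and> R (fst y) (snd y)}"
    have R' [measurable]: "Measurable.pred (cvec N \<Otimes>\<^sub>M jointM N s2) (\<lambda>y. R (fst y) (snd y))" using R by (simp add: split_beta')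
    have i [measurable]: "(\<lambda>y. infod N s2 (fst (snd y)) (snd (snd y))) \<in> borel_measurable (cvec N \<Otimes>\<^sub>M jointM N s2)"
      by (rule measurable_compose[OF _ measurable_infod(1)]) measurable
    have X [measurable]: "?X \<in> sets (cvec N \<Otimes>\<^sub>M jointM N s2)" by measurable
    have e: "emeasure (jointM N s2) {x \<in> space (jointM N s2). t \<le> infod N s2 (fst x) (snd x) \<and> R q x} = emeasure (jointM N s2) (Pair q -` ?X)"
      if "q \<in> space (cvec N)" for q
      using that by (intro arg_cong2[where f = emeasure]) (auto simp: space_pair_measure)
    show "(\<lambda>q. emeasure (jointM N s2) {x \<in> space (jointM N s2). t \<le> infod N s2 (fst x) (snd x) \<and> R q x}) \<in> borel_measurable (cvec N)"
      using J.measurable_emeasure_Pair[OF X] by (subst measurable_cong[OF e])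
    have "(\<integral>\<^sup>+q. emeasure (jointM N s2) {x \<in> space (jointM N s2). t \<le> infod N s2 (fst x) (snd x) \<and> R q x} \<partial>cvec N) = emeasure (cvec N \<Otimes>\<^sub>M jointM N s2) ?X"
      unfolding J.emeasure_pair_measure_alt[OF X] by (intro nn_integral_cong e)
    also have "\<dots> = (\<integral>\<^sup>+y. indicator ?X y \<partial>(cvec N \<Otimes>\<^sub>M jointM N s2))" by (rule nn_integral_indicator[symmetric]) (rule X)
    also have "\<dots> = (\<integral>\<^sup>+x. \<integral>\<^sup>+q. indicator ?X (q, x) \<partial>cvec N \<partial>jointM N s2)"
      using X by (intro LJ.nn_integral_snd[symmetric] borel_measurable_indicator)
    also have "\<dots> \<le> (\<integral>\<^sup>+x. ennreal (exp (- t)) \<partial>jointM N s2)"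
    proof (rule nn_integral_mono_AE)
      show "AE x in jointM N s2. (\<integral>\<^sup>+q. indicator ?X (q, x) \<partial>cvec N) \<le> ennreal (exp (- t))"
        using AE_jointM_nonzero[OF s2]
      proof (rule eventually_mono)
        fix x :: "(nat \<Rightarrow> complex) \<times> (nat \<Rightarrow> complex)" assume x: "\<forall>k<N. fst x k \<noteq> 0"
        show "(\<integral>\<^sup>+q. indicator ?X (q, x) \<partial>cvec N) \<le> ennreal (exp (- t))"
        proof (cases "t \<le> infod N s2 (fst x) (snd x)")
          case True
          have "(\<integral>\<^sup>+q. indicator ?X (q, x) \<partial>cvec N) \<le> (\<integral>\<^sup>+q. indicator {q. R q x} q \<partial>cvec N)"
            by (intro nn_integral_mono) (auto simp: indicator_def)
          then show ?thesis using le[OF x True] by simp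
        next
          case False
          then have "(\<integral>\<^sup>+q. indicator ?X (q, x) \<partial>cvec N) = (\<integral>\<^sup>+q. 0 \<partial>cvec N)" by (intro nn_integral_cong) (auto simp: indicator_def)
          then show ?thesis by simp
        qed
      qed
    qed
    also have "\<dots> = ennreal (exp (- t))" by (simp add: J.emeasure_space_1)
    finally show "(\<integral>\<^sup>+q. emeasure (jointM N s2) {x \<in> space (jointM N s2). t \<le> infod N s2 (fst x) (snd x) \<and> R q x} \<partial>cvec N) \<le> ennreal (exp (- t))" .
  qed
  have "Measurable.pred (cvec N \<Otimes>\<^sub>M jointM N s2) (\<lambda>(q, x). closer N (fst x) (snd x) p q)"
    unfolding split_beta' using p by (intro measurable_closer) measurable
  moreover have "(\<integral>\<^sup>+q. indicator {q. closer N (fst x) (snd x) p q} q \<partial>cvec N) \<le> ennreal (exp (- t))"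
    if "\<forall>k<N. fst x k \<noteq> 0" "t \<le> infod N s2 (fst x) (snd x)" for x
    \<comment> \<open>The variable point is here the one that \<open>p\<close> is mistaken for, so
      it enters with coefficient \<open>- h\<close>. Its squared moduli are those of
      \<open>h\<close>; this case is the reason why the coefficients are kept separate from
      \<open>h\<close> in the volume bound.\<close>
    by (rule nn_integral_confusion_le[OF s2 that, of "\<lambda>k. - fst x k" _ "\<lambda>k. fst x k * p k + snd x k"])
       (use that in \<open>auto simp: hdet_def closer_iff algebra_simps\<close>)
  ultimately show ?m1 ?i1 unfolding conf_def by (auto dest: gen)
  have "Measurable.pred (cvec N \<Otimes>\<^sub>M jointM N s2) (\<lambda>(q, x). closer N (fst x) (snd x) q p)"
    unfolding split_beta' using p by (intro measurable_closer) measurable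
  moreover have "(\<integral>\<^sup>+q. indicator {q. closer N (fst x) (snd x) q p} q \<partial>cvec N) \<le> ennreal (exp (- t))"
    if "\<forall>k<N. fst x k \<noteq> 0" "t \<le> infod N s2 (fst x) (snd x)" for x
    by (rule nn_integral_confusion_le[OF s2 that, of "\<lambda>k. fst x k" _ "\<lambda>k. snd x k - fst x k * p k"])
       (use that in \<open>auto simp: hdet_def closer_iff algebra_simps\<close>)
  ultimately show ?m2 ?i2 unfolding conf_def by (auto dest: gen)
qed

text \<open>A new point adds its weights to and from the \<open>n\<close> chosen ones. Their mean
  over \<open>B\<close> is at most \<open>2 * n * \<alpha>\<close>, so some \<open>q\<close> adds at
  most \<open>\<alpha> * (2 * n + 1)\<close>, and \<open>n^2 + (2 * n + 1) = (n + 1)^2\<close>.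
  Points being null sets, \<open>q\<close> can be taken outside \<open>P\<close>.\<close>

lemma greedy_points:
  fixes w :: "'a \<Rightarrow> 'a \<Rightarrow> ennreal"
  assumes V: "emeasure B (space B) = ennreal V" "0 < V" and al: "0 < \<alpha>"
    and m: "\<And>p. p \<in> space B \<Longrightarrow> (\<lambda>q. w p q) \<in> borel_measurable B" "\<And>p. p \<in> space B \<Longrightarrow> (\<lambda>q. w q p) \<in> borel_measurable B"
    and i: "\<And>p. p \<in> space B \<Longrightarrow> (\<integral>\<^sup>+q. w p q \<partial>B) \<le> ennreal (\<alpha> * V)" "\<And>p. p \<in> space B \<Longrightarrow> (\<integral>\<^sup>+q. w q p \<partial>B) \<le> ennreal (\<alpha> * V)"
    and null: "\<And>p. p \<in> space B \<Longrightarrow> {p} \<in> null_sets B"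
  shows "\<exists>P. finite P \<and> card P = n \<and> P \<subseteq> space B \<and> (\<Sum>p\<in>P. \<Sum>q\<in>P - {p}. w p q) \<le> ennreal (\<alpha> * (real n)\<^sup>2)"
proof (induction n)
  case 0
  show ?case by (intro exI[of _ "{}"]) simp
next
  case (Suc n)
  then obtain P where P: "finite P" "card P = n" "P \<subseteq> space B" "(\<Sum>p\<in>P. \<Sum>q\<in>P - {p}. w p q) \<le> ennreal (\<alpha> * (real n)\<^sup>2)" by blast
  let ?f = "\<lambda>q. \<Sum>p\<in>P. w p q + w q p"
  \<comment> \<open>The \<open>+ 1\<close> makes the averaging argument strict: with
    \<open>2 * n\<close> alone the comparison of integrals would not be contradictory.\<close>
  have "\<exists>q\<in>space B - P. ?f q \<le> ennreal (\<alpha> * (2 * real n + 1))"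
  proof (rule ccontr)
    assume "\<not> ?thesis"
    then have gt: "ennreal (\<alpha> * (2 * real n + 1)) \<le> ?f q" if "q \<in> space B - P" for q using that by (metis linear)
    have "(\<Union>p\<in>P. {p}) \<in> null_sets B" using P by (intro null_sets.finite_UN null) auto
    then have "AE q in B. q \<notin> P" by (intro AE_not_in) simp
    then have ae: "AE q in B. ennreal (\<alpha> * (2 * real n + 1)) \<le> ?f q" using gt by (auto elim!: AE_mp)
    have "ennreal (\<alpha> * (2 * real n + 1) * V) = (\<integral>\<^sup>+q. ennreal (\<alpha> * (2 * real n + 1)) \<partial>B)"
      using V al by (simp add: ennreal_mult)
    also have "\<dots> \<le> (\<integral>\<^sup>+q. ?f q \<partial>B)" by (rule nn_integral_mono_AE[OF ae])
    also have "\<dots> = (\<Sum>p\<in>P. (\<integral>\<^sup>+q. w p q \<partial>B) + (\<integral>\<^sup>+q. w q p \<partial>B))"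
      using P m by (subst nn_integral_sum) (auto intro!: sum.cong nn_integral_add)
    also have "\<dots> \<le> (\<Sum>p\<in>P. ennreal (\<alpha> * V) + ennreal (\<alpha> * V))"
      using P i by (intro sum_mono add_mono) auto
    also have "\<dots> = ennreal (\<alpha> * (2 * real n) * V)"
      using V al P(2) by (simp add: ennreal_plus[symmetric] ennreal_of_nat_eq_real_of_nat ennreal_mult'[symmetric] mult_ac del: ennreal_plus)
    finally show False using V al by (simp add: ennreal_le_iff)
  qed
  then obtain q where q: "q \<in> space B" "q \<notin> P" "?f q \<le> ennreal (\<alpha> * (2 * real n + 1))" by auto
  have "(\<Sum>p\<in>insert q P. \<Sum>r\<in>insert q P - {p}. w p r) = (\<Sum>r\<in>P. w q r) + (\<Sum>p\<in>P. w p q + (\<Sum>r\<in>P - {p}. w p r))"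
  proof -
    have "insert q P - {p} = insert q (P - {p})" if "p \<in> P" for p using that q by auto
    then show ?thesis using P q by (simp add: insert_Diff_if)
  qed
  also have "\<dots> = ?f q + (\<Sum>p\<in>P. \<Sum>r\<in>P - {p}. w p r)" by (simp add: sum.distrib ac_simps)
  also have "\<dots> \<le> ennreal (\<alpha> * (2 * real n + 1)) + ennreal (\<alpha> * (real n)\<^sup>2)" by (intro add_mono q P)
  also have "\<dots> = ennreal (\<alpha> * (real (Suc n))\<^sup>2)"
    using al by (subst ennreal_plus[symmetric]) (auto simp: power2_eq_square algebra_simps)
  finally show ?case using P q by (intro exI[of _ "insert q P"]) auto
qed

text \<open>The event that the noise may bridge a gap \<open>g\<close> in some faded coordinate; the
  4 is explained by \<open>guard_badI\<close>.\<close>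

definition guard_bad :: "nat \<Rightarrow> real \<Rightarrow> (nat \<Rightarrow> complex) \<Rightarrow> (nat \<Rightarrow> complex) \<Rightarrow> bool" where
  "guard_bad N g h z \<longleftrightarrow> (\<exists>k\<in>{..<N}. (cmod (h k))\<^sup>2 * g\<^sup>2 < 4 * (\<Sum>j<N. (cmod (z j))\<^sup>2))"

lemma measurable_guard_bad [measurable]:
  "Measurable.pred (cvec N \<Otimes>\<^sub>M cvec N) (\<lambda>x. guard_bad N g (fst x) (snd x))"
  "Measurable.pred (cvec N) (guard_bad N g h)"
  unfolding guard_bad_def[abs_def] by measurable

text \<open>As \<open>g\<close> runs through the natural numbers, the events decrease to one inside
  the null set where some fading coefficient vanishes. Hence \<open>g\<close> can be fixed before
  the size of the box is chosen.\<close>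

lemma guard_prob_small:
  assumes s2: "0 < s2" and e: "0 < \<beta>"
  shows "\<exists>g>0. measure (jointM N s2) {x \<in> space (jointM N s2). guard_bad N g (fst x) (snd x)} \<le> \<beta>"
proof -
  let ?J = "jointM N s2"
  interpret J: prob_space ?J by (rule prob_space_jointM[OF s2])
  let ?A = "\<lambda>n::nat. {x \<in> space ?J. guard_bad N (real n) (fst x) (snd x)}"
  have A [measurable]: "?A n \<in> sets ?J" for n by measurable
  have "(\<lambda>n. measure ?J (?A n)) \<longlonglongrightarrow> measure ?J (\<Inter>n. ?A n)"
  proof (rule J.finite_Lim_measure_decseq)
    show "decseq ?A"
      unfolding decseq_def
    proof (intro allI impI subsetI)
      fix m n x assume mn: "m \<le> n" and x: "x \<in> ?A n"
      have "(cmod (fst x k))\<^sup>2 * (real m)\<^sup>2 \<le> (cmod (fst x k))\<^sup>2 * (real n)\<^sup>2" for k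
        using mn by (intro mult_left_mono power_mono) auto
      then show "x \<in> ?A m" using x unfolding guard_bad_def by (blast intro: le_less_trans)
    qed
  qed (use A in auto)
  moreover have "measure ?J (\<Inter>n. ?A n) = 0"
  proof -
    have "AE x in ?J. x \<notin> (\<Inter>n. ?A n)"
      using AE_jointM_nonzero[OF s2]
    proof (rule eventually_mono)
      fix x :: "(nat \<Rightarrow> complex) \<times> (nat \<Rightarrow> complex)" assume x: "\<forall>k<N. fst x k \<noteq> 0"
      show "x \<notin> (\<Inter>n. ?A n)"
      proof
        assume "x \<in> (\<Inter>n. ?A n)"
        then have gb: "\<forall>n. guard_bad N (real n) (fst x) (snd x)" by auto
        define Z where "Z = 4 * (\<Sum>j<N. (cmod (snd x j))\<^sup>2)"
        define b where "b = (\<Sum>k<N. Z / (cmod (fst x k))\<^sup>2)"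
        have Z: "0 \<le> Z" by (simp add: Z_def sum_nonneg)
        \<comment> \<open>The 1 ensures \<open>real n \<le> (real n)^2\<close>, so that
          \<open>(real n)^2\<close> dominates \<open>b\<close> as well.\<close>
        obtain n :: nat where n: "max b 1 \<le> real n" using real_arch_simple by blast
        have "guard_bad N (real n) (fst x) (snd x)" using gb by blast
        then obtain k where k: "k < N" "(cmod (fst x k))\<^sup>2 * (real n)\<^sup>2 < Z" by (auto simp: guard_bad_def Z_def)
        have "Z / (cmod (fst x k))\<^sup>2 \<le> b" unfolding b_def by (rule member_le_sum) (use k Z in auto)
        also have "\<dots> \<le> (real n)\<^sup>2" using n by (smt (verit) max.bounded_iff self_le_power zero_less_numeral)
        finally show False using k x by (simp add: field_simps)
      qed
    qed
    then have "measure ?J (\<Inter>n. ?A n) = measure ?J {}" by (intro measure_eq_AE) auto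
    then show ?thesis by simp
  qed
  ultimately have "(\<lambda>n. measure ?J (?A n)) \<longlonglongrightarrow> 0" by simp
  then have "\<forall>\<^sub>F n in sequentially. measure ?J (?A n) < \<beta>" using e by (rule order_tendstoD)
  then have "\<forall>\<^sub>F n in sequentially. measure ?J (?A n) < \<beta> \<and> 0 < n"
    using eventually_gt_at_top[of "0::nat"] by eventually_elim auto
  then obtain n where "measure ?J (?A n) < \<beta>" "0 < n" by (auto simp: eventually_sequentially)
  then show ?thesis by (intro exI[of _ "real n"]) auto
qed

section \<open>Periodic constellations\<close>

definition window_shifts :: "real \<Rightarrow> real \<Rightarrow> real \<Rightarrow> int set" where
  "window_shifts c a x = {m. \<bar>x + c * of_int m\<bar> < a / 2}"

lemma window_shifts:
  assumes c: "0 < c" and a: "c \<le> a"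
  shows "finite (window_shifts c a x)" "a / c - 1 \<le> real (card (window_shifts c a x))"
    "real (card (window_shifts c a x)) \<le> a / c + 1"
proof -
  define l u where "l = (- a / 2 - x) / c" and "u = (a / 2 - x) / c"
  have ul: "u - l = a / c" using c by (simp add: l_def u_def field_simps)
  have "\<bar>x + c * of_int m\<bar> < a / 2 \<longleftrightarrow> l < of_int m \<and> of_int m < u" for m :: int
    unfolding l_def u_def abs_less_iff pos_less_divide_eq[OF c] pos_divide_less_eq[OF c] mult.commute[of _ c] by arith
  then have "window_shifts c a x = {m. l < of_int m \<and> of_int m < u}" by (simp add: window_shifts_def)
  also have "\<dots> = {\<lfloor>l\<rfloor><..<\<lceil>u\<rceil>}" by (auto simp: floor_less_iff less_ceiling_iff)
  finally have e: "window_shifts c a x = {\<lfloor>l\<rfloor><..<\<lceil>u\<rceil>}" .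
  show "finite (window_shifts c a x)" by (simp add: e)
  \<comment> \<open>With \<open>c \<le> a\<close> the interval is non-degenerate and the floor of
    \<open>l\<close> lies below the ceiling of \<open>u\<close>, so the cardinality, a truncated
    difference, agrees with the real one.\<close>
  have "1 \<le> a / c" using a c by simp
  then have "l < u" using ul by linarith
  then have "\<lfloor>l\<rfloor> < \<lceil>u\<rceil>" by (meson floor_le_ceiling floor_less_iff le_of_int_ceiling less_le_trans of_int_floor_le order_le_less_trans of_int_less_iff)
  then have "real (card (window_shifts c a x)) = of_int \<lceil>u\<rceil> - of_int \<lfloor>l\<rfloor> - 1" by (simp add: e)
  then show "a / c - 1 \<le> real (card (window_shifts c a x))" "real (card (window_shifts c a x)) \<le> a / c + 1"
    using ul by linarith+
qed

text \<open>Coordinates from \<open>N\<close> on are set to 0 as \<open>is_IC\<close> demands,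
  whereas the points of \<open>pbox\<close>, as elements of a product space, are
  \<open>undefined\<close> there.\<close>

definition shifted :: "nat \<Rightarrow> real \<Rightarrow> (nat \<Rightarrow> complex) \<Rightarrow> (nat \<Rightarrow> int \<times> int) \<Rightarrow> nat \<Rightarrow> complex" where
  "shifted N c p m = (\<lambda>k. if k < N then p k + of_real c * Complex (of_int (fst (m k))) (of_int (snd (m k))) else 0)"

definition periodic_IC :: "nat \<Rightarrow> real \<Rightarrow> (nat \<Rightarrow> complex) set \<Rightarrow> (nat \<Rightarrow> complex) set" where
  "periodic_IC N c P = (\<lambda>(p, m). shifted N c p m) ` (P \<times> PiE {..<N} (\<lambda>_. UNIV))"

definition cellidx :: "nat \<Rightarrow> real \<Rightarrow> real \<Rightarrow> (nat \<Rightarrow> complex) \<Rightarrow> (nat \<Rightarrow> int \<times> int) set" where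
  "cellidx N c a p = PiE {..<N} (\<lambda>k. window_shifts c a (Re (p k)) \<times> window_shifts c a (Im (p k)))"

definition pbox :: "nat \<Rightarrow> real \<Rightarrow> (nat \<Rightarrow> complex) set" where
  "pbox N b = PiE {..<N} (\<lambda>_. {z. \<bar>Re z\<bar> \<le> b / 2 \<and> \<bar>Im z\<bar> \<le> b / 2})"

context
  fixes N :: nat and b g :: real and P :: "(nat \<Rightarrow> complex) set"
  assumes N: "0 < N" and b: "0 < b" and g: "0 < g" and P: "finite P" "P \<noteq> {}" "P \<subseteq> pbox N b"
begin

abbreviation (input) "period \<equiv> b + g"

text \<open>In a coordinate where the shifts differ they are at least \<open>b + g\<close> apart in
  real or imaginary part, while points of the box differ by at most \<open>b\<close> in
  each.\<close>

lemma shifted_gap: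
  assumes "p \<in> P" "q \<in> P" "m \<in> PiE {..<N} (\<lambda>_. UNIV)" "m' \<in> PiE {..<N} (\<lambda>_. UNIV)" "m \<noteq> m'"
  shows "\<exists>k<N. g \<le> cmod (shifted N period p m k - shifted N period q m' k)"
proof -
  obtain k where k: "k < N" "m k \<noteq> m' k" using assms by (metis PiE_ext lessThan_iff)
  have pb: "\<bar>Re (p k)\<bar> \<le> b / 2" "\<bar>Im (p k)\<bar> \<le> b / 2" "\<bar>Re (q k)\<bar> \<le> b / 2" "\<bar>Im (q k)\<bar> \<le> b / 2"
    using assms P k by (auto simp: pbox_def)
  let ?d = "shifted N period p m k - shifted N period q m' k"
  have big: "period \<le> \<bar>period * of_int i - period * of_int j\<bar>" if "i \<noteq> j" for i j :: int
  proof -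
    have "1 \<le> \<bar>i - j\<bar>" using that by simp
    then have "real_of_int 1 \<le> real_of_int \<bar>i - j\<bar>" by (simp only: of_int_le_iff)
    then have "1 \<le> \<bar>real_of_int i - of_int j\<bar>" by simp
    then have "period * 1 \<le> period * \<bar>real_of_int i - of_int j\<bar>" using b g by (intro mult_left_mono) auto
    then show ?thesis using b g by (simp add: abs_mult right_diff_distrib[symmetric])
  qed
  have re: "Re ?d = Re (p k) - Re (q k) + (period * of_int (fst (m k)) - period * of_int (fst (m' k)))"
    and im: "Im ?d = Im (p k) - Im (q k) + (period * of_int (snd (m k)) - period * of_int (snd (m' k)))"
    using k by (simp_all add: shifted_def)
  have "g \<le> cmod ?d"
  proof (cases "fst (m k) = fst (m' k)")
    case False
    have "g \<le> \<bar>Re ?d\<bar>" using big[OF False] pb unfolding re by linarith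
    then show ?thesis using abs_Re_le_cmod order_trans by blast
  next
    case True
    then have "snd (m k) \<noteq> snd (m' k)" using k(2) by (simp add: prod_eq_iff)
    from big[OF this] have "g \<le> \<bar>Im ?d\<bar>" using pb unfolding im by linarith
    then show ?thesis using abs_Im_le_cmod order_trans by blast
  qed
  then show ?thesis using k by blast
qed

lemma shifted_same:
  "(\<forall>k<N. shifted N period p m k - shifted N period q m k = p k - q k)"
  by (simp add: shifted_def)

text \<open>The gap separates different shifts; for equal shifts the points agree on
  \<open>{..<N}\<close> and, being extensional, everywhere.\<close>

lemma inj_shifted: "inj_on (\<lambda>(p, m). shifted N period p m) (P \<times> PiE {..<N} (\<lambda>_. UNIV))"
proof (rule inj_onI, clarify)
  fix p m q m' assume pq: "p \<in> P" "q \<in> P" "m \<in> PiE {..<N} (\<lambda>_. UNIV)" "m' \<in> PiE {..<N} (\<lambda>_. UNIV)"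
    and eq: "shifted N period p m = shifted N period q m'"
  have mm: "m = m'" using shifted_gap[OF pq] g eq by (metis diff_self norm_zero not_le)
  then have "p k = q k" if "k < N" for k using shifted_same[of p m q] eq that by simp
  moreover have "p \<in> extensional {..<N}" "q \<in> extensional {..<N}" using P pq by (auto simp: pbox_def PiE_def)
  ultimately show "p = q \<and> m = m'" using mm by (auto intro!: extensionalityI[of _ "{..<N}"])
qed

lemma periodic_cube: "periodic_IC N period P \<inter> cube N a = (\<lambda>(p, m). shifted N period p m) ` (SIGMA p:P. cellidx N period a p)"
proof -
  have iff: "shifted N period p m \<in> cube N a \<longleftrightarrow> m \<in> cellidx N period a p" if "m \<in> PiE {..<N} (\<lambda>_. UNIV)" for p m
    using that by (auto simp: cube_def shifted_def cellidx_def PiE_iff window_shifts_def mem_Times_iff)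
  have sub: "cellidx N period a p \<subseteq> PiE {..<N} (\<lambda>_. UNIV)" for p by (auto simp: cellidx_def)
  show ?thesis
  proof (intro set_eqI iffI)
    fix s assume "s \<in> periodic_IC N period P \<inter> cube N a"
    then obtain p m where "p \<in> P" "m \<in> PiE {..<N} (\<lambda>_. UNIV)" "s = shifted N period p m" "shifted N period p m \<in> cube N a"
      unfolding periodic_IC_def by auto
    then show "s \<in> (\<lambda>(p, m). shifted N period p m) ` (SIGMA p:P. cellidx N period a p)" using iff by auto
  next
    fix s assume "s \<in> (\<lambda>(p, m). shifted N period p m) ` (SIGMA p:P. cellidx N period a p)"
    then obtain p m where pm: "p \<in> P" "m \<in> cellidx N period a p" "s = shifted N period p m" by auto
    then have m: "m \<in> PiE {..<N} (\<lambda>_. UNIV)" using sub by blast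
    have "s \<in> (\<lambda>(p, m). shifted N period p m) ` (P \<times> PiE {..<N} (\<lambda>_. UNIV))"
      unfolding pm(3) by (rule image_eqI[of _ _ "(p, m)"]) (use pm(1) m in \<open>simp_all only: split SigmaI\<close>)
    then have "s \<in> periodic_IC N period P" by (simp only: periodic_IC_def)
    moreover have "s \<in> cube N a" using iff[OF m] pm by simp
    ultimately show "s \<in> periodic_IC N period P \<inter> cube N a" by simp
  qed
qed

lemma sum_periodic:
  fixes f :: "_ \<Rightarrow> real"
  assumes "period \<le> a"
  shows "(\<Sum>s\<in>periodic_IC N period P \<inter> cube N a. f s) = (\<Sum>p\<in>P. \<Sum>m\<in>cellidx N period a p. f (shifted N period p m))"
proof -
  have sub: "(SIGMA p:P. cellidx N period a p) \<subseteq> P \<times> PiE {..<N} (\<lambda>_. UNIV)" by (auto simp: cellidx_def)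
  have fin: "finite (cellidx N period a p)" for p
    unfolding cellidx_def using assms b g by (intro finite_PiE finite_cartesian_product window_shifts) auto
  show ?thesis
    unfolding periodic_cube using fin P
    by (subst sum.reindex[OF inj_on_subset[OF inj_shifted sub]]) (auto simp: sum.Sigma split_beta')
qed

lemma card_cellidx:
  assumes "period \<le> a"
  shows "(a / period - 1) ^ (2 * N) \<le> real (card (cellidx N period a p))" "real (card (cellidx N period a p)) \<le> (a / period + 1) ^ (2 * N)"
proof -
  have period: "0 < period" using b g by simp
  note tc = window_shifts[OF period assms]
  have "card (cellidx N period a p) = (\<Prod>k<N. card (window_shifts period a (Re (p k))) * card (window_shifts period a (Im (p k))))"
    by (simp add: cellidx_def card_PiE card_cartesian_product)
  then have e: "real (card (cellidx N period a p)) = (\<Prod>k<N. real (card (window_shifts period a (Re (p k)))) * real (card (window_shifts period a (Im (p k)))))"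
    by simp
  have a0: "0 \<le> a / period - 1" using period assms by simp
  have "(\<Prod>k<N. (a / period - 1) * (a / period - 1)) \<le> real (card (cellidx N period a p))"
    unfolding e using tc a0 by (intro prod_mono conjI mult_mono mult_nonneg_nonneg) auto
  then show "(a / period - 1) ^ (2 * N) \<le> real (card (cellidx N period a p))" by (simp add: power_mult power2_eq_square)
  have "real (card (cellidx N period a p)) \<le> (\<Prod>k<N. (a / period + 1) * (a / period + 1))"
    unfolding e using tc a0 by (intro prod_mono conjI mult_mono mult_nonneg_nonneg) auto
  then show "real (card (cellidx N period a p)) \<le> (a / period + 1) ^ (2 * N)" by (simp add: power_mult power2_eq_square)
qed

lemma card_periodic:
  assumes "period \<le> a"
  shows "real (card P) * (a / period - 1) ^ (2 * N) \<le> real (card (periodic_IC N period P \<inter> cube N a))"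
    "real (card (periodic_IC N period P \<inter> cube N a)) \<le> real (card P) * (a / period + 1) ^ (2 * N)"
proof -
  have e: "real (card (periodic_IC N period P \<inter> cube N a)) = (\<Sum>p\<in>P. real (card (cellidx N period a p)))"
    using sum_periodic[OF assms, of "\<lambda>_. 1"] by simp
  show "real (card P) * (a / period - 1) ^ (2 * N) \<le> real (card (periodic_IC N period P \<inter> cube N a))"
    unfolding e using sum_mono[of P "\<lambda>_. (a / period - 1) ^ (2 * N)"] card_cellidx[OF assms] by simp
  show "real (card (periodic_IC N period P \<inter> cube N a)) \<le> real (card P) * (a / period + 1) ^ (2 * N)"
    unfolding e using sum_mono[of P _ "\<lambda>_. (a / period + 1) ^ (2 * N)"] card_cellidx[OF assms] by simp
qed

lemma is_IC_periodic: "is_IC N (periodic_IC N period P)"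
  unfolding is_IC_def
proof (intro conjI allI ballI impI)
  show "countable (periodic_IC N period P)"
  proof -
    have "countable (PiE {..<N} (\<lambda>_. UNIV :: (int \<times> int) set))" by (intro countable_PiE) auto
    then show ?thesis unfolding periodic_IC_def using P by (intro countable_image countable_SIGMA) (auto intro: countable_finite)
  qed
  show "x k = 0" if x: "x \<in> periodic_IC N period P" and k: "N \<le> k" for x k
  proof -
    obtain p m where "x = shifted N period p m" using x unfolding periodic_IC_def by auto
    then show ?thesis using k by (simp add: shifted_def)
  qed
  fix a :: real
  \<comment> \<open>The counting facts concern cubes of side at least one period; smaller cubes are
    contained in such a one.\<close>
  have "a / 2 \<le> max a period / 2" by simp
  then have "cube N a \<subseteq> cube N (max a period)" unfolding cube_def by (blast intro: less_le_trans)
  moreover have "finite (periodic_IC N period P \<inter> cube N (max a period))"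
    using P b g unfolding periodic_cube cellidx_def
    by (intro finite_imageI finite_SigmaI finite_PiE finite_cartesian_product window_shifts) auto
  ultimately show "finite (periodic_IC N period P \<inter> cube N a)" by (metis Int_mono finite_subset subset_refl)
qed

lemma IC_density_periodic: "IC_density N (periodic_IC N period P) = ereal (real (card P) / period ^ (2 * N))"
proof -
  have period: "0 < period" using b g by simp
  let ?M = "real (card P)"
  have 1: "((\<lambda>a. ((a / period - 1) / a) ^ (2 * N)) \<longlongrightarrow> inverse period ^ (2 * N)) at_top"
    using period by (intro tendsto_power) real_asymp
  have 2: "((\<lambda>a. ((a / period + 1) / a) ^ (2 * N)) \<longlongrightarrow> inverse period ^ (2 * N)) at_top"
    using period by (intro tendsto_power) real_asymp
  have "((\<lambda>a. real (card (periodic_IC N period P \<inter> cube N a)) / a ^ (2 * N)) \<longlongrightarrow> ?M * inverse period ^ (2 * N)) at_top"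
  proof (rule tendsto_sandwich)
    show "((\<lambda>a. ?M * ((a / period - 1) / a) ^ (2 * N)) \<longlongrightarrow> ?M * inverse period ^ (2 * N)) at_top" by (intro tendsto_mult_left 1)
    show "((\<lambda>a. ?M * ((a / period + 1) / a) ^ (2 * N)) \<longlongrightarrow> ?M * inverse period ^ (2 * N)) at_top" by (intro tendsto_mult_left 2)
    show "\<forall>\<^sub>F a in at_top. ?M * ((a / period - 1) / a) ^ (2 * N) \<le> real (card (periodic_IC N period P \<inter> cube N a)) / a ^ (2 * N)"
      using eventually_ge_at_top[of period]
    proof eventually_elim
      case (elim a)
      then show ?case using card_periodic(1)[OF elim] period by (simp add: power_divide divide_right_mono)
    qed
    show "\<forall>\<^sub>F a in at_top. real (card (periodic_IC N period P \<inter> cube N a)) / a ^ (2 * N) \<le> ?M * ((a / period + 1) / a) ^ (2 * N)"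
      using eventually_ge_at_top[of period]
    proof eventually_elim
      case (elim a)
      then show ?case using card_periodic(2)[OF elim] period by (simp add: power_divide divide_right_mono)
    qed
  qed
  then have "((\<lambda>a. ereal (real (card (periodic_IC N period P \<inter> cube N a)) / a ^ (2 * N))) \<longlongrightarrow> ereal (?M * inverse period ^ (2 * N))) at_top"
    by simp
  then show ?thesis unfolding IC_density_def by (subst lim_imp_Limsup) (auto simp: power_inverse divide_inverse)
qed

text \<open>Averages over large cubes see every translation class with the same asymptotic frequency.\<close>

lemma err_given_fading_periodic_le:
  assumes E: "\<And>p m. p \<in> P \<Longrightarrow> m \<in> PiE {..<N} (\<lambda>_. UNIV) \<Longrightarrow>
      ml_err_prob N s2 (fade h ` periodic_IC N period P) (fade h (shifted N period p m)) \<le> E p"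
  shows "err_given_fading N s2 (periodic_IC N period P) h \<le> ennreal ((\<Sum>p\<in>P. E p) / real (card P))"
proof -
  have period: "0 < period" using b g by simp
  let ?M = "real (card P)" let ?S = "periodic_IC N period P"
  let ?e = "\<lambda>s. ml_err_prob N s2 (fade h ` ?S) (fade h s)"
  have M: "0 < ?M" using P by (simp add: card_gt_0_iff)
  \<comment> \<open>Follows from the hypothesis on \<open>E\<close> at the zero shift, error
    probabilities being non-negative.\<close>
  have E0: "0 \<le> E p" if "p \<in> P" for p
  proof -
    have "(\<lambda>k\<in>{..<N}. (0, 0)) \<in> PiE {..<N} (\<lambda>_. UNIV :: (int \<times> int) set)" by auto
    from E[OF that this] show ?thesis by (rule order_trans[rotated]) (simp add: ml_err_prob_def)
  qed
  let ?B = "(\<Sum>p\<in>P. E p) / ?M"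
  \<comment> \<open>Upper over lower count of the translates of one point in the cube; it tends to
    1.\<close>
  let ?r = "\<lambda>a. ((a / period + 1) / (a / period - 1)) ^ (2 * N)"
  have "err_given_fading N s2 ?S h \<le> Limsup at_top (\<lambda>a. ennreal (?r a * ?B))"
    unfolding err_given_fading_def
  proof (rule Limsup_mono)
    show "\<forall>\<^sub>F a in at_top. ennreal ((\<Sum>s\<in>?S \<inter> cube N a. ?e s) / real (card (?S \<inter> cube N a))) \<le> ennreal (?r a * ?B)"
      using eventually_gt_at_top[of period]
    proof eventually_elim
      case (elim a)
      have ca: "period \<le> a" using elim by simp
      have lo: "0 < (a / period - 1) ^ (2 * N)" using elim period by simp
      have "(\<Sum>s\<in>?S \<inter> cube N a. ?e s) = (\<Sum>p\<in>P. \<Sum>m\<in>cellidx N period a p. ?e (shifted N period p m))" by (rule sum_periodic[OF ca])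
      also have "\<dots> \<le> (\<Sum>p\<in>P. \<Sum>m\<in>cellidx N period a p. E p)"
        by (intro sum_mono E) (auto simp: cellidx_def)
      also have "\<dots> = (\<Sum>p\<in>P. real (card (cellidx N period a p)) * E p)" by simp
      also have "\<dots> \<le> (\<Sum>p\<in>P. (a / period + 1) ^ (2 * N) * E p)"
        using card_cellidx(2)[OF ca] E0 by (intro sum_mono mult_right_mono) auto
      also have "\<dots> = (a / period + 1) ^ (2 * N) * (\<Sum>p\<in>P. E p)" by (simp add: sum_distrib_left)
      finally have s: "(\<Sum>s\<in>?S \<inter> cube N a. ?e s) \<le> (a / period + 1) ^ (2 * N) * (\<Sum>p\<in>P. E p)" .
      have "(\<Sum>s\<in>?S \<inter> cube N a. ?e s) / real (card (?S \<inter> cube N a)) \<le> ((a / period + 1) ^ (2 * N) * (\<Sum>p\<in>P. E p)) / (?M * (a / period - 1) ^ (2 * N))"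
        using s card_periodic(1)[OF ca] M lo E0 by (intro frac_le) (auto intro!: sum_nonneg mult_nonneg_nonneg)
      also have "\<dots> = ?r a * ?B" by (simp add: power_divide)
      finally show ?case by (rule ennreal_leI)
    qed
  qed
  also have "\<dots> = ennreal ?B"
  proof (rule lim_imp_Limsup)
    have "((\<lambda>a. ?r a * ?B) \<longlongrightarrow> 1 ^ (2 * N) * ?B) at_top"
      using period by (intro tendsto_mult_right tendsto_power) real_asymp
    then show "((\<lambda>a. ennreal (?r a * ?B)) \<longlongrightarrow> ennreal ?B) at_top" by (intro tendsto_ennrealI) simp
  qed simp
  finally show ?thesis .
qed

end

section \<open>The direct bound\<close>

lemma emeasure_jointM_slices:
  assumes s2: "0 < s2" and R: "Measurable.pred (cvec N \<Otimes>\<^sub>M cvec N) (\<lambda>x. R (fst x) (snd x))"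
  shows "(\<lambda>h. emeasure (cgaussvec N s2) {z \<in> space (cgaussvec N s2). R h z}) \<in> borel_measurable (cgaussvec N 1)" (is ?m)
    and "(\<integral>\<^sup>+h. emeasure (cgaussvec N s2) {z \<in> space (cgaussvec N s2). R h z} \<partial>cgaussvec N 1)
      = emeasure (jointM N s2) {x \<in> space (jointM N s2). R (fst x) (snd x)}" (is ?e)
proof -
  let ?H = "cgaussvec N 1" let ?G = "cgaussvec N s2"
  interpret H: prob_space ?H by (rule prob_space_cgaussvec) simp
  interpret G: prob_space ?G by (rule prob_space_cgaussvec[OF s2])
  let ?X = "{x \<in> space (jointM N s2). R (fst x) (snd x)}"
  have "?X \<in> sets (jointM N s2)" using R by measurable
  then have X: "?X \<in> sets (?H \<Otimes>\<^sub>M ?G)" by (simp add: jointM_def)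
  have e: "emeasure ?G {z \<in> space ?G. R h z} = emeasure ?G (Pair h -` ?X)" if "h \<in> space ?H" for h
    using that by (intro arg_cong2[where f = emeasure]) (auto simp: space_pair_measure jointM_def)
  show ?m using G.measurable_emeasure_Pair[OF X] by (subst measurable_cong[OF e])
  have "emeasure (jointM N s2) ?X = (\<integral>\<^sup>+h. emeasure ?G (Pair h -` ?X) \<partial>?H)"
    using G.emeasure_pair_measure_alt[OF X] by (simp only: jointM_def)
  also have "\<dots> = (\<integral>\<^sup>+h. emeasure ?G {z \<in> space ?G. R h z} \<partial>?H)" by (intro nn_integral_cong e[symmetric])
  finally show ?e ..
qed

text \<open>As \<open>h j * u = x j - z j\<close>, the square of \<open>|h j| * g\<close> is at most
  \<open>2 |x j|^2 + 2 |z j|^2\<close>, and this is below 4 times the squared norm of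
  \<open>z\<close> because \<open>x\<close> is shorter than \<open>z\<close>. It is applied with
  \<open>x\<close> the displacement of the received point from a wrong point.\<close>

lemma guard_badI:
  assumes j: "j < N" and g: "0 \<le> g" "g \<le> cmod u" and lt: "(\<Sum>k<N. (cmod (x k))\<^sup>2) < (\<Sum>k<N. (cmod (z k))\<^sup>2)"
    and x: "x j = h j * u + z j"
  shows "guard_bad N g h z"
proof -
  have le: "(cmod (y j))\<^sup>2 \<le> (\<Sum>k<N. (cmod (y k))\<^sup>2)" for y :: "nat \<Rightarrow> complex"
    by (rule member_le_sum) (use j in auto)
  have "cmod (h j) * g \<le> cmod (h j * u)" using g by (simp add: norm_mult mult_left_mono)
  then have "(cmod (h j) * g)\<^sup>2 \<le> (cmod (h j * u))\<^sup>2" using g by (intro power_mono) auto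
  also have "h j * u = x j - z j" using x by simp
  also have "(cmod (x j - z j))\<^sup>2 \<le> (cmod (x j) + cmod (z j))\<^sup>2" by (intro power_mono norm_triangle_ineq4) auto
  also have "\<dots> \<le> 2 * (cmod (x j))\<^sup>2 + 2 * (cmod (z j))\<^sup>2"
    using zero_le_power2[of "cmod (x j) - cmod (z j)"] by (simp add: power2_eq_square algebra_simps)
  also have "\<dots> < 4 * (\<Sum>k<N. (cmod (z k))\<^sup>2)" using le[of x] le[of z] lt by linarith
  finally show ?thesis using j by (auto simp: guard_bad_def power_mult_distrib)
qed

text \<open>A nearer point with the same shift amounts, by translation invariance, to a confusion
  inside \<open>P\<close>; one with another shift means that the noise has bridged a guard interval.
  Thus infinitely many translates are covered by one event and only the finite \<open>P\<close>
  needs a union bound. The bound is free of \<open>m\<close>, as averaging over translates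
  requires.\<close>

lemma ml_err_periodic_le:
  assumes s2: "0 < s2" and N: "0 < N" and b: "0 < b" and g: "0 < g" and P: "finite P" "P \<noteq> {}" "P \<subseteq> pbox N b"
    and p: "p \<in> P" and m: "m \<in> PiE {..<N} (\<lambda>_. UNIV)"
  defines "G \<equiv> cgaussvec N s2"
  shows "ml_err_prob N s2 (fade h ` periodic_IC N (b + g) P) (fade h (shifted N (b + g) p m))
    \<le> measure G {z \<in> space G. infod N s2 h z < t \<or> guard_bad N g h z \<or> (\<exists>q\<in>P - {p}. t \<le> infod N s2 h z \<and> closer N h z p q)}"
    (is "_ \<le> measure G ?A")
proof -
  interpret G: prob_space G unfolding G_def by (rule prob_space_cgaussvec[OF s2])
  have [measurable_cong]: "sets G = sets (cvec N)" unfolding G_def by (rule sets_cgaussvec)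
  have cl [measurable]: "Measurable.pred G (\<lambda>z. closer N h z p q)" for q
    unfolding closer_iff by measurable
  have A: "?A \<in> sets G"
  proof -
    have [measurable]: "{z \<in> space G. infod N s2 h z < t} \<in> sets G" "{z \<in> space G. guard_bad N g h z} \<in> sets G"
      "{z \<in> space G. t \<le> infod N s2 h z \<and> closer N h z p q} \<in> sets G" for q by measurable
    have "?A = {z \<in> space G. infod N s2 h z < t} \<union> {z \<in> space G. guard_bad N g h z} \<union>
        (\<Union>q\<in>P - {p}. {z \<in> space G. t \<le> infod N s2 h z \<and> closer N h z p q})" by auto
    also have "\<dots> \<in> sets G" using P(1) by (intro sets.Un sets.finite_UN) auto
    finally show ?thesis .
  qed
  let ?s = "shifted N (b + g) p m"
  have "z \<in> ?A" if z: "z \<in> space G" and q: "q \<in> fade h ` periodic_IC N (b + g) P"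
    and lt: "sqdist N (\<lambda>k. fade h ?s k + z k) q < sqdist N (\<lambda>k. fade h ?s k + z k) (fade h ?s)" for z q
  proof -
    obtain p' m' where p': "p' \<in> P" "m' \<in> PiE {..<N} (\<lambda>_. UNIV)" and q: "q = fade h (shifted N (b + g) p' m')"
      using q unfolding periodic_IC_def by auto
    let ?s' = "shifted N (b + g) p' m'"
    have cs: "closer N h z ?s ?s'" using lt unfolding q closer_def .
    show ?thesis
    proof (cases "m = m'")
      case True
      have "(\<Sum>k<N. (cmod (h k * (?s k - ?s' k) + z k))\<^sup>2) = (\<Sum>k<N. (cmod (h k * (p k - p' k) + z k))\<^sup>2)"
        using True by (intro sum.cong) (auto simp: shifted_def)
      then have c: "closer N h z p p'" using cs by (simp add: closer_iff)
      then have "p' \<noteq> p" by (auto simp: closer_iff)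
      then show ?thesis using c p' z by (cases "infod N s2 h z < t") auto
    next
      case False
      obtain j where j: "j < N" "g \<le> cmod (?s j - ?s' j)"
        using shifted_gap[OF N b g P p p'(1) m p'(2) False] by blast
      have "guard_bad N g h z"
        using cs j g unfolding closer_iff by (intro guard_badI[OF j(1) _ j(2)]) auto
      then show ?thesis using z by simp
    qed
  qed
  then show ?thesis unfolding ml_err_prob_def G_def[symmetric] by (intro G.finite_measure_mono A) blast
qed

text \<open>The guard length \<open>g\<close> is fixed first; the box is then taken so large that
  the guard intervals at most double the volume of a period and that at least one point fits. One
  \<open>\<beta>\<close> pays for the guard event, the other for confusion inside the box.\<close>

theorem exists_good_IC:
  assumes s2: "0 < s2" and N: "0 < n * L" and gam: "0 < \<gamma>" and bet: "0 < \<beta>"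
  shows "\<exists>S. is_IC (n * L) S \<and> ereal (\<gamma> / 4) \<le> IC_density (n * L) S \<and> IC_density (n * L) S < \<infinity> \<and>
    avg_err_prob n L s2 S \<le> ennreal (infocdf (n * L) s2 (ln (\<gamma> / \<beta>)) + 2 * \<beta>)"
proof -
  define N where "N = n * L"
  have N: "0 < N" using assms by (simp add: N_def)
  interpret L: product_sigma_finite "\<lambda>_::nat. lborel :: complex measure" by standard
  let ?J = "jointM N s2" let ?H = "cgaussvec N 1" let ?G = "cgaussvec N s2"
  interpret J: prob_space ?J by (rule prob_space_jointM[OF s2])
  interpret H: prob_space ?H by (rule prob_space_cgaussvec) simp
  interpret G: prob_space ?G by (rule prob_space_cgaussvec[OF s2])
  define t where "t = ln (\<gamma> / \<beta>)"
  have et: "exp (- t) = \<beta> / \<gamma>" using gam bet by (simp add: t_def exp_minus)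
  obtain g where g: "0 < g" and gp: "measure ?J {x \<in> space ?J. guard_bad N g (fst x) (snd x)} \<le> \<beta>"
    using guard_prob_small[OF s2 bet] by blast
  have "((\<lambda>b. ((b + g) / b) ^ (2 * N)) \<longlongrightarrow> 1 ^ (2 * N)) at_top"
    by (intro tendsto_power) real_asymp
  then have "\<forall>\<^sub>F b in at_top. ((b + g) / b) ^ (2 * N) < 2" by (rule order_tendstoD) simp
  moreover have "filterlim (\<lambda>b. \<gamma> * b ^ (2 * N)) at_top at_top"
    using N gam by (intro filterlim_tendsto_pos_mult_at_top[OF tendsto_const] filterlim_pow_at_top filterlim_ident) auto
  then have "\<forall>\<^sub>F b in at_top. 1 \<le> \<gamma> * b ^ (2 * N)" by (simp add: filterlim_at_top)
  ultimately have "\<forall>\<^sub>F b in at_top. ((b + g) / b) ^ (2 * N) < 2 \<and> 1 \<le> \<gamma> * b ^ (2 * N) \<and> 0 < b"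
    using eventually_gt_at_top[of "0::real"] by eventually_elim auto
  then obtain K where "\<And>b. K \<le> b \<Longrightarrow> ((b + g) / b) ^ (2 * N) < 2 \<and> 1 \<le> \<gamma> * b ^ (2 * N) \<and> 0 < b"
    unfolding eventually_at_top_linorder by blast
  then obtain b where b: "((b + g) / b) ^ (2 * N) < 2" "1 \<le> \<gamma> * b ^ (2 * N)" "0 < b"
    by blast
  define V where "V = b ^ (2 * N)"
  have V: "0 < V" using b by (simp add: V_def)
  have cV: "(b + g) ^ (2 * N) \<le> 2 * V" using b(1) V by (simp add: power_divide V_def field_simps)
  \<comment> \<open>Rounding down loses at most a factor 2, because
    \<open>\<gamma> * V \<ge> 1\<close>; the guard intervals lose another, which gives
    \<open>\<gamma> / 4\<close>.\<close>
  define M where "M = nat \<lfloor>\<gamma> * V\<rfloor>"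
  have M: "real M \<le> \<gamma> * V" "\<gamma> * V / 2 \<le> real M" "0 < M"
  proof -
    have "1 \<le> \<lfloor>\<gamma> * V\<rfloor>" using b(2) by (simp add: V_def)
    then have "real M = of_int \<lfloor>\<gamma> * V\<rfloor>" "1 \<le> real_of_int \<lfloor>\<gamma> * V\<rfloor>" by (auto simp: M_def)
    then show "real M \<le> \<gamma> * V" "\<gamma> * V / 2 \<le> real M" "0 < M" by linarith+
  qed
  have pb: "pbox N b \<in> sets (cvec N)" unfolding pbox_def by (intro sets_PiM_I_finite) auto
  have pbs: "pbox N b \<subseteq> space (cvec N)" using pb by (rule sets.sets_into_space)
  let ?B = "restrict_space (cvec N) (pbox N b)"
  have spB: "space ?B = pbox N b" using pbs by (auto simp: space_restrict_space)
  \<comment> \<open>With this value the volume bound \<open>exp (- t) = \<beta> / \<gamma>\<close>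
    equals \<open>\<alpha> * V\<close>, as the greedy choice requires. Its total weight
    \<open>\<alpha> * M^2\<close>, averaged over the \<open>M\<close> points, is
    \<open>\<alpha> * M \<le> \<beta>\<close>.\<close>
  define \<alpha> where "\<alpha> = \<beta> / (\<gamma> * V)"
  have al: "0 < \<alpha>" using V gam bet by (simp add: \<alpha>_def)
  have "\<exists>P. finite P \<and> card P = M \<and> P \<subseteq> space ?B \<and> (\<Sum>p\<in>P. \<Sum>q\<in>P - {p}. conf N s2 t p q) \<le> ennreal (\<alpha> * (real M)\<^sup>2)"
  proof (rule greedy_points[where V = V])
    show "emeasure ?B (space ?B) = ennreal V"
      unfolding spB using pb pbs emeasure_box[of "b / 2" N] b by (simp add: emeasure_restrict_space pbox_def V_def)
    have ex: "exp (- t) = \<alpha> * V" using V by (simp add: et \<alpha>_def)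
    fix p assume "p \<in> space ?B"
    then have p: "p \<in> space (cvec N)" "p \<in> pbox N b" using pbs by (auto simp: spB)
    note c = nn_integral_conf_le[OF s2 p(1), of t]
    show "conf N s2 t p \<in> borel_measurable ?B" using c(1) by (rule measurable_restrict_space1)
    show "(\<lambda>q. conf N s2 t q p) \<in> borel_measurable ?B" using c(2) by (rule measurable_restrict_space1)
    have r: "(\<integral>\<^sup>+q. f q \<partial>?B) \<le> (\<integral>\<^sup>+q. f q \<partial>cvec N)" for f
      using pb by (subst nn_integral_restrict_space) (auto intro!: nn_integral_mono simp: indicator_def)
    show "(\<integral>\<^sup>+q. conf N s2 t p q \<partial>?B) \<le> ennreal (\<alpha> * V)" using order_trans[OF r c(3)] by (simp only: ex)
    show "(\<integral>\<^sup>+q. conf N s2 t q p \<partial>?B) \<le> ennreal (\<alpha> * V)" using order_trans[OF r c(4)] by (simp only: ex)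
    have s: "{p} = PiE {..<N} (\<lambda>k. {p k})" using p(2) by (intro PiE_singleton[symmetric]) (simp add: pbox_def PiE_def)
    have "{p} \<in> sets (cvec N)" unfolding s by (intro sets_PiM_I_finite) auto
    moreover have "emeasure (cvec N) {p} = 0" unfolding s using N by (subst L.emeasure_PiM) auto
    ultimately show "{p} \<in> null_sets ?B" using p pb by (subst null_sets_restrict_space) auto
  qed (use V al in auto)
  then obtain P where P: "finite P" "card P = M" "P \<subseteq> pbox N b"
    and sP: "(\<Sum>p\<in>P. \<Sum>q\<in>P - {p}. conf N s2 t p q) \<le> ennreal (\<alpha> * (real M)\<^sup>2)" by (auto simp: spB)
  have P0: "P \<noteq> {}" using P(2) M(3) by auto
  define S where "S = periodic_IC N (b + g) P"
  have "is_IC N S" unfolding S_def by (rule is_IC_periodic[OF N b(3) g P(1) P0 P(3)])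
  moreover have dens: "IC_density N S = ereal (real M / (b + g) ^ (2 * N))"
    unfolding S_def using IC_density_periodic[OF N b(3) g P(1) P0 P(3)] P(2) by simp
  moreover have "\<gamma> / 4 \<le> real M / (b + g) ^ (2 * N)"
  proof -
    have "\<gamma> / 4 * (b + g) ^ (2 * N) \<le> \<gamma> / 4 * (2 * V)" using cV gam by (intro mult_left_mono) auto
    also have "\<dots> \<le> real M" using M(2) by (simp add: mult.commute)
    finally show ?thesis using b g by (simp add: pos_le_divide_eq)
  qed
  moreover have "avg_err_prob n L s2 S \<le> ennreal (infocdf N s2 t + 2 * \<beta>)"
  proof -
    let ?I = "\<lambda>h. emeasure ?G {z \<in> space ?G. infod N s2 h z < t}"
    let ?U = "\<lambda>h. emeasure ?G {z \<in> space ?G. guard_bad N g h z}"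
    let ?C = "\<lambda>p q h. emeasure ?G {z \<in> space ?G. t \<le> infod N s2 h z \<and> closer N h z p q}"
    have mp: "p \<in> space (cvec N)" if "p \<in> P" for p using that P(3) pbs by blast
    have [measurable]: "Measurable.pred (cvec N \<Otimes>\<^sub>M cvec N) (\<lambda>x. closer N (fst x) (snd x) p q)" if "p \<in> P" "q \<in> P" for p q
      using mp[OF that(1)] mp[OF that(2)] by (intro measurable_closer) measurable
    note sI = emeasure_jointM_slices[OF s2, where N = N and R = "\<lambda>h z. infod N s2 h z < t"]
    note sU = emeasure_jointM_slices[where R = "guard_bad N g" and N = N, OF s2 measurable_guard_bad(1)]
    have sC: "?C p q \<in> borel_measurable ?H" "(\<integral>\<^sup>+h. ?C p q h \<partial>?H) = conf N s2 t p q" if "p \<in> P" "q \<in> P" for p q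
      using that emeasure_jointM_slices[OF s2, where N = N and R = "\<lambda>h z. t \<le> infod N s2 h z \<and> closer N h z p q"] by (auto simp: conf_def)
    have sI': "?I \<in> borel_measurable ?H" "(\<integral>\<^sup>+h. ?I h \<partial>?H) = emeasure ?J {x \<in> space ?J. infod N s2 (fst x) (snd x) < t}"
      using sI by auto
    let ?D = "\<lambda>h p. {z \<in> space ?G. infod N s2 h z < t \<or> guard_bad N g h z \<or> (\<exists>q\<in>P - {p}. t \<le> infod N s2 h z \<and> closer N h z p q)}"
    let ?E = "\<lambda>h p. measure ?G (?D h p)"
    \<comment> \<open>For fixed \<open>h\<close> the three terms are slices of events of the joint
      law; integrating over \<open>h\<close> leads to \<open>infocdf\<close>, the guard probability
      and \<open>conf\<close>.\<close>
    have "err_given_fading N s2 S h \<le> ?I h + ?U h + ennreal (1 / real M) * (\<Sum>p\<in>P. \<Sum>q\<in>P - {p}. ?C p q h)" for h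
    proof -
      have Ele: "ennreal (?E h p) \<le> ?I h + ?U h + (\<Sum>q\<in>P - {p}. ?C p q h)" for p
      proof -
        have cl [measurable]: "Measurable.pred (cvec N) (\<lambda>z. closer N h z p q)" for q
          unfolding closer_iff by measurable
        let ?I1 = "{z \<in> space ?G. infod N s2 h z < t}" let ?U1 = "{z \<in> space ?G. guard_bad N g h z}"
        let ?C' = "\<lambda>q. {z \<in> space ?G. t \<le> infod N s2 h z \<and> closer N h z p q}"
        have m: "?I1 \<in> sets ?G" "?U1 \<in> sets ?G"
          "?C' q \<in> sets ?G" for q by measurable
        have "ennreal (?E h p) = emeasure ?G (?D h p)"
          by (simp only: G.emeasure_eq_measure)
        also have "\<dots> = emeasure ?G (?I1 \<union> ?U1 \<union> (\<Union>q\<in>P - {p}. ?C' q))"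
          by (intro arg_cong2[where f = emeasure]) auto
        also have "\<dots> \<le> emeasure ?G (?I1 \<union> ?U1) + emeasure ?G (\<Union>q\<in>P - {p}. ?C' q)"
          using m P(1) by (intro emeasure_subadditive) auto
        also have "\<dots> \<le> (?I h + ?U h) + (\<Sum>q\<in>P - {p}. ?C p q h)"
          using m P(1) by (intro add_mono emeasure_subadditive emeasure_subadditive_finite) auto
        finally show ?thesis .
      qed
      have "err_given_fading N s2 S h \<le> ennreal ((\<Sum>p\<in>P. ?E h p) / real (card P))"
        unfolding S_def using ml_err_periodic_le[OF s2 N b(3) g P(1) P0 P(3)]
        by (intro err_given_fading_periodic_le[OF N b(3) g P(1) P0 P(3)])
      also have "\<dots> = ennreal (1 / real M) * (\<Sum>p\<in>P. ennreal (?E h p))"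
        by (simp add: P(2) sum_ennreal ennreal_mult'[symmetric])
      also have "\<dots> \<le> ennreal (1 / real M) * (\<Sum>p\<in>P. (?I h + ?U h) + (\<Sum>q\<in>P - {p}. ?C p q h))"
        by (intro mult_left_mono sum_mono Ele) auto
      also have "\<dots> = ennreal (1 / real M) * (of_nat M * (?I h + ?U h)) + ennreal (1 / real M) * (\<Sum>p\<in>P. \<Sum>q\<in>P - {p}. ?C p q h)"
        by (simp add: sum.distrib P(2) distrib_left)
      also have "ennreal (1 / real M) * (of_nat M * (?I h + ?U h)) = ?I h + ?U h"
        using M(3) by (simp add: mult.assoc[symmetric] ennreal_of_nat_eq_real_of_nat ennreal_mult'[symmetric])
      finally show ?thesis .
    qed
    then have "avg_err_prob n L s2 S \<le> (\<integral>\<^sup>+h. ?I h + ?U h + ennreal (1 / real M) * (\<Sum>p\<in>P. \<Sum>q\<in>P - {p}. ?C p q h) \<partial>?H)"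
      unfolding avg_err_prob_def N_def[symmetric] by (intro nn_integral_mono)
    also have "\<dots> = (\<integral>\<^sup>+h. ?I h \<partial>?H) + (\<integral>\<^sup>+h. ?U h \<partial>?H) + ennreal (1 / real M) * (\<Sum>p\<in>P. \<Sum>q\<in>P - {p}. (\<integral>\<^sup>+h. ?C p q h \<partial>?H))"
    proof -
      have mS: "(\<lambda>h. \<Sum>q\<in>P - {p}. ?C p q h) \<in> borel_measurable ?H" if "p \<in> P" for p
        using sC(1) that by (intro borel_measurable_sum) auto
      then have mSS: "(\<lambda>h. \<Sum>p\<in>P. \<Sum>q\<in>P - {p}. ?C p q h) \<in> borel_measurable ?H" by (intro borel_measurable_sum) auto
      have "(\<integral>\<^sup>+h. (\<Sum>p\<in>P. \<Sum>q\<in>P - {p}. ?C p q h) \<partial>?H) = (\<Sum>p\<in>P. \<Sum>q\<in>P - {p}. (\<integral>\<^sup>+h. ?C p q h \<partial>?H))"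
        using mS sC(1) by (subst nn_integral_sum) (auto intro!: sum.cong nn_integral_sum)
      then show ?thesis
        using sI'(1) sU(1) mSS by (simp add: nn_integral_add nn_integral_cmult)
    qed
    also have "\<dots> \<le> ennreal (infocdf N s2 t) + ennreal \<beta> + ennreal \<beta>"
    proof (intro add_mono)
      show "(\<integral>\<^sup>+h. ?I h \<partial>?H) \<le> ennreal (infocdf N s2 t)"
      proof -
        have "{x \<in> space ?J. infod N s2 (fst x) (snd x) \<le> t} \<in> sets ?J" by measurable
        then have "emeasure ?J {x \<in> space ?J. infod N s2 (fst x) (snd x) < t} \<le> emeasure ?J {x \<in> space ?J. infod N s2 (fst x) (snd x) \<le> t}"
          by (intro emeasure_mono) auto
        then show ?thesis using sI'(2) by (simp only: infocdf_def J.emeasure_eq_measure)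
      qed
      show "(\<integral>\<^sup>+h. ?U h \<partial>?H) \<le> ennreal \<beta>" unfolding sU(2) J.emeasure_eq_measure using gp by (rule ennreal_leI)
      have "(\<Sum>p\<in>P. \<Sum>q\<in>P - {p}. (\<integral>\<^sup>+h. ?C p q h \<partial>?H)) = (\<Sum>p\<in>P. \<Sum>q\<in>P - {p}. conf N s2 t p q)"
        using sC(2) by (intro sum.cong refl) auto
      then have "ennreal (1 / real M) * (\<Sum>p\<in>P. \<Sum>q\<in>P - {p}. (\<integral>\<^sup>+h. ?C p q h \<partial>?H)) \<le> ennreal (1 / real M) * ennreal (\<alpha> * (real M)\<^sup>2)"
        using sP by (simp add: mult_left_mono)
      also have "\<dots> = ennreal (\<alpha> * real M)" using M(3) al by (simp add: ennreal_mult'[symmetric] power2_eq_square)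
      also have "\<dots> \<le> ennreal \<beta>"
        using mult_left_mono[OF M(1), of \<alpha>] al V gam by (intro ennreal_leI) (simp add: \<alpha>_def)
      finally show "ennreal (1 / real M) * (\<Sum>p\<in>P. \<Sum>q\<in>P - {p}. (\<integral>\<^sup>+h. ?C p q h \<partial>?H)) \<le> ennreal \<beta>" .
    qed
    also have "\<dots> = ennreal (infocdf N s2 t + 2 * \<beta>)"
      using bet by (simp add: ennreal_plus[symmetric] infocdf_def del: ennreal_plus)
    finally show ?thesis .
  qed
  ultimately show ?thesis unfolding N_def t_def by (intro exI[of _ S]) simp
qed

section \<open>Normal approximation of the information density\<close>

lemma pair_integral_mult:
  fixes f :: "'a \<Rightarrow> 'c :: {real_normed_field, banach, second_countable_topology}" and g :: "'b \<Rightarrow> 'c"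
  assumes M: "prob_space M1" "prob_space M2" and f: "integrable M1 f" and g: "integrable M2 g"
  shows "integrable (M1 \<Otimes>\<^sub>M M2) (\<lambda>x. f (fst x) * g (snd x))"
    and "(\<integral>x. f (fst x) * g (snd x) \<partial>(M1 \<Otimes>\<^sub>M M2)) = (\<integral>x. f x \<partial>M1) * (\<integral>x. g x \<partial>M2)"
proof -
  interpret M1: prob_space M1 by (rule M)
  interpret M2: prob_space M2 by (rule M)
  interpret P: pair_prob_space M1 M2 ..
  have [measurable]: "f \<in> borel_measurable M1" "g \<in> borel_measurable M2" using f g by auto
  show i: "integrable (M1 \<Otimes>\<^sub>M M2) (\<lambda>x. f (fst x) * g (snd x))"
  proof (rule P.Fubini_integrable)
    show "integrable M1 (\<lambda>x. \<integral>y. norm (f (fst (x, y)) * g (snd (x, y))) \<partial>M2)"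
      using f g by (simp add: norm_mult)
  qed (use f g in auto)
  show "(\<integral>x. f (fst x) * g (snd x) \<partial>(M1 \<Otimes>\<^sub>M M2)) = (\<integral>x. f x \<partial>M1) * (\<integral>x. g x \<partial>M2)"
    using P.integral_fst'[OF i] f g by simp
qed

lemma integral_cgauss_sqnorm:
  fixes f :: "real \<Rightarrow> 'a :: {banach, second_countable_topology}"
  assumes s2: "0 < s2" and [measurable]: "f \<in> borel_measurable borel"
  shows "integrable (cgauss s2) (\<lambda>z. f ((cmod z)\<^sup>2 / s2)) \<longleftrightarrow> integrable lborel (\<lambda>x. exponential_density 1 x *\<^sub>R f x)"
    and "(\<integral>z. f ((cmod z)\<^sup>2 / s2) \<partial>cgauss s2) = (\<integral>x. exponential_density 1 x *\<^sub>R f x \<partial>lborel)"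
proof -
  have d: "distr (cgauss s2) lborel (\<lambda>z. (cmod z)\<^sup>2 / s2) = density lborel (exponential_density 1)"
    using cgauss_sqnorm_exponential[OF s2] by (simp add: distributed_def)
  have "integrable (cgauss s2) (\<lambda>z. f ((cmod z)\<^sup>2 / s2)) \<longleftrightarrow> integrable (distr (cgauss s2) lborel (\<lambda>z. (cmod z)\<^sup>2 / s2)) f"
    by (rule integrable_distr_eq[symmetric]) auto
  then show "integrable (cgauss s2) (\<lambda>z. f ((cmod z)\<^sup>2 / s2)) \<longleftrightarrow> integrable lborel (\<lambda>x. exponential_density 1 x *\<^sub>R f x)"
    unfolding d by (subst (asm) integrable_density) (auto simp: exponential_density_nonneg)
  have "(\<integral>z. f ((cmod z)\<^sup>2 / s2) \<partial>cgauss s2) = integral\<^sup>L (distr (cgauss s2) lborel (\<lambda>z. (cmod z)\<^sup>2 / s2)) f"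
    by (rule integral_distr[symmetric]) auto
  then show "(\<integral>z. f ((cmod z)\<^sup>2 / s2) \<partial>cgauss s2) = (\<integral>x. exponential_density 1 x *\<^sub>R f x \<partial>lborel)"
    unfolding d by (subst (asm) integral_density) (auto simp: exponential_density_nonneg)
qed

section \<open>Third moments of the noise and fading terms\<close>

lemma integrable_exponential_moment:
  "integrable lborel (\<lambda>x. exponential_density 1 x * x ^ k)"
proof (rule integrableI_nonneg)
  have "(\<integral>\<^sup>+x. ennreal (exponential_density 1 x * x ^ k) \<partial>lborel) = ennreal (fact k)"
    using nn_integral_erlang_ith_moment[of 1 0 k] by simp
  then show "(\<integral>\<^sup>+x. ennreal (exponential_density 1 x * x ^ k) \<partial>lborel) < \<infinity>" by simp
qed (auto simp: exponential_density_def)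

lemma integrable_exponential_powr:
  "integrable lborel (\<lambda>x. exponential_density 1 x * x powr (- 1 / 2))"
proof -
  let ?f = "\<lambda>t::real. t powr (1 / 2 - 1) / exp t"
  have h: "(?f has_integral Gamma (1 / 2)) {0..}" by (rule Gamma_integral_real) simp
  have "?f absolutely_integrable_on {0..}"
    by (rule nonnegative_absolutely_integrable_1) (use h in \<open>auto simp: integrable_on_def\<close>)
  then have "integrable lebesgue (\<lambda>x. indicator {0..} x *\<^sub>R ?f x)" by (simp add: set_integrable_def)
  then have "integrable lborel (\<lambda>x. indicator {0..} x *\<^sub>R ?f x)" by (subst (asm) integrable_completion) auto
  also have "(\<lambda>x. indicator {0..} x *\<^sub>R ?f x) = (\<lambda>x. exponential_density 1 x * x powr (- 1 / 2))"
    by (auto simp: exponential_density_def indicator_def exp_minus field_simps fun_eq_iff)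
  finally show ?thesis .
qed

text \<open>Near 0, \<open>ln y \<le> y\<close> at \<open>y = x powr (- 1 / 6)\<close> gives
  \<open>|ln x| \<le> 6 * x powr (- 1 / 6)\<close>, whose cube is
  \<open>216 * x powr (- 1 / 2)\<close>, integrable by the value of Gamma at 1/2. For
  \<open>x \<ge> 1\<close>, \<open>ln x \<le> x\<close> suffices.\<close>

lemma integrable_exponential_ln3:
  "integrable lborel (\<lambda>x. exponential_density 1 x * \<bar>ln x\<bar> ^ 3)"
proof (rule Bochner_Integration.integrable_bound)
  let ?d = "exponential_density 1"
  show "integrable lborel (\<lambda>x. 216 * (?d x * x powr (- 1 / 2)) + ?d x * x ^ 3)"
    using integrable_exponential_powr integrable_exponential_moment[of 3] by simp
  have "\<bar>ln x\<bar> ^ 3 \<le> 216 * x powr (- 1 / 2) + x ^ 3" if x: "0 < x" for x :: real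
  proof (cases "1 \<le> x")
    case True
    then have "\<bar>ln x\<bar> \<le> x" using ln_bound[of x] by simp
    then have "\<bar>ln x\<bar> ^ 3 \<le> x ^ 3" by (intro power_mono) auto
    then show ?thesis by (simp add: add_increasing)
  next
    case False
    have "ln (x powr (- 1 / 6)) \<le> x powr (- 1 / 6)" using x by (intro ln_bound) simp
    then have "- ln x \<le> 6 * x powr (- 1 / 6)" using x by (simp add: ln_powr)
    then have "\<bar>ln x\<bar> \<le> 6 * x powr (- 1 / 6)" using False x by (simp add: ln_less_zero abs_of_neg)
    then have "\<bar>ln x\<bar> ^ 3 \<le> (6 * x powr (- 1 / 6)) ^ 3" by (intro power_mono) auto
    also have "\<dots> = 216 * x powr (- 1 / 2)"
      using x by (simp add: power_mult_distrib powr_realpow[symmetric] powr_powr)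
    finally show ?thesis using x by (simp add: add_increasing2)
  qed
  then have le: "?d x * \<bar>ln x\<bar> ^ 3 \<le> ?d x * (216 * x powr (- 1 / 2) + x ^ 3)" if "0 < x" for x
    using that by (intro mult_left_mono) (auto simp: exponential_density_def)
  then have "norm (?d x * \<bar>ln x\<bar> ^ 3) \<le> norm (216 * (?d x * x powr (- 1 / 2)) + ?d x * x ^ 3)" if "0 < x" for x
    using le[OF that] that by (simp add: exponential_density_nonneg abs_mult distrib_left mult_ac)
  moreover have "norm (?d x * \<bar>ln x\<bar> ^ 3) \<le> norm (216 * (?d x * x powr (- 1 / 2)) + ?d x * x ^ 3)" if "\<not> 0 < x" for x
    using that by (cases "x = 0") (auto simp: exponential_density_def)
  ultimately show "AE x in lborel. norm (?d x * \<bar>ln x\<bar> ^ 3) \<le> norm (216 * (?d x * x powr (- 1 / 2)) + ?d x * x ^ 3)"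
    by (intro AE_I2) blast
qed (auto simp: exponential_density_def[abs_def])

definition lnsq :: "complex \<Rightarrow> real" where "lnsq h = ln ((cmod h)\<^sup>2)"

lemma lnsq_measurable [measurable]: "lnsq \<in> borel_measurable borel"
  unfolding lnsq_def[abs_def] by measurable

lemma (in prob_space) integrable_lower_powers:
  fixes X :: "'a \<Rightarrow> real"
  assumes [measurable]: "X \<in> borel_measurable M" and i: "integrable M (\<lambda>x. \<bar>X x\<bar> ^ 3)"
  shows "integrable M X" "integrable M (\<lambda>x. (X x)\<^sup>2)"
proof -
  have b: "\<bar>y\<bar> \<le> 1 + \<bar>y\<bar> ^ 3" "y\<^sup>2 \<le> 1 + \<bar>y\<bar> ^ 3" for y :: real
  proof -
    show "\<bar>y\<bar> \<le> 1 + \<bar>y\<bar> ^ 3"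
      using self_le_power[of "\<bar>y\<bar>" 3] by (cases "1 \<le> \<bar>y\<bar>") (auto simp: add_increasing2 intro: order_trans)
    show "y\<^sup>2 \<le> 1 + \<bar>y\<bar> ^ 3"
    proof (cases "1 \<le> \<bar>y\<bar>")
      case True
      then have "\<bar>y\<bar>\<^sup>2 \<le> \<bar>y\<bar> ^ 3" by (intro power_increasing) auto
      then show ?thesis by simp
    next
      case False
      then have "y\<^sup>2 \<le> 1" by (simp add: abs_square_le_1)
      then show ?thesis by (simp add: add_increasing2)
    qed
  qed
  have i': "integrable M (\<lambda>x. 1 + \<bar>X x\<bar> ^ 3)" using i by simp
  show "integrable M X" by (rule Bochner_Integration.integrable_bound[OF i']) (use b in auto)
  show "integrable M (\<lambda>x. (X x)\<^sup>2)" by (rule Bochner_Integration.integrable_bound[OF i']) (use b in auto)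
qed

lemma lnsq_moments:
  shows "integrable (cgauss 1) (\<lambda>h. \<bar>lnsq h\<bar> ^ 3)" "integrable (cgauss 1) lnsq" "integrable (cgauss 1) (\<lambda>h. (lnsq h)\<^sup>2)"
proof -
  interpret prob_space "cgauss 1" by (rule prob_space_cgauss) simp
  have m: "lnsq \<in> borel_measurable (cgauss 1)" by measurable
  show i: "integrable (cgauss 1) (\<lambda>h. \<bar>lnsq h\<bar> ^ 3)"
    using integral_cgauss_sqnorm(1)[of 1 "\<lambda>x. \<bar>ln x\<bar> ^ 3"] integrable_exponential_ln3 by (simp add: lnsq_def)
  show "integrable (cgauss 1) lnsq" "integrable (cgauss 1) (\<lambda>h. (lnsq h)\<^sup>2)"
    using integrable_lower_powers[OF m i] by auto
qed

lemma sqnorm_moments: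
  assumes s2: "0 < s2"
  defines "Y \<equiv> \<lambda>z. (cmod z)\<^sup>2 / s2"
  shows "integrable (cgauss s2) (\<lambda>z. \<bar>Y z\<bar> ^ 3)" "integrable (cgauss s2) Y" "integrable (cgauss s2) (\<lambda>z. (Y z)\<^sup>2)"
    "(\<integral>z. Y z \<partial>cgauss s2) = 1" "(\<integral>z. (Y z - 1)\<^sup>2 \<partial>cgauss s2) = 1"
proof -
  interpret prob_space "cgauss s2" by (rule prob_space_cgauss[OF s2])
  have m: "Y \<in> borel_measurable (cgauss s2)" unfolding Y_def by measurable
  have "integrable (cgauss s2) (\<lambda>z. (Y z) ^ 3)"
    using integral_cgauss_sqnorm(1)[OF s2, of "\<lambda>x. x ^ 3"] integrable_exponential_moment[of 3] by (simp add: Y_def)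
  moreover have "(\<lambda>z. \<bar>Y z\<bar> ^ 3) = (\<lambda>z. (Y z) ^ 3)" using s2 by (simp add: Y_def fun_eq_iff)
  ultimately show i: "integrable (cgauss s2) (\<lambda>z. \<bar>Y z\<bar> ^ 3)" by simp
  show "integrable (cgauss s2) Y" "integrable (cgauss s2) (\<lambda>z. (Y z)\<^sup>2)"
    using integrable_lower_powers[OF m i] by auto
  have D: "distributed (cgauss s2) lborel Y (exponential_density 1)"
    unfolding Y_def by (rule cgauss_sqnorm_exponential[OF s2])
  show e: "(\<integral>z. Y z \<partial>cgauss s2) = 1" using exponential_distributed_expectation[OF _ D] by simp
  show "(\<integral>z. (Y z - 1)\<^sup>2 \<partial>cgauss s2) = 1" using exponential_distributed_variance[OF _ D] e by simp
qed

lemma char_exponential: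
  "(CLBINT x. exponential_density 1 x *\<^sub>R iexp (s * x)) = 1 / (1 - \<i> * s)"
proof -
  let ?a = "1 - \<i> * complex_of_real s"
  let ?f = "\<lambda>x::real. exp (- (?a * x))" let ?F = "\<lambda>x::real. - exp (- (?a * x)) / ?a"
  have a: "?a \<noteq> 0" by (simp add: complex_eq_iff)
  have n: "cmod (?f x) = exp (- x)" for x :: real by (simp add: norm_exp_eq_Re)
  have "(LBINT x=0..\<infinity>. ?f x) = 0 - ?F 0"
  proof (rule interval_integral_FTC_integrable)
    show "(?F has_vector_derivative ?f x) (at x)" for x
    proof -
      have "((\<lambda>z. - exp (- (?a * z)) / ?a) has_field_derivative exp (- (?a * complex_of_real x))) (at (complex_of_real x))"
        using a by (auto intro!: derivative_eq_intros simp: divide_simps) (simp add: algebra_simps)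
      from has_vector_derivative_real_field[OF this] show ?thesis by simp
    qed
    show "isCont ?f x" for x by (intro continuous_intros)
    show "set_integrable lborel (einterval 0 \<infinity>) ?f"
      unfolding set_integrable_def
    proof (rule Bochner_Integration.integrable_bound)
      show "integrable lborel (\<lambda>x. exponential_density 1 x * x ^ 0)" by (rule integrable_exponential_moment)
      show "AE x in lborel. norm (indicator (einterval 0 \<infinity>) x *\<^sub>R ?f x) \<le> norm (exponential_density 1 x * x ^ 0)"
        using n by (auto simp: indicator_def exponential_density_def einterval_def zero_ereal_def simp del: norm_exp_eq_Re)
    qed measurable
    show "((?F \<circ> real_of_ereal) \<longlongrightarrow> ?F 0) (at_right 0)"
      unfolding zero_ereal_def ereal_tendsto_simps by (intro tendsto_intros) (use a in auto)
    have "((\<lambda>x. cmod (?F x)) \<longlongrightarrow> 0) at_top"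
    proof -
      have "(\<lambda>x. cmod (?F x)) = (\<lambda>x. exp (- x) / cmod ?a)" by (simp add: norm_divide n fun_eq_iff)
      moreover have "0 < cmod ?a" using a by simp
      then have "((\<lambda>x. exp (- x) / cmod ?a) \<longlongrightarrow> 0) at_top" by real_asymp
      ultimately show ?thesis by simp
    qed
    then show "((?F \<circ> real_of_ereal) \<longlongrightarrow> 0) (at_left \<infinity>)"
      unfolding ereal_tendsto_simps by (rule tendsto_norm_zero_cancel)
  qed auto
  also have "(LBINT x=0..\<infinity>. ?f x) = (CLINT x|lborel. indicator (einterval 0 \<infinity>) x *\<^sub>R ?f x)"
    by (simp add: interval_lebesgue_integral_def set_lebesgue_integral_def)
  also have "\<dots> = (CLBINT x. exponential_density 1 x *\<^sub>R iexp (s * x))"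
  proof (rule integral_cong_AE)
    \<comment> \<open>The integrands differ at \<open>x = 0\<close>, which the open interval leaves
      out although the exponential density is positive there.\<close>
    show "AE x in lborel. indicator (einterval 0 \<infinity>) x *\<^sub>R ?f x = exponential_density 1 x *\<^sub>R iexp (s * x)"
      using AE_lborel_singleton[of "0::real"]
    proof eventually_elim
      case (elim x)
      show ?case
      proof (cases "0 < x")
        case True
        then show ?thesis by (simp add: indicator_def einterval_def zero_ereal_def exponential_density_def exp_of_real[symmetric] exp_add[symmetric] scaleR_conv_of_real algebra_simps)
      next
        case False
        then show ?thesis using elim by (simp add: indicator_def einterval_def zero_ereal_def exponential_density_def)
      qed
    qed
  qed (auto simp: exponential_density_def[abs_def])
  finally show ?thesis by simp
qed

section \<open>The law of one summand of the information density\<close>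

definition infolaw :: "real \<Rightarrow> real measure" where
  "infolaw s2 = distr (cgauss 1 \<Otimes>\<^sub>M cgauss s2) borel (\<lambda>x. lnsq (fst x) - ln (pi * s2) - (cmod (snd x))\<^sup>2 / s2)"

lemma prob_space_cgauss_pair: "0 < s2 \<Longrightarrow> prob_space (cgauss 1 \<Otimes>\<^sub>M cgauss s2)"
  by (intro prob_space_pair prob_space_cgauss) auto

lemma real_distribution_infolaw: "0 < s2 \<Longrightarrow> real_distribution (infolaw s2)"
  unfolding infolaw_def by (intro prob_space.real_distribution_distr prob_space_cgauss_pair) auto

lemma integrable_iexp_prob:
  assumes "prob_space M" and [measurable]: "f \<in> borel_measurable M"
  shows "integrable M (\<lambda>x. iexp (f x :: real))"
proof -
  interpret prob_space M by fact
  show ?thesis by (rule integrable_const_bound[where B = 1]) auto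
qed

definition chA :: "real \<Rightarrow> complex" where "chA t = (CLINT h|cgauss 1. iexp (t * lnsq h))"

definition chB :: "real \<Rightarrow> real \<Rightarrow> complex" where "chB s2 t = (CLINT z|cgauss s2. iexp (t * (- ln (pi * s2) - (cmod z)\<^sup>2 / s2)))"

lemma char_infolaw:
  assumes s2: "0 < s2" shows "char (infolaw s2) t = chA t * chB s2 t"
proof -
  have e: "iexp (t * (lnsq (fst x) - ln (pi * s2) - (cmod (snd x))\<^sup>2 / s2)) =
      iexp (t * lnsq (fst x)) * iexp (t * (- ln (pi * s2) - (cmod (snd x))\<^sup>2 / s2))" for x :: "complex \<times> complex"
    unfolding exp_add[symmetric] by (simp add: algebra_simps)
  have "char (infolaw s2) t = (CLINT x|cgauss 1 \<Otimes>\<^sub>M cgauss s2. iexp (t * (lnsq (fst x) - ln (pi * s2) - (cmod (snd x))\<^sup>2 / s2)))"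
    unfolding char_def infolaw_def by (rule integral_distr) auto
  also have "\<dots> = chA t * chB s2 t"
    unfolding e chA_def chB_def using s2
    by (intro pair_integral_mult prob_space_cgauss integrable_iexp_prob) auto
  finally show ?thesis .
qed

text \<open>The noise part has modulus exactly \<open>1 / sqrt (1 + t^2)\<close>, the constant
  \<open>ln (pi * s2)\<close> being a phase; of the fading part only modulus at most 1 is
  used.\<close>

lemma cmod_char_infolaw_le:
  assumes s2: "0 < s2" shows "cmod (char (infolaw s2) t) \<le> 1 / sqrt (1 + t\<^sup>2)"
proof -
  interpret C: prob_space "cgauss 1" by (rule prob_space_cgauss) simp
  have A: "cmod (chA t) \<le> 1"
  proof -
    have "cmod (chA t) \<le> (\<integral>h. cmod (iexp (t * lnsq h)) \<partial>cgauss 1)" unfolding chA_def by (rule integral_norm_bound)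
    then show ?thesis using C.prob_space by simp
  qed
  have "chB s2 t = (CLINT z|cgauss s2. iexp (- t * ln (pi * s2)) * iexp (- t * ((cmod z)\<^sup>2 / s2)))"
    unfolding chB_def exp_add[symmetric] by (simp add: algebra_simps)
  also have "\<dots> = iexp (- t * ln (pi * s2)) * (CLINT z|cgauss s2. iexp (- t * ((cmod z)\<^sup>2 / s2)))" by (rule integral_mult_right_zero)
  also have "(CLINT z|cgauss s2. iexp (- t * ((cmod z)\<^sup>2 / s2))) = (CLBINT x. exponential_density 1 x *\<^sub>R iexp (- t * x))"
    by (rule integral_cgauss_sqnorm(2)[OF s2, of "\<lambda>x. iexp (- t * x)"]) measurable
  also have "\<dots> = 1 / (1 - \<i> * of_real (- t))" by (rule char_exponential)
  finally have "cmod (chB s2 t) = 1 / cmod (1 - \<i> * of_real (- t))"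
    by (simp only: norm_mult norm_divide norm_exp_i_times norm_one mult_1_left)
  moreover have "cmod (1 - \<i> * of_real (- t)) = sqrt (1 + t\<^sup>2)" by (simp add: cmod_def)
  ultimately have B: "cmod (chB s2 t) = 1 / sqrt (1 + t\<^sup>2)" by simp
  have "cmod (char (infolaw s2) t) \<le> 1 * (1 / sqrt (1 + t\<^sup>2))"
    unfolding char_infolaw[OF s2] norm_mult B using A by (intro mult_right_mono) auto
  then show ?thesis by simp
qed

text \<open>The exponential of the sum factors over coordinates and over fading and noise; this is
  independence in the form in which \<open>berry_esseen\<close> asks for it.\<close>

lemma char_infod:
  assumes s2: "0 < s2"
  shows "char (distr (jointM N s2) borel (\<lambda>x. infod N s2 (fst x) (snd x))) t = char (infolaw s2) t ^ N"
proof -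
  interpret H: product_prob_space "\<lambda>_::nat. cgauss 1" by (rule product_prob_space_cgauss) simp
  interpret G: product_prob_space "\<lambda>_::nat. cgauss s2" by (rule product_prob_space_cgauss[OF s2])
  have p1: "prob_space (cgauss 1)" and p2: "prob_space (cgauss s2)" using s2 by (auto intro: prob_space_cgauss)
  let ?f = "\<lambda>h. iexp (t * lnsq h)" let ?g = "\<lambda>z. iexp (t * (- ln (pi * s2) - (cmod z)\<^sup>2 / s2))"
  have fi: "integrable (cgauss 1) ?f" "integrable (cgauss s2) ?g" using p1 p2
    by (intro integrable_iexp_prob; simp)+
  have e: "iexp (t * infod N s2 (fst x) (snd x)) = (\<Prod>k<N. ?f (fst x k)) * (\<Prod>k<N. ?g (snd x k))" for x
  proof -
    have "iexp (t * infod N s2 (fst x) (snd x)) = (\<Prod>k<N. iexp (t * (lnsq (fst x k) - ln (pi * s2) - (cmod (snd x k))\<^sup>2 / s2)))"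
      unfolding infod_def lnsq_def[symmetric] by (simp add: exp_sum[symmetric] sum_distrib_left)
    also have "\<dots> = (\<Prod>k<N. ?f (fst x k) * ?g (snd x k))"
      unfolding exp_add[symmetric] by (intro prod.cong refl arg_cong[where f = exp]) (simp add: algebra_simps)
    finally show ?thesis by (simp only: prod.distrib)
  qed
  have "char (distr (jointM N s2) borel (\<lambda>x. infod N s2 (fst x) (snd x))) t = (CLINT x|jointM N s2. iexp (t * infod N s2 (fst x) (snd x)))"
    unfolding char_def by (rule integral_distr) measurable
  also have "\<dots> = (CLINT x|cgaussvec N 1 \<Otimes>\<^sub>M cgaussvec N s2. (\<Prod>k<N. ?f (fst x k)) * (\<Prod>k<N. ?g (snd x k)))"
    unfolding e jointM_def ..
  also have "\<dots> = (CLINT x|cgaussvec N 1. (\<Prod>k<N. ?f (x k))) * (CLINT x|cgaussvec N s2. (\<Prod>k<N. ?g (x k)))"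
    using s2 fi unfolding cgaussvec_def
    by (intro pair_integral_mult H.product_integrable_prod G.product_integrable_prod prob_space_PiM p1 p2) auto
  also have "(CLINT x|cgaussvec N 1. (\<Prod>k<N. ?f (x k))) = chA t ^ N"
    unfolding cgaussvec_def chA_def using fi by (subst H.product_integral_prod) auto
  also have "(CLINT x|cgaussvec N s2. (\<Prod>k<N. ?g (x k))) = chB s2 t ^ N"
    unfolding cgaussvec_def chB_def using fi by (subst G.product_integral_prod) auto
  finally show ?thesis by (simp add: char_infolaw[OF s2] power_mult_distrib)
qed

text \<open>Kept symbolic together with \<open>var_ln\<close>, since \<open>delta_star\<close> and
  \<open>disp_V\<close> reduce to the same two numbers. As \<open>|h|^2\<close> is exponential of
  mean 1, they are minus Euler's constant and \<open>pi^2 / 6\<close>.\<close>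

definition mu_ln :: real where "mu_ln = (\<integral>h. lnsq h \<partial>cgauss 1)"

definition var_ln :: real where "var_ln = (\<integral>h. (lnsq h - mu_ln)\<^sup>2 \<partial>cgauss 1)"

lemma infolaw_moments:
  assumes s2: "0 < s2"
  defines "m \<equiv> mu_ln - ln (pi * s2) - 1"
  shows "integrable (infolaw s2) (\<lambda>x. x)" "(\<integral>x. x \<partial>infolaw s2) = m"
    "integrable (infolaw s2) (\<lambda>x. x\<^sup>2)" "(\<integral>x. (x - m)\<^sup>2 \<partial>infolaw s2) = var_ln + 1"
    "integrable (infolaw s2) (\<lambda>x. \<bar>x\<bar> ^ 3)"
proof -
  let ?H = "cgauss 1" let ?G = "cgauss s2" let ?P = "cgauss 1 \<Otimes>\<^sub>M cgauss s2"
  have p: "prob_space ?H" "prob_space ?G" using s2 by (auto intro: prob_space_cgauss)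
  interpret H: prob_space ?H by (rule p)
  interpret G: prob_space ?G by (rule p)
  interpret P: prob_space ?P by (rule prob_space_cgauss_pair[OF s2])
  interpret nu: real_distribution "infolaw s2" by (rule real_distribution_infolaw[OF s2])
  let ?Y = "\<lambda>z. (cmod z)\<^sup>2 / s2" let ?c = "ln (pi * s2)"
  let ?Z = "\<lambda>x. lnsq (fst x) - ?c - ?Y (snd x)"
  note X = lnsq_moments and Y = sqnorm_moments[OF s2]
  have fst: "integrable ?P (\<lambda>x. f (fst x))" "(\<integral>x. f (fst x) \<partial>?P) = (\<integral>x. f x \<partial>?H)" if "integrable ?H f" for f :: "complex \<Rightarrow> real"
    using pair_integral_mult[OF p that, of "\<lambda>_. 1"] G.prob_space by auto
  have snd: "integrable ?P (\<lambda>x. f (snd x))" "(\<integral>x. f (snd x) \<partial>?P) = (\<integral>x. f x \<partial>?G)" if "integrable ?G f" for f :: "complex \<Rightarrow> real"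
    using pair_integral_mult[OF p _ that, of "\<lambda>_. 1"] H.prob_space by auto
  have i3: "integrable ?P (\<lambda>x. \<bar>?Z x\<bar> ^ 3)"
  proof (rule Bochner_Integration.integrable_bound)
    show "integrable ?P (\<lambda>x. 27 * (\<bar>lnsq (fst x)\<bar> ^ 3 + \<bar>?c\<bar> ^ 3 + \<bar>?Y (snd x)\<bar> ^ 3))"
      using fst(1)[OF X(1)] snd(1)[OF Y(1)] by simp
    have tri: "\<bar>u - v - w\<bar> ^ 3 \<le> 27 * (\<bar>u\<bar> ^ 3 + \<bar>v\<bar> ^ 3 + \<bar>w\<bar> ^ 3)" for u v w :: real
    proof -
      define M where "M = max \<bar>u\<bar> (max \<bar>v\<bar> \<bar>w\<bar>)"
      have "\<bar>u - v - w\<bar> ^ 3 \<le> (3 * M) ^ 3" by (intro power_mono) (auto simp: M_def)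
      also have "\<dots> = 27 * M ^ 3" by (simp add: power_mult_distrib)
      also have "M ^ 3 \<le> \<bar>u\<bar> ^ 3 + \<bar>v\<bar> ^ 3 + \<bar>w\<bar> ^ 3" by (auto simp: M_def max_def)
      finally show ?thesis by simp
    qed
    have "norm (\<bar>a\<bar> ^ 3) \<le> norm b" if "\<bar>a\<bar> ^ 3 \<le> b" for a b :: real using that by simp
    from this[OF tri] show "AE x in ?P. norm (\<bar>?Z x\<bar> ^ 3) \<le> norm (27 * (\<bar>lnsq (fst x)\<bar> ^ 3 + \<bar>?c\<bar> ^ 3 + \<bar>?Y (snd x)\<bar> ^ 3))"
      by (intro AE_I2)
  qed measurable
  have "integrable (infolaw s2) (\<lambda>x. \<bar>x\<bar> ^ 3) = integrable ?P (\<lambda>x. \<bar>?Z x\<bar> ^ 3)"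
    unfolding infolaw_def by (rule integrable_distr_eq) measurable
  then show n3: "integrable (infolaw s2) (\<lambda>x. \<bar>x\<bar> ^ 3)" using i3 by simp
  have nm: "(\<lambda>x. x) \<in> borel_measurable (infolaw s2)" by (rule measurable_ident_sets) (simp add: infolaw_def)
  show "integrable (infolaw s2) (\<lambda>x. x)" by (rule nu.integrable_lower_powers(1)[OF nm n3])
  show "integrable (infolaw s2) (\<lambda>x. x\<^sup>2)" by (rule nu.integrable_lower_powers(2)[OF nm n3])
  have "(\<integral>x. x \<partial>infolaw s2) = (\<integral>x. ?Z x \<partial>?P)"
    unfolding infolaw_def by (rule integral_distr) auto
  also have "\<dots> = m"
    using fst[OF X(2)] snd[OF Y(2)] Y(4) P.prob_space by (simp add: m_def mu_ln_def)
  finally show "(\<integral>x. x \<partial>infolaw s2) = m" .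
  let ?U = "\<lambda>h. lnsq h - mu_ln" let ?W = "\<lambda>z. ?Y z - 1"
  have iU: "integrable ?H ?U" "integrable ?G ?W" using X(2) Y(2) by auto
  have iU2: "integrable ?H (\<lambda>h. (?U h)\<^sup>2)" "integrable ?G (\<lambda>z. (?W z)\<^sup>2)"
  proof -
    have sq: "integrable ?G (\<lambda>z. (f z - 1)\<^sup>2)" if "integrable ?G f" "integrable ?G (\<lambda>z. (f z)\<^sup>2)" for f :: "complex \<Rightarrow> real"
      using that by (simp add: power2_diff)
    show "integrable ?H (\<lambda>h. (?U h)\<^sup>2)" using X(2,3) by (simp add: power2_diff)
    show "integrable ?G (\<lambda>z. (?W z)\<^sup>2)" using Y(2,3) by (rule sq)
  qed
  have zU: "(\<integral>h. ?U h \<partial>?H) = 0" using X(2) H.prob_space by (simp add: mu_ln_def)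
  have "(\<integral>x. (x - m)\<^sup>2 \<partial>infolaw s2) = (\<integral>x. (?Z x - m)\<^sup>2 \<partial>?P)"
    unfolding infolaw_def by (rule integral_distr) auto
  \<comment> \<open>\<open>?Z - m\<close> is the difference of the centred parts \<open>?U\<close>
    and \<open>?W\<close>; by independence the cross term integrates to 0.\<close>
  also have "\<dots> = (\<integral>x. (?U (fst x))\<^sup>2 - 2 * (?U (fst x) * ?W (snd x)) + (?W (snd x))\<^sup>2 \<partial>?P)"
  proof -
    have "(a - c - y - (u - c - 1))\<^sup>2 = (a - u)\<^sup>2 - 2 * ((a - u) * (y - 1)) + (y - 1)\<^sup>2" for a c y u :: real
      by (simp add: power2_eq_square algebra_simps)
    then show ?thesis unfolding m_def by simp
  qed
  also have "\<dots> = var_ln - 2 * 0 + 1"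
    using fst[OF iU2(1)] snd[OF iU2(2)] pair_integral_mult[OF p iU] Y(5) zU by (simp add: var_ln_def)
  finally show "(\<integral>x. (x - m)\<^sup>2 \<partial>infolaw s2) = var_ln + 1" by simp
qed

theorem infocdf_normal_approx:
  assumes s2: "0 < s2"
  shows "\<exists>C. \<forall>N\<ge>4. \<forall>x. \<bar>infocdf N s2 x - ncdf
    ((x - real N * (mu_ln - ln (pi * s2) - 1)) / sqrt (real N * (var_ln + 1)))\<bar> \<le> C / sqrt (real N)"
proof -
  \<comment> \<open>The unit variance of the exponential part makes this positive from
    \<open>var_ln \<ge> 0\<close> alone.\<close>
  have v: "0 < var_ln + 1" unfolding var_ln_def by (intro add_nonneg_pos integral_nonneg) auto
  note mom = infolaw_moments[OF s2]
  obtain C where C: "\<And>N \<mu> x. 4 \<le> N \<Longrightarrow> real_distribution \<mu> \<Longrightarrow> (\<forall>t. char \<mu> t = char (infolaw s2) t ^ N) \<Longrightarrow>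
     \<bar>cdf \<mu> x - ncdf ((x - real N * (mu_ln - ln (pi * s2) - 1)) / sqrt (real N * (var_ln + 1)))\<bar> \<le> C / sqrt (real N)"
    using berry_esseen[OF real_distribution_infolaw[OF s2] mom(1,2,3,4) v mom(5) cmod_char_infolaw_le[OF s2]] by blast
  show ?thesis
  proof (intro exI[of _ C] allI impI)
    fix N :: nat and x :: real assume N: "4 \<le> N"
    interpret J: prob_space "jointM N s2" by (rule prob_space_jointM[OF s2])
    let ?\<mu> = "distr (jointM N s2) borel (\<lambda>x. infod N s2 (fst x) (snd x))"
    have rv: "(\<lambda>x. infod N s2 (fst x) (snd x)) \<in> borel_measurable (jointM N s2)" by measurable
    have "cdf ?\<mu> x = infocdf N s2 x"
      unfolding cdf_def infocdf_def using rv
      by (subst measure_distr) (auto intro!: arg_cong2[where f = measure])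
    then show "\<bar>infocdf N s2 x - ncdf ((x - real N * (mu_ln - ln (pi * s2) - 1)) / sqrt (real N * (var_ln + 1)))\<bar> \<le> C / sqrt (real N)"
      using C[OF N J.real_distribution_distr[OF rv], of x] char_infod[OF s2] by simp
  qed
qed

section \<open>The constants \<open>delta_star\<close> and \<open>disp_V\<close> as moments of a
  summand\<close>

lemma AE_lndet:
  assumes c: "0 < c"
  shows "AE h in cgaussvec L 1. lndet L c h = (\<Sum>l<L. lnsq (h l) - ln c)"
  using AE_cgaussvec_nonzero[of 1 L, OF zero_less_one]
proof eventually_elim
  case (elim h)
  have "lndet L c h = (\<Sum>l<L. ln ((cmod (h l))\<^sup>2 / c))"
    unfolding lndet_def using elim c by (intro ln_prod) auto
  also have "\<dots> = (\<Sum>l<L. lnsq (h l) - ln c)"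
    unfolding lnsq_def using elim c by (intro sum.cong refl) (auto simp: ln_div)
  finally show ?case .
qed

lemma integral_cgaussvec_component:
  fixes f :: "complex \<Rightarrow> real"
  assumes s2: "0 < s2" and l: "l < L" and f: "integrable (cgauss s2) f"
  shows "integrable (cgaussvec L s2) (\<lambda>h. f (h l))" "(\<integral>h. f (h l) \<partial>cgaussvec L s2) = (\<integral>x. f x \<partial>cgauss s2)"
proof -
  have d: "distr (cgaussvec L s2) (cgauss s2) (\<lambda>h. h l) = cgauss s2"
    unfolding cgaussvec_def using l by (intro distr_PiM_component prob_space_cgauss s2) auto
  have m: "(\<lambda>h. h l) \<in> cgaussvec L s2 \<rightarrow>\<^sub>M cgauss s2"
    unfolding cgaussvec_def using l by (intro measurable_component_singleton) auto
  have fm: "f \<in> borel_measurable (cgauss s2)" using f by auto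
  show "integrable (cgaussvec L s2) (\<lambda>h. f (h l))" using integrable_distr_eq[OF m fm] f d by simp
  show "(\<integral>h. f (h l) \<partial>cgaussvec L s2) = (\<integral>x. f x \<partial>cgauss s2)" using integral_distr[OF m fm] d by simp
qed

lemma integral_lndet:
  assumes c: "0 < c"
  shows "(\<integral>h. lndet L c h \<partial>cgaussvec L 1) = real L * (mu_ln - ln c)"
proof -
  interpret prob_space "cgaussvec L 1" by (rule prob_space_cgaussvec) simp
  have i: "integrable (cgauss 1) (\<lambda>h. lnsq h - ln c)"
    using lnsq_moments(2) prob_space.prob_space[OF prob_space_cgauss[of 1]]
    by (intro Bochner_Integration.integrable_diff) (auto intro!: finite_measure.integrable_const prob_space.axioms prob_space_cgauss prob_space_imp_sigma_finite simp: prob_space_def)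
  have v: "(\<integral>h. lnsq h - ln c \<partial>cgauss 1) = mu_ln - ln c"
  proof -
    interpret C: prob_space "cgauss 1" by (rule prob_space_cgauss) simp
    show ?thesis using lnsq_moments(2) C.prob_space by (simp add: mu_ln_def)
  qed
  note co = integral_cgaussvec_component[OF zero_less_one _ i]
  have "(\<integral>h. lndet L c h \<partial>cgaussvec L 1) = (\<integral>h. (\<Sum>l<L. lnsq (h l) - ln c) \<partial>cgaussvec L 1)"
    by (rule integral_cong_AE) (use AE_lndet[OF c] in \<open>auto simp: lndet_def[abs_def]\<close>)
  also have "\<dots> = (\<Sum>l<L. \<integral>h. lnsq (h l) - ln c \<partial>cgaussvec L 1)"
    by (rule Bochner_Integration.integral_sum) (use co(1) in auto)
  also have "\<dots> = (\<Sum>l<L. mu_ln - ln c)" by (intro sum.cong refl) (use co(2) v in auto)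
  finally show ?thesis by simp
qed

text \<open>The mean 1 of \<open>|z|^2 / s2\<close> is the logarithm of the \<open>exp 1\<close> in
  the definition of \<open>delta_star\<close>.\<close>

lemma delta_star_eq: "0 < s2 \<Longrightarrow> delta_star L s2 = real L * (mu_ln - ln (pi * s2) - 1)"
  unfolding delta_star_def by (subst integral_lndet) (auto simp: ln_mult algebra_simps)

text \<open>\<open>lndet\<close> is almost surely a sum over branches; the square of the centred sum
  is expanded and cross terms vanish by independence. The summand \<open>L\<close> in
  \<open>disp_V\<close> is the variance of the noise part, 1 per branch.\<close>

lemma disp_V_eq: "disp_V L = real L * (var_ln + 1)"
proof -
  interpret C: prob_space "cgauss 1" by (rule prob_space_cgauss) simp
  interpret H: product_prob_space "\<lambda>_::nat. cgauss 1" by (rule product_prob_space_cgauss) simp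
  let ?W = "\<lambda>h. lnsq h - mu_ln"
  have iW: "integrable (cgauss 1) ?W" "integrable (cgauss 1) (\<lambda>h. (?W h)\<^sup>2)"
    using lnsq_moments(2,3) by (auto simp: power2_diff)
  have zW: "(\<integral>h. ?W h \<partial>cgauss 1) = 0" using lnsq_moments(2) C.prob_space by (simp add: mu_ln_def)
  have cross: "integrable (cgaussvec L 1) (\<lambda>h. ?W (h l) * ?W (h l'))"
    "(\<integral>h. ?W (h l) * ?W (h l') \<partial>cgaussvec L 1) = (if l = l' then var_ln else 0)" if l: "l < L" "l' < L" for l l'
  proof -
    have "integrable (cgaussvec L 1) (\<lambda>h. ?W (h l) * ?W (h l')) \<and> (\<integral>h. ?W (h l) * ?W (h l') \<partial>cgaussvec L 1) = (if l = l' then var_ln else 0)"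
    proof (cases "l = l'")
      case True
      then show ?thesis
        using integral_cgaussvec_component[OF zero_less_one l(1) iW(2)] by (simp add: var_ln_def power2_eq_square)
    next
      case False
      \<comment> \<open>Constant functions 1 in the remaining coordinates turn the product of two
        factors into one over all \<open>L\<close>, to which the product formula applies.\<close>
      let ?f = "\<lambda>k. if k = l \<or> k = l' then ?W else (\<lambda>_. 1)"
      have e: "?W (h l) * ?W (h l') = (\<Prod>k<L. ?f k (h k))" for h
      proof -
        have "(\<Prod>k<L. ?f k (h k)) = (\<Prod>k\<in>{l, l'}. ?f k (h k))"
          using l by (intro prod.mono_neutral_right) auto
        then show ?thesis using False by simp
      qed
      have i: "integrable (cgauss 1) (?f k)" for k using iW(1) by simp
      have "(\<integral>h. (\<Prod>k<L. ?f k (h k)) \<partial>PiM {..<L} (\<lambda>_. cgauss 1)) = (\<Prod>k<L. integral\<^sup>L (cgauss 1) (?f k))"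
        by (rule H.product_integral_prod) (use i in auto)
      also have "\<dots> = 0" using l zW by (intro prod_zero) auto
      finally show ?thesis
        unfolding e cgaussvec_def using H.product_integrable_prod[of "{..<L}" ?f] i False by auto
    qed
    then show "integrable (cgaussvec L 1) (\<lambda>h. ?W (h l) * ?W (h l'))"
      "(\<integral>h. ?W (h l) * ?W (h l') \<partial>cgaussvec L 1) = (if l = l' then var_ln else 0)" by auto
  qed
  have m: "(\<integral>h. lndet L 1 h \<partial>cgaussvec L 1) = real L * mu_ln" using integral_lndet[of 1 L] by simp
  have "(\<integral>h. (lndet L 1 h - real L * mu_ln)\<^sup>2 \<partial>cgaussvec L 1) = (\<integral>h. (\<Sum>l<L. \<Sum>l'<L. ?W (h l) * ?W (h l')) \<partial>cgaussvec L 1)"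
  proof (rule integral_cong_AE)
    show "AE h in cgaussvec L 1. (lndet L 1 h - real L * mu_ln)\<^sup>2 = (\<Sum>l<L. \<Sum>l'<L. ?W (h l) * ?W (h l'))"
      using AE_lndet[of 1 L, OF zero_less_one]
    proof eventually_elim
      case (elim h)
      have "lndet L 1 h - real L * mu_ln = (\<Sum>l<L. ?W (h l))" by (simp add: elim sum_subtractf)
      then show ?case by (simp add: power2_eq_square sum_product)
    qed
  qed (auto simp: lndet_def[abs_def])
  also have "\<dots> = (\<Sum>l<L. \<Sum>l'<L. if l = l' then var_ln else 0)"
    using cross by (subst Bochner_Integration.integral_sum) (auto intro!: sum.cong Bochner_Integration.integral_sum)
  also have "\<dots> = real L * var_ln" by simp
  finally show ?thesis unfolding disp_V_def m by (simp add: distrib_left)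
qed

section \<open>The asymptotic expansion\<close>

text \<open>On \<open>[-K, K]\<close> the density is least at the ends. This lower bound on the
  slope converts an error in probability into an error of the same order in the quantile.\<close>

lemma std_normal_cdf_diff_ge:
  assumes "a \<le> b" "\<bar>a\<bar> \<le> K" "\<bar>b\<bar> \<le> K"
  shows "std_normal_density K * (b - a) \<le> ncdf b - ncdf a"
proof (cases "a = b")
  case False
  interpret real_distribution std_normal_distribution by (rule real_dist_normal_dist)
  have ab: "a < b" using assms False by simp
  have d: "std_normal_density K \<le> std_normal_density t" if "t \<in> {a<..b}" for t
  proof -
    have "t\<^sup>2 \<le> K\<^sup>2" using that assms by (intro abs_le_square_iff[THEN iffD1]) auto
    then show ?thesis by (simp add: std_normal_density_def divide_right_mono)
  qed
  have "std_normal_density K * (b - a) = (\<integral>t. indicator {a<..b} t * std_normal_density K \<partial>lborel)"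
    using ab by simp
  also have "\<dots> \<le> (\<integral>t. indicator {a<..b} t * std_normal_density t \<partial>lborel)"
  proof (rule integral_mono)
    show "integrable lborel (\<lambda>t. indicator {a<..b} t * std_normal_density K)" using ab by simp
    show "integrable lborel (\<lambda>t. indicator {a<..b} t * std_normal_density t)"
      by (rule Bochner_Integration.integrable_bound[of _ "std_normal_density"]) (auto simp: indicator_def)
    show "indicator {a<..b} t * std_normal_density K \<le> indicator {a<..b} t * std_normal_density t" for t
      using d by (auto simp: indicator_def)
  qed
  also have "\<dots> = ncdf b - ncdf a"
    using ab by (simp add: cdf_diff_eq measure_std_normal_Ioc)
  finally show ?thesis .
qed simp

lemma std_normal_cdf_strict_mono:
  assumes "a < b" shows "ncdf a < ncdf b"
proof -
  have "0 < std_normal_density (max \<bar>a\<bar> \<bar>b\<bar>) * (b - a)"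
    using assms by (intro mult_pos_pos normal_density_pos) auto
  also have "\<dots> \<le> ncdf b - ncdf a"
    using assms by (intro std_normal_cdf_diff_ge) auto
  finally show ?thesis by simp
qed

lemma Qfun_eq_cdf: "Qfun x = ncdf (- x)"
proof -
  interpret real_distribution std_normal_distribution by (rule real_dist_normal_dist)
  have "emeasure std_normal_distribution {x<..} = (\<integral>\<^sup>+t. ennreal (std_normal_density t) * indicator {x<..} t \<partial>lborel)"
    by (rule emeasure_density) auto
  also have "\<dots> = ennreal \<bar>- 1\<bar> * (\<integral>\<^sup>+t. ennreal (std_normal_density (0 + - 1 * t)) * indicator {x<..} (0 + - 1 * t) \<partial>lborel)"
    by (rule nn_integral_real_affine) auto
  also have "\<dots> = (\<integral>\<^sup>+t. ennreal (std_normal_density t) * indicator {..< - x} t \<partial>lborel)"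
    by (simp, intro nn_integral_cong) (auto simp: std_normal_density_def indicator_def)
  also have "\<dots> = emeasure std_normal_distribution {..< - x}"
    by (rule emeasure_density[symmetric]) auto
  finally have "Qfun x = measure std_normal_distribution {..< - x}" by (simp add: Qfun_def measure_def)
  also have "\<dots> = measure std_normal_distribution ({..< - x} \<union> {- x})"
    using std_normal_atomless[of "- x"] by (subst finite_measure_Union) auto
  also have "{..< - x} \<union> {- x} = {.. - x}" by auto
  finally show "Qfun x = ncdf (- x)" by (simp add: cdf_def)
qed

text \<open>Existence by the intermediate value theorem and uniqueness by strict monotonicity give
  the definite description in \<open>Qinv\<close> its value.\<close>

lemma std_normal_quantile:
  assumes "0 < \<epsilon>" "\<epsilon> < 1"
  shows "ncdf (- Qinv \<epsilon>) = \<epsilon>"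
proof -
  interpret real_distribution std_normal_distribution by (rule real_dist_normal_dist)
  let ?F = "ncdf"
  have "\<forall>\<^sub>F a in at_bot. ?F a < \<epsilon>" using cdf_lim_at_bot assms by (auto intro: order_tendstoD)
  then obtain a where a: "?F a < \<epsilon>" by (auto simp: eventually_at_bot_linorder)
  have "\<forall>\<^sub>F b in at_top. \<epsilon> < ?F b" using cdf_lim_at_top_prob assms by (auto intro: order_tendstoD)
  then obtain b where b: "\<epsilon> < ?F b" by (auto simp: eventually_at_top_linorder)
  have "a \<le> b" using a b cdf_nondecreasing[of b a] by linarith
  moreover have "continuous_on {a..b} ?F"
    using std_normal_atomless by (intro continuous_at_imp_continuous_on ballI) (simp add: isCont_cdf)
  ultimately obtain y where y: "?F y = \<epsilon>" using IVT'[of ?F a \<epsilon> b] a b by auto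
  have "Qinv \<epsilon> = - y"
    unfolding Qinv_def
  proof (rule the_equality)
    show "Qfun (- y) = \<epsilon>" using Qfun_eq_cdf[of "- y"] y by simp
    fix x assume "Qfun x = \<epsilon>"
    then have "?F (- x) = ?F y" using Qfun_eq_cdf[of x] y by simp
    then show "x = - y" using std_normal_cdf_strict_mono[of "- x" y] std_normal_cdf_strict_mono[of y "- x"] by force
  qed
  then show ?thesis using y by simp
qed

theorem theorem5p5:
  fixes L :: nat and \<sigma> \<epsilon> :: real
  assumes "1 \<le> L" and "0 < \<sigma>" and "0 < \<epsilon>" and "\<epsilon> < 1"
  shows "\<exists>C. \<forall>\<^sub>F n in sequentially. \<exists>d. opt_NLD n L (\<sigma>\<^sup>2) \<epsilon> = ereal d \<and>
           \<bar>d - (delta_star L (\<sigma>\<^sup>2) - sqrt (disp_V L / real n) * Qinv \<epsilon>)\<bar>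
             \<le> C * ln (real n) / real n"
proof -
  define s2 where "s2 = \<sigma>\<^sup>2"
  have s2: "0 < s2" using assms by (simp add: s2_def)
  let ?F = "ncdf"
  interpret N: real_distribution std_normal_distribution by (rule real_dist_normal_dist)
  define y where "y = - Qinv \<epsilon>"
  have y: "?F y = \<epsilon>" unfolding y_def by (rule std_normal_quantile) fact+
  define \<delta> where "\<delta> = delta_star L s2"
  define V where "V = disp_V L"
  have V: "0 < V"
  proof -
    have "0 \<le> var_ln" unfolding var_ln_def by simp
    then show ?thesis unfolding V_def disp_V_eq using assms by (intro mult_pos_pos) auto
  qed
  obtain C0 where C0: "\<And>N x. 4 \<le> N \<Longrightarrow> \<bar>infocdf N s2 x - ?F ((x - real N * (mu_ln - ln (pi * s2) - 1)) / sqrt (real N * (var_ln + 1)))\<bar> \<le> C0 / sqrt (real N)"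
    using infocdf_normal_approx[OF s2] by blast
  \<comment> \<open>The approximation for \<open>N = n * L\<close>, restated in \<open>n\<close>:
    mean and variance per coordinate times \<open>L\<close> are \<open>\<delta>\<close> and
    \<open>V\<close>, and the error shrinks since \<open>n \<le> n * L\<close>. The absolute value
    is taken because the sign of \<open>C0\<close> is unknown.\<close>
  have be: "\<bar>infocdf (n * L) s2 x - ?F ((x - real n * \<delta>) / sqrt (real n * V))\<bar> \<le> \<bar>C0\<bar> / sqrt (real n)" if n: "4 \<le> n" for n x
  proof -
    have nL: "n \<le> n * L" "4 \<le> n * L" using n assms(1) by (auto intro: order_trans)
    have "real (n * L) * (mu_ln - ln (pi * s2) - 1) = real n * \<delta>" "real (n * L) * (var_ln + 1) = real n * V"
      by (simp_all add: \<delta>_def V_def delta_star_eq[OF s2] disp_V_eq)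
    then have "\<bar>infocdf (n * L) s2 x - ?F ((x - real n * \<delta>) / sqrt (real n * V))\<bar> \<le> C0 / sqrt (real (n * L))"
      using C0[OF nL(2), of x] by (simp only:)
    also have "\<dots> \<le> \<bar>C0\<bar> / sqrt (real (n * L))" by (intro divide_right_mono) auto
    also have "\<dots> \<le> \<bar>C0\<bar> / sqrt (real n)"
    proof -
      have "real n \<le> real (n * L)" using nL(1) by (simp only: of_nat_le_iff)
      then show ?thesis using n by (intro divide_left_mono mult_pos_pos) auto
    qed
    finally show ?thesis .
  qed
  \<comment> \<open>Room for moving the quantile \<open>y\<close> by up to 1 in either
    direction.\<close>
  define K where "K = \<bar>y\<bar> + 1"
  define dK where "dK = std_normal_density K"
  have dK: "0 < dK" unfolding dK_def by (rule normal_density_pos) simp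
  \<comment> \<open>Of \<open>|C0| + 3\<close>, \<open>|C0|\<close> covers the normal approximation
    and 2 the terms \<open>2 * \<eta>\<close> and \<open>2 * \<beta>\<close>; the last 1 gives the
    strict inequality of the converse. Dividing by the slope \<open>dK\<close> makes a step
    \<open>C2 / r\<close> of the quantile, with \<open>r = sqrt n\<close>, change the probability by
    at least \<open>(|C0| + 3) / r\<close>.\<close>
  define C2 where "C2 = (\<bar>C0\<bar> + 3) / dK"
  have C2: "0 < C2" "dK * C2 = \<bar>C0\<bar> + 3" using dK by (simp_all add: C2_def add_nonneg_pos)
  \<comment> \<open>The constant terms are absorbed by \<open>ln n \<ge> 1\<close>; the
    \<open>1 / 2\<close> is that of \<open>ln (sqrt n)\<close>.\<close>
  define C3 where "C3 = C2 * sqrt V + ln 4 + 1 / 2"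
  have "\<forall>\<^sub>F n in sequentially. \<exists>d. opt_NLD n L s2 \<epsilon> = ereal d \<and>
      \<bar>d - (\<delta> + sqrt (V / real n) * y)\<bar> \<le> C3 * ln (real n) / real n"
    \<comment> \<open>\<open>n \<ge> C2^2\<close> keeps the step \<open>C2 / r\<close> at most 1;
      \<open>n \<ge> 4\<close> exceeds \<open>exp 1\<close> and admits the normal
      approximation.\<close>
    using eventually_ge_at_top[of "max 4 (nat \<lceil>C2\<^sup>2\<rceil>)"]
  proof eventually_elim
    case (elim n)
    then have n: "4 \<le> n" and nC: "C2\<^sup>2 \<le> real n" by (auto simp: nat_le_iff ceiling_le_iff)
    define r where "r = sqrt (real n)"
    have r: "0 < r" "r\<^sup>2 = real n" using n by (auto simp: r_def)
    have C2r: "C2 / r \<le> 1"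
      using nC r C2(1) by (simp add: r_def real_le_rsqrt)
    have step: "dK * (C2 / r) = (\<bar>C0\<bar> + 3) / r" using C2(2) by simp
    have c2: "0 \<le> C2 / r" using C2(1) r by simp
    have yK: "\<bar>y\<bar> \<le> K" "\<bar>y + C2 / r\<bar> \<le> K" "\<bar>y - C2 / r\<bar> \<le> K" using c2 C2r unfolding K_def by linarith+
    have up: "\<epsilon> + (\<bar>C0\<bar> + 3) / r \<le> ?F (y + C2 / r)"
    proof -
      have "dK * ((y + C2 / r) - y) \<le> ?F (y + C2 / r) - ?F y"
        unfolding dK_def using c2 yK by (intro std_normal_cdf_diff_ge) auto
      also have "dK * ((y + C2 / r) - y) = (\<bar>C0\<bar> + 3) / r" using step by simp
      finally show ?thesis using y by linarith
    qed
    have dn: "?F (y - C2 / r) \<le> \<epsilon> - (\<bar>C0\<bar> + 3) / r"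
    proof -
      have "dK * (y - (y - C2 / r)) \<le> ?F y - ?F (y - C2 / r)"
        unfolding dK_def using c2 yK by (intro std_normal_cdf_diff_ge) auto
      also have "dK * (y - (y - C2 / r)) = (\<bar>C0\<bar> + 3) / r" using step by simp
      finally show ?thesis using y by linarith
    qed
    have be': "\<bar>infocdf (n * L) s2 x - ?F ((x - real n * \<delta>) / sqrt (real n * V))\<bar> \<le> \<bar>C0\<bar> / r" for x
      using be[OF n] by (simp only: r_def)
    have q: "(\<bar>C0\<bar> + 3) / r = \<bar>C0\<bar> / r + 3 * (1 / r)" and r1: "0 < 1 / r" using r(1) by (simp_all add: add_divide_distrib)
    have rV: "0 < sqrt (real n * V)" using V n by simp
    have rV': "sqrt (real n * V) = r * sqrt V" by (simp add: r_def real_sqrt_mult)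
    have N0: "0 < n * L" using n assms(1) by simp
    \<comment> \<open>One remainder serves both directions. \<open>ln 4\<close> and
      \<open>ln n / 2\<close> come in the converse from the threshold
      \<open>\<gamma> * \<eta> / 4\<close> with \<open>\<eta> = 1 / r\<close>, and in the direct
      part from the density \<open>\<gamma> / 4\<close> and \<open>\<beta> = 1 / r\<close>.\<close>
    define E where "E = (C2 * sqrt V + ln 4 + ln (real n) / 2) / real n"
    have lnr: "ln (1 / r) = - (ln (real n) / 2)" using n by (simp add: r_def ln_div ln_sqrt)
    have mid: "sqrt (V / real n) * real n = r * sqrt V"
      using r V by (simp add: r_def real_sqrt_divide field_simps)
    let ?A = "{ereal (NLD n L S) | S. is_IC (n * L) S \<and> 0 < IC_density (n * L) S \<and> IC_density (n * L) S < \<infinity> \<and> avg_err_prob n L s2 S \<le> ennreal \<epsilon>}"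
    have upper: "x \<le> ereal (\<delta> + sqrt (V / real n) * y + E)"
      if x: "x \<in> ?A" for x
    proof -
      from x obtain S where S: "x = ereal (NLD n L S)" "is_IC (n * L) S" "0 < IC_density (n * L) S" "IC_density (n * L) S < \<infinity>"
        "avg_err_prob n L s2 S \<le> ennreal \<epsilon>" by auto
      obtain \<gamma> where g: "IC_density (n * L) S = ereal \<gamma>" "0 < \<gamma>" using S(3,4) by (cases "IC_density (n * L) S") auto
      let ?t = "ln (\<gamma> * (1 / r) / 4)"
      have "ennreal (infocdf (n * L) s2 ?t - 2 * (1 / r)) \<le> ennreal \<epsilon>"
        using order_trans[OF avg_err_prob_ge[OF s2 N0 S(2) g, of "1 / r"] S(5)] r by simp
      then have "infocdf (n * L) s2 ?t - 2 * (1 / r) \<le> \<epsilon>" using assms(3) by (simp add: ennreal_le_iff2)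
      then have F: "?F ((?t - real n * \<delta>) / sqrt (real n * V)) < \<epsilon> + (\<bar>C0\<bar> + 3) / r"
        using be'[of ?t] q r1 by linarith
      have "(?t - real n * \<delta>) / sqrt (real n * V) < y + C2 / r"
        using F up N.cdf_nondecreasing[of "y + C2 / r" "(?t - real n * \<delta>) / sqrt (real n * V)"] by linarith
      then have "?t - real n * \<delta> < (y + C2 / r) * (r * sqrt V)" using rV by (simp add: pos_divide_less_eq rV')
      also have "(y + C2 / r) * (r * sqrt V) = sqrt (V / real n) * real n * y + C2 * sqrt V"
        unfolding mid using r(1) by (simp add: field_simps)
      finally have "?t < real n * \<delta> + sqrt (V / real n) * real n * y + C2 * sqrt V" by simp
      moreover have "?t = ln \<gamma> - ln (real n) / 2 - ln 4"
      proof -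
        have "?t = ln \<gamma> + ln (1 / r) - ln 4" using g r(1) by (simp add: ln_mult ln_div)
        then show ?thesis by (simp add: lnr)
      qed
      ultimately have "ln \<gamma> \<le> (\<delta> + sqrt (V / real n) * y) * real n + (C2 * sqrt V + ln 4 + ln (real n) / 2)"
        by (simp add: algebra_simps)
      then have "ln \<gamma> / real n \<le> ((\<delta> + sqrt (V / real n) * y) * real n + (C2 * sqrt V + ln 4 + ln (real n) / 2)) / real n"
        by (intro divide_right_mono) auto
      also have "\<dots> = \<delta> + sqrt (V / real n) * y + E" using n by (simp add: E_def add_divide_distrib)
      finally show ?thesis unfolding S(1) NLD_def g(1) by simp
    qed
    have lower: "\<exists>x\<in>?A.
       ereal (\<delta> + sqrt (V / real n) * y - E) \<le> x"
    proof -
      \<comment> \<open>\<open>u\<close> is the threshold \<open>ln (\<gamma> / \<beta>)\<close> of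
        the direct bound with \<open>\<beta> = 1 / r\<close>, placed one step \<open>C2 / r\<close>
        below the quantile; this determines \<open>\<gamma>\<close>.\<close>
      define u where "u = real n * \<delta> + r * sqrt V * (y - C2 / r)"
      define \<gamma> where "\<gamma> = exp u / r"
      have g: "0 < \<gamma>" using r by (simp add: \<gamma>_def)
      obtain S where S: "is_IC (n * L) S" "ereal (\<gamma> / 4) \<le> IC_density (n * L) S" "IC_density (n * L) S < \<infinity>"
        "avg_err_prob n L s2 S \<le> ennreal (infocdf (n * L) s2 (ln (\<gamma> / (1 / r))) + 2 * (1 / r))"
        using exists_good_IC[OF s2 N0 g, of "1 / r"] r by auto
      have lu: "ln (\<gamma> / (1 / r)) = u" using r by (simp add: \<gamma>_def)
      have "(u - real n * \<delta>) / sqrt (real n * V) = y - C2 / r" using r(1) V by (simp add: u_def rV')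
      then have "infocdf (n * L) s2 u \<le> ?F (y - C2 / r) + \<bar>C0\<bar> / r" using be'[of u] by (simp add: abs_le_iff)
      then have "infocdf (n * L) s2 u + 2 * (1 / r) \<le> \<epsilon>"
        using dn q r1 by linarith
      then have err: "avg_err_prob n L s2 S \<le> ennreal \<epsilon>" using S(4) unfolding lu by (meson ennreal_leI order_trans)
      obtain \<gamma>' where g': "IC_density (n * L) S = ereal \<gamma>'" using S(2,3) by (cases "IC_density (n * L) S") auto
      have gg: "\<gamma> / 4 \<le> \<gamma>'" using S(2) g' by simp
      then have pos: "0 < \<gamma>'" using g by simp
      have "ln (\<gamma> / 4) \<le> ln \<gamma>'" using gg g by (subst ln_le_cancel_iff) (use pos in auto)
      moreover have "ln (\<gamma> / 4) = u + ln (1 / r) - ln 4" using r by (simp add: \<gamma>_def ln_div ln_mult)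
      moreover have "u = (\<delta> + sqrt (V / real n) * y) * real n - C2 * sqrt V"
      proof -
        have "u = real n * \<delta> + sqrt (V / real n) * real n * y - C2 * sqrt V"
          unfolding mid u_def using r(1) by (simp add: field_simps)
        then show ?thesis by (simp add: algebra_simps)
      qed
      ultimately have "(\<delta> + sqrt (V / real n) * y) * real n - (C2 * sqrt V + ln 4 + ln (real n) / 2) \<le> ln \<gamma>'" by (simp add: lnr)
      then have "((\<delta> + sqrt (V / real n) * y) * real n - (C2 * sqrt V + ln 4 + ln (real n) / 2)) / real n \<le> ln \<gamma>' / real n"
        by (intro divide_right_mono) auto
      moreover have "((\<delta> + sqrt (V / real n) * y) * real n - (C2 * sqrt V + ln 4 + ln (real n) / 2)) / real n = \<delta> + sqrt (V / real n) * y - E"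
        using n by (simp add: E_def diff_divide_distrib)
      ultimately have "\<delta> + sqrt (V / real n) * y - E \<le> NLD n L S" by (simp add: NLD_def g')
      then show ?thesis using S err pos g' by (intro bexI[of _ "ereal (NLD n L S)"]) auto
    qed
    have o1: "opt_NLD n L s2 \<epsilon> \<le> ereal (\<delta> + sqrt (V / real n) * y + E)" unfolding opt_NLD_def by (rule Sup_least) (rule upper)
    have o2: "ereal (\<delta> + sqrt (V / real n) * y - E) \<le> opt_NLD n L s2 \<epsilon>"
      unfolding opt_NLD_def using lower by (meson Sup_upper order_trans)
    \<comment> \<open>The supremum is taken in the extended reals; lying between two real bounds, it
      is finite.\<close>
    obtain d where d: "opt_NLD n L s2 \<epsilon> = ereal d" using o1 o2 by (cases "opt_NLD n L s2 \<epsilon>") auto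
    have "E \<le> C3 * ln (real n) / real n"
    proof -
      have "exp 1 \<le> real n" using exp_le n by (simp add: order_trans[of _ 3])
      then have ln1: "1 \<le> ln (real n)" using n by (simp add: ln_ge_iff)
      have "(C2 * sqrt V + ln 4) * 1 \<le> (C2 * sqrt V + ln 4) * ln (real n)" using ln1 C2(1) V by (intro mult_left_mono) auto
      then have "C2 * sqrt V + ln 4 + ln (real n) / 2 \<le> C3 * ln (real n)" by (simp add: C3_def algebra_simps)
      then show ?thesis unfolding E_def by (intro divide_right_mono) auto
    qed
    then have "\<bar>d - (\<delta> + sqrt (V / real n) * y)\<bar> \<le> C3 * ln (real n) / real n" using o1 o2 unfolding d by (simp add: abs_le_iff)
    then show ?case using d by blast
  qed
  then show ?thesis unfolding s2_def[symmetric] \<delta>_def V_def y_def by (intro exI[of _ C3]) simp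
qed

end
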